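(* Let $\mathbf{Inv}$ be the category of pseudogroups and callitic morphisms, and let $\mathbf{Etale}$ be the category of étale groupoids and continuous covering functors. Let $\mathsf{G}\colon \mathbf{Inv}^{op}\to\mathbf{Etale}$ be the functor sending a pseudogroup $S$ to the étale groupoid $\mathsf{G}(S)$ of completely prime filters of $S$ and sending a callitic morphism $\theta\colon S\to T$ to $\theta^{-1}\colon \mathsf{G}(T)\to\mathsf{G}(S)$, $F\mapsto\theta^{-1}(F)$. Let $\mathsf{B}\colon\mathbf{Etale}\to\mathbf{Inv}^{op}$ be the functor sending an étale groupoid $G$ to the pseudogroup $\mathsf{B}(G)$ of open bisections of $G$ and sending a continuous covering functor $\theta\colon G\to H$ to $\theta^{-1}\colon\mathsf{B}(H)\to\mathsf{B}(G)$, $U\mapsto\theta^{-1}(U)$. Then $\mathsf{G}$ is right adjoint to $\mathsf{B}$.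
   Context: Inverse semigroups carry their natural partial order. Elements $s,t$ are compatible if $s^{-1}t$ and $st^{-1}$ are idempotents; a subset is compatible if its elements are pairwise compatible. A pseudogroup is an inverse monoid in which every compatible subset has a join (so there is a zero, the empty join) and multiplication distributes over arbitrary compatible joins. Pseudogroups have all binary meets. A pseudogroup morphism is a semigroup homomorphism preserving compatible joins; it is a $\wedge$-morphism if it also preserves binary meets. A filter in an inverse semigroup is a non-empty subset $F$ that is upward closed and such that for all $a,b\in F$ there is $c\in F$ with $c\le a,b$; all filters are assumed proper, i.e. $0\notin F$. A filter $F$ in a pseudogroup is completely prime if $\bigvee_i a_i\in F$ implies $a_i\in F$ for some $i$. A function $\theta\colon S\to T$ between pseudogroups is callitic if it is a $\wedge$-morphism of pseudogroups and $F\cap\operatorname{im}(\theta)\ne\emptyset$ for every completely prime filter $F$ of $T$. For a subset $X$, $X^{\uparrow}$ is its upward closure. For a filter $A$ put $\mathbf{d}(A)=(A^{-1}A)^{\uparrow}$, $\mathbf{r}(A)=(AA^{-1})^{\uparrow}$; the product $A\cdot B=(AB)^{\uparrow}$ is defined iff $\mathbf{d}(A)=\mathbf{r}(B)$. With this partial product the set $\mathsf{G}(S)$ of completely prime filters of a pseudogroup $S$ is a groupoid, topologized with basis the sets $X_s=\{F\in\mathsf{G}(S): s\in F\}$, $s\in S$. A groupoid $G$ is identified with its set of arrows, $G_o$ is its set of identities, $\mathbf{d}(x)=x^{-1}x$, $\mathbf{r}(x)=xx^{-1}$. An étale groupoid is a topological groupoid whose domain map $\mathbf{d}\colon G\to G_o$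 is a local homeomorphism. A bisection is a subset $A\subseteq G$ with $A^{-1}A\subseteq G_o$ and $AA^{-1}\subseteq G_o$; $\mathsf{B}(G)$ is the set of open bisections under subset multiplication (its natural partial order is inclusion). A functor $\alpha\colon G\to H$ of groupoids is a covering functor if (i) $\mathbf{d}(g)=\mathbf{d}(g')$ and $\alpha(g)=\alpha(g')$ imply $g=g'$, and (ii) if $e$ is an identity with $\alpha(e)=\mathbf{d}(h)$ then there is $g\in G$ with $\mathbf{d}(g)=e$ and $\alpha(g)=h$. *)

theory Defs
  imports "HOL-Algebra.Coset" "HOL-Algebra.Lattice" "HOL-Analysis.Product_Topology"
begin

definition generalized_inverse :: "('a, 'm) monoid_scheme \<Rightarrow> 'a \<Rightarrow> 'a \<Rightarrow> bool"
  where "generalized_inverse S s t \<longleftrightarrow>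
    t \<in> carrier S \<and> s \<otimes>\<^bsub>S\<^esub> t \<otimes>\<^bsub>S\<^esub> s = s \<and> t \<otimes>\<^bsub>S\<^esub> s \<otimes>\<^bsub>S\<^esub> t = t"

locale inverse_monoid = monoid S for S (structure) +
  assumes ex1_inverse: "s \<in> carrier S \<Longrightarrow> \<exists>!t. generalized_inverse S s t"

text \<open>The inverse of an inverse semigroup; the library's \<^const>\<open>m_inv\<close> is the group inverse
  and is only meaningful for units.\<close>
definition sinv :: "('a, 'm) monoid_scheme \<Rightarrow> 'a \<Rightarrow> 'a"
  where "sinv S s = (THE t. generalized_inverse S s t)"

definition idems :: "('a, 'm) monoid_scheme \<Rightarrow> 'a set"
  where "idems S = {e \<in> carrier S. e \<otimes>\<^bsub>S\<^esub> e = e}"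

definition natural_order :: "('a, 'm) monoid_scheme \<Rightarrow> 'a gorder"
  where "natural_order S =
    \<lparr>carrier = carrier S, eq = (=), le = (\<lambda>s t. \<exists>e\<in>idems S. s = t \<otimes>\<^bsub>S\<^esub> e)\<rparr>"

definition compatible :: "('a, 'm) monoid_scheme \<Rightarrow> 'a set \<Rightarrow> bool"
  where "compatible S A \<longleftrightarrow> A \<subseteq> carrier S \<and>
    (\<forall>s\<in>A. \<forall>t\<in>A. sinv S s \<otimes>\<^bsub>S\<^esub> t \<in> idems S \<and> s \<otimes>\<^bsub>S\<^esub> sinv S t \<in> idems S)"

abbreviation is_join :: "('a, 'm) monoid_scheme \<Rightarrow> 'a \<Rightarrow> 'a set \<Rightarrow> bool"
  where "is_join S j A \<equiv> is_lub (natural_order S) j A"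

abbreviation is_meet :: "('a, 'm) monoid_scheme \<Rightarrow> 'a \<Rightarrow> 'a set \<Rightarrow> bool"
  where "is_meet S m A \<equiv> is_glb (natural_order S) m A"

text \<open>The empty set is compatible; its join is the zero, and the distributive laws for it say
  that this element is absorbing.\<close>
locale pseudogroup = inverse_monoid S for S (structure) +
  assumes ex_join: "compatible S A \<Longrightarrow> \<exists>j. is_join S j A"
    and distrib_left: "\<lbrakk>compatible S A; is_join S j A; s \<in> carrier S\<rbrakk>
      \<Longrightarrow> is_join S (s \<otimes> j) ((\<lambda>a. s \<otimes> a) ` A)"
    and distrib_right: "\<lbrakk>compatible S A; is_join S j A; s \<in> carrier S\<rbrakk>
      \<Longrightarrow> is_join S (j \<otimes> s) ((\<lambda>a. a \<otimes> s) ` A)"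

definition pg_filter :: "('a, 'm) monoid_scheme \<Rightarrow> 'a set \<Rightarrow> bool"
  where "pg_filter S F \<longleftrightarrow> F \<subseteq> carrier S \<and> F \<noteq> {} \<and>
    (\<forall>a\<in>F. \<forall>b\<in>carrier S. a \<sqsubseteq>\<^bsub>natural_order S\<^esub> b \<longrightarrow> b \<in> F) \<and>
    (\<forall>a\<in>F. \<forall>b\<in>F. \<exists>c\<in>F. c \<sqsubseteq>\<^bsub>natural_order S\<^esub> a \<and> c \<sqsubseteq>\<^bsub>natural_order S\<^esub> b) \<and>
    (\<forall>z. is_join S z {} \<longrightarrow> z \<notin> F)"

definition cp_filters :: "('a, 'm) monoid_scheme \<Rightarrow> 'a set set"
  where "cp_filters S = {F. pg_filter S F \<and>
    (\<forall>A j. compatible S A \<and> is_join S j A \<and> j \<in> F \<longrightarrow> (\<exists>a\<in>A. a \<in> F))}"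

text \<open>A semigroup homomorphism: the identity need not be preserved. The image of a compatible
  set is automatically compatible.\<close>
definition pg_morphism :: "('a, 'm) monoid_scheme \<Rightarrow> ('b, 'n) monoid_scheme \<Rightarrow> ('a \<Rightarrow> 'b) \<Rightarrow> bool"
  where "pg_morphism S T \<theta> \<longleftrightarrow> \<theta> \<in> hom S T \<and>
    (\<forall>A j. compatible S A \<and> is_join S j A \<longrightarrow> is_join T (\<theta> j) (\<theta> ` A))"

definition meet_morphism :: "('a, 'm) monoid_scheme \<Rightarrow> ('b, 'n) monoid_scheme \<Rightarrow> ('a \<Rightarrow> 'b) \<Rightarrow> bool"
  where "meet_morphism S T \<theta> \<longleftrightarrow> pg_morphism S T \<theta> \<and>
    (\<forall>a\<in>carrier S. \<forall>b\<in>carrier S. \<forall>m. is_meet S m {a, b} \<longrightarrow> is_meet T (\<theta> m) {\<theta> a, \<theta> b})"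

definition callitic :: "('a, 'm) monoid_scheme \<Rightarrow> ('b, 'n) monoid_scheme \<Rightarrow> ('a \<Rightarrow> 'b) \<Rightarrow> bool"
  where "callitic S T \<theta> \<longleftrightarrow> meet_morphism S T \<theta> \<and>
    (\<forall>F\<in>cp_filters T. F \<inter> \<theta> ` carrier S \<noteq> {})"

text \<open>The hom-sets consist of extensional functions, so that arrows are equal iff they
  agree on the carrier; the composite of \<open>f\<close> followed by \<open>g\<close> is \<open>compose (carrier _) g f\<close>
  and identities are \<open>restrict id (carrier _)\<close>.\<close>
definition Inv_hom :: "('a, 'm) monoid_scheme \<Rightarrow> ('b, 'n) monoid_scheme \<Rightarrow> ('a \<Rightarrow> 'b) set"
  where "Inv_hom S T = {\<theta> \<in> extensional (carrier S). callitic S T \<theta>}"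

text \<open>A groupoid is its set of arrows with a partial product: \<open>gmult\<close> is only meaningful on
  pairs with \<open>gdom x = gran y\<close>.\<close>
record 'a top_groupoid = "'a partial_object" +
  gmult :: "'a \<Rightarrow> 'a \<Rightarrow> 'a"  (infixl \<open>\<cdot>\<index>\<close> 70)
  ginv :: "'a \<Rightarrow> 'a"
  gtop :: "'a topology"

definition gdom :: "('a, 'm) top_groupoid_scheme \<Rightarrow> 'a \<Rightarrow> 'a"
  where "gdom G x = ginv G x \<cdot>\<^bsub>G\<^esub> x"

definition gran :: "('a, 'm) top_groupoid_scheme \<Rightarrow> 'a \<Rightarrow> 'a"
  where "gran G x = x \<cdot>\<^bsub>G\<^esub> ginv G x"

definition composable :: "('a, 'm) top_groupoid_scheme \<Rightarrow> ('a \<times> 'a) set"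
  where "composable G = {(x, y). x \<in> carrier G \<and> y \<in> carrier G \<and> gdom G x = gran G y}"

definition identities :: "('a, 'm) top_groupoid_scheme \<Rightarrow> 'a set"
  where "identities G = {e \<in> carrier G. gdom G e = e}"

locale groupoid = fixes G :: "('a, 'm) top_groupoid_scheme" (structure)
  assumes ginv_closed: "x \<in> carrier G \<Longrightarrow> ginv G x \<in> carrier G"
    and gdom_ginv: "x \<in> carrier G \<Longrightarrow> gdom G (ginv G x) = gran G x"
    and gran_ginv: "x \<in> carrier G \<Longrightarrow> gran G (ginv G x) = gdom G x"
    and gdom_gdom: "x \<in> carrier G \<Longrightarrow> gdom G (gdom G x) = gdom G x"
    and gran_gdom: "x \<in> carrier G \<Longrightarrow> gran G (gdom G x) = gdom G x"
    and gmult_closed: "(x, y) \<in> composable G \<Longrightarrow> x \<cdot> y \<in> carrier G"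
    and gdom_gmult: "(x, y) \<in> composable G \<Longrightarrow> gdom G (x \<cdot> y) = gdom G y"
    and gran_gmult: "(x, y) \<in> composable G \<Longrightarrow> gran G (x \<cdot> y) = gran G x"
    and gmult_assoc: "\<lbrakk>(x, y) \<in> composable G; (y, z) \<in> composable G\<rbrakk>
      \<Longrightarrow> (x \<cdot> y) \<cdot> z = x \<cdot> (y \<cdot> z)"
    and gmult_gdom: "x \<in> carrier G \<Longrightarrow> x \<cdot> gdom G x = x"
    and gran_gmult_self: "x \<in> carrier G \<Longrightarrow> gran G x \<cdot> x = x"

locale topological_groupoid = groupoid G for G (structure) +
  assumes topspace_gtop: "topspace (gtop G) = carrier G"
    and continuous_gmult: "continuous_map
      (subtopology (prod_topology (gtop G) (gtop G)) (composable G)) (gtop G) (\<lambda>(x, y). x \<cdot> y)"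
    and continuous_ginv: "continuous_map (gtop G) (gtop G) (ginv G)"

definition local_homeomorphism_map :: "'a topology \<Rightarrow> 'b topology \<Rightarrow> ('a \<Rightarrow> 'b) \<Rightarrow> bool"
  where "local_homeomorphism_map X Y f \<longleftrightarrow>
    (\<forall>x\<in>topspace X. \<exists>U. openin X U \<and> x \<in> U \<and> openin Y (f ` U) \<and>
      homeomorphic_map (subtopology X U) (subtopology Y (f ` U)) f)"

locale etale_groupoid = topological_groupoid G for G (structure) +
  assumes local_homeomorphism_gdom:
    "local_homeomorphism_map (gtop G) (subtopology (gtop G) (identities G)) (gdom G)"

definition gfunctor ::
    "('a, 'm) top_groupoid_scheme \<Rightarrow> ('b, 'n) top_groupoid_scheme \<Rightarrow> ('a \<Rightarrow> 'b) \<Rightarrow> bool"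
  where "gfunctor G H \<alpha> \<longleftrightarrow> \<alpha> \<in> carrier G \<rightarrow> carrier H \<and>
    (\<forall>x\<in>carrier G. gdom H (\<alpha> x) = \<alpha> (gdom G x) \<and> gran H (\<alpha> x) = \<alpha> (gran G x)) \<and>
    (\<forall>(x, y)\<in>composable G. \<alpha> (x \<cdot>\<^bsub>G\<^esub> y) = \<alpha> x \<cdot>\<^bsub>H\<^esub> \<alpha> y)"

definition covering_functor ::
    "('a, 'm) top_groupoid_scheme \<Rightarrow> ('b, 'n) top_groupoid_scheme \<Rightarrow> ('a \<Rightarrow> 'b) \<Rightarrow> bool"
  where "covering_functor G H \<alpha> \<longleftrightarrow> gfunctor G H \<alpha> \<and>
    (\<forall>g\<in>carrier G. \<forall>g'\<in>carrier G. gdom G g = gdom G g' \<and> \<alpha> g = \<alpha> g' \<longrightarrow> g = g') \<and>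
    (\<forall>e\<in>identities G. \<forall>h\<in>carrier H. \<alpha> e = gdom H h \<longrightarrow>
      (\<exists>g\<in>carrier G. gdom G g = e \<and> \<alpha> g = h))"

definition Etale_hom ::
    "('a, 'm) top_groupoid_scheme \<Rightarrow> ('b, 'n) top_groupoid_scheme \<Rightarrow> ('a \<Rightarrow> 'b) set"
  where "Etale_hom G H = {\<alpha> \<in> extensional (carrier G).
    continuous_map (gtop G) (gtop H) \<alpha> \<and> covering_functor G H \<alpha>}"

definition upclosure :: "('a, 'm) monoid_scheme \<Rightarrow> 'a set \<Rightarrow> 'a set"
  where "upclosure S X = {t \<in> carrier S. \<exists>x\<in>X. x \<sqsubseteq>\<^bsub>natural_order S\<^esub> t}"

text \<open>With these operations \<open>gdom\<close> and \<open>gran\<close> unfold to \<open>upclosure S (A\<inverse> A)\<close> and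
  \<open>upclosure S (A A\<inverse>)\<close>.\<close>
definition filter_groupoid :: "('a, 'm) monoid_scheme \<Rightarrow> 'a set top_groupoid"
  where "filter_groupoid S =
    \<lparr>carrier = cp_filters S,
     gmult = (\<lambda>A B. upclosure S (A <#>\<^bsub>S\<^esub> B)),
     ginv = (\<lambda>A. sinv S ` A),
     gtop = topology (arbitrary union_of
       (\<lambda>U. \<exists>s\<in>carrier S. U = {F \<in> cp_filters S. s \<in> F}))\<rparr>"

definition filter_map ::
    "('a, 'm) monoid_scheme \<Rightarrow> ('b, 'n) monoid_scheme \<Rightarrow> ('a \<Rightarrow> 'b) \<Rightarrow> 'b set \<Rightarrow> 'a set"
  where "filter_map S T \<theta> = (\<lambda>F\<in>cp_filters T. {s \<in> carrier S. \<theta> s \<in> F})"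

definition bisection_mult ::
    "('a, 'm) top_groupoid_scheme \<Rightarrow> 'a set \<Rightarrow> 'a set \<Rightarrow> 'a set"
  where "bisection_mult G A B =
    {a \<cdot>\<^bsub>G\<^esub> b |a b. a \<in> A \<and> b \<in> B \<and> (a, b) \<in> composable G}"

definition bisection :: "('a, 'm) top_groupoid_scheme \<Rightarrow> 'a set \<Rightarrow> bool"
  where "bisection G A \<longleftrightarrow> A \<subseteq> carrier G \<and>
    bisection_mult G (ginv G ` A) A \<subseteq> identities G \<and>
    bisection_mult G A (ginv G ` A) \<subseteq> identities G"

definition bisection_monoid :: "('a, 'm) top_groupoid_scheme \<Rightarrow> 'a set monoid"
  where "bisection_monoid G =
    \<lparr>carrier = {A. bisection G A \<and> openin (gtop G) A},
     mult = bisection_mult G,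
     one = identities G\<rparr>"

definition bisection_map ::
    "('a, 'm) top_groupoid_scheme \<Rightarrow> ('b, 'n) top_groupoid_scheme \<Rightarrow> ('a \<Rightarrow> 'b) \<Rightarrow> 'b set \<Rightarrow> 'a set"
  where "bisection_map G H \<alpha> =
    (\<lambda>U\<in>carrier (bisection_monoid H). {g \<in> carrier G. \<alpha> g \<in> U})"

text \<open>The correspondence between arrows \<open>B(G) \<rightarrow> S\<close> of the opposite of \<open>Inv\<close>, that is, callitic
  morphisms \<open>\<phi>\<close> from \<open>S\<close> to \<open>B(G)\<close>, and arrows \<open>G \<rightarrow> G(S)\<close> of \<open>Etale\<close>. As \<open>S\<close>, \<open>G\<close> and their images
  live in different types, the family of bijections has to be a polymorphic constant: it cannot be
  existentially quantified over all types at once.\<close>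
definition transpose_arrow ::
    "('a, 'm) monoid_scheme \<Rightarrow> ('b, 'n) top_groupoid_scheme \<Rightarrow> ('a \<Rightarrow> 'b set) \<Rightarrow> 'b \<Rightarrow> 'a set"
  where "transpose_arrow S G \<phi> = (\<lambda>g\<in>carrier G. {s \<in> carrier S. g \<in> \<phi> s})"

end

theory Submission
  imports Defs
begin

text \<open>Everything about a completely prime filter can be read off from one of its elements: if \<open>a \<in> A\<close>,
  then \<open>x \<in> \<^bold>d(A)\<close> iff \<open>a x \<in> A\<close>, and \<open>x \<in> A \<cdot> B\<close> iff \<open>a\<inverse> x \<in> B\<close>. Conversely, if \<open>a\<inverse> a \<in> \<^bold>r(B)\<close>, then
  \<open>{x. a\<inverse> x \<in> B}\<close> is a completely prime filter with the same domain as \<open>B\<close>. This makes \<open>\<^bold>d\<close> a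
  homeomorphism from each basic open set \<open>X\<^sub>a\<close> onto an open set of identities, and gives the
  lifting property of covering functors.

  In an etale groupoid the identities are open and a product of open bisections is open, so the
  open bisections form a pseudogroup ordered by inclusion, with unions as joins. The unit
  \<open>g \<mapsto> {A. g \<in> A}\<close> is a continuous covering functor \<open>G \<rightarrow> G(B(G))\<close> and the counit \<open>s \<mapsto> X\<^sub>s\<close> is a callitic
  morphism \<open>S \<rightarrow> B(G(S))\<close>. The transpose of \<open>\<phi>\<close> is \<open>\<phi>\<inverse>\<close> after the unit, and \<open>\<alpha>\<close> is the transpose of \<open>\<alpha>\<inverse>\<close>
  after the counit.\<close>

section \<open>Inverse monoids\<close>

text \<open>A completely prime filter of B(G) need not consist of the open bisections through one
  point, since G is not assumed sober. So the requirement that every such filter meets the image of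
  a morphism cannot be checked pointwise: a member of the filter is covered by suitable open sets,
  and primeness selects one of them. The unit is still star surjective, because a filter whose
  domain is the germ of an identity e has a member containing an arrow with domain e, and that arrow
  determines the filter. On the filter side the obstacle is that A \<cdot> B is an upward closure
  over all pairs of representatives. Fixing one representative of A turns each groupoid law into a
  computation in S; the price is one proof, by common lower bounds, that the choice is immaterial.
  The conditions on morphisms divide the work. Preservation of meets keeps preimages of filters
  directed, and meeting every filter keeps them non-empty. Star injectivity keeps preimages of
  bisections bisections, and star surjectivity makes taking preimages multiplicative.\<close>

lemma is_lub_natural_order_iff:
  assumes "A \<subseteq> carrier S"
  shows "is_join S j A \<longleftrightarrow> j \<in> carrier S \<and> (\<forall>a\<in>A. a \<sqsubseteq>\<^bsub>natural_order S\<^esub> j) \<and>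
    (\<forall>u\<in>carrier S. (\<forall>a\<in>A. a \<sqsubseteq>\<^bsub>natural_order S\<^esub> u) \<longrightarrow> j \<sqsubseteq>\<^bsub>natural_order S\<^esub> u)"
proof -
  have "carrier (natural_order S) = carrier S" by (simp add: natural_order_def)
  then show ?thesis
    using assms unfolding least_def Upper_def by (auto 0 3 simp: subset_iff)
qed

lemma is_glb_natural_order_iff:
  assumes "A \<subseteq> carrier S"
  shows "is_meet S j A \<longleftrightarrow> j \<in> carrier S \<and> (\<forall>a\<in>A. j \<sqsubseteq>\<^bsub>natural_order S\<^esub> a) \<and>
    (\<forall>u\<in>carrier S. (\<forall>a\<in>A. u \<sqsubseteq>\<^bsub>natural_order S\<^esub> a) \<longrightarrow> u \<sqsubseteq>\<^bsub>natural_order S\<^esub> j)"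
proof -
  have "carrier (natural_order S) = carrier S" by (simp add: natural_order_def)
  then show ?thesis
    using assms unfolding greatest_def Lower_def by (auto 0 3 simp: subset_iff)
qed

context inverse_monoid
begin

abbreviation nle (infix \<open>\<preceq>\<close> 50) where "s \<preceq> t \<equiv> s \<sqsubseteq>\<^bsub>natural_order S\<^esub> t"

lemma generalized_inverse_sinv: "s \<in> carrier S \<Longrightarrow> generalized_inverse S s (sinv S s)"
  unfolding sinv_def by (rule theI') (rule ex1_inverse)

lemma sinv_closed [simp]: "s \<in> carrier S \<Longrightarrow> sinv S s \<in> carrier S"
  using generalized_inverse_sinv by (simp add: generalized_inverse_def)

lemma mult_sinv_self [simp]:
  assumes "s \<in> carrier S" shows "s \<otimes> (sinv S s \<otimes> s) = s"
  using generalized_inverse_sinv[OF assms] assms by (simp add: generalized_inverse_def m_assoc)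

lemma sinv_mult_self [simp]:
  assumes "s \<in> carrier S" shows "sinv S s \<otimes> (s \<otimes> sinv S s) = sinv S s"
  using generalized_inverse_sinv[OF assms] assms by (simp add: generalized_inverse_def m_assoc)

lemma mult_sinv_self_left [simp]:
  assumes "s \<in> carrier S" "x \<in> carrier S" shows "s \<otimes> (sinv S s \<otimes> (s \<otimes> x)) = s \<otimes> x"
proof -
  have "s \<otimes> (sinv S s \<otimes> (s \<otimes> x)) = s \<otimes> (sinv S s \<otimes> s) \<otimes> x"
    using assms by (simp only: m_assoc sinv_closed m_closed)
  then show ?thesis using assms by simp
qed

lemma sinv_mult_self_left [simp]:
  assumes "s \<in> carrier S" "x \<in> carrier S"
  shows "sinv S s \<otimes> (s \<otimes> (sinv S s \<otimes> x)) = sinv S s \<otimes> x"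
proof -
  have "sinv S s \<otimes> (s \<otimes> (sinv S s \<otimes> x)) = sinv S s \<otimes> (s \<otimes> sinv S s) \<otimes> x"
    using assms by (simp only: m_assoc sinv_closed m_closed)
  then show ?thesis using assms by simp
qed

lemma sinv_eqI:
  assumes "s \<in> carrier S" "t \<in> carrier S" "s \<otimes> (t \<otimes> s) = s" "t \<otimes> (s \<otimes> t) = t"
  shows "sinv S s = t"
  unfolding sinv_def
  by (rule the1_equality[OF ex1_inverse[OF assms(1)]]) (use assms in \<open>simp add: generalized_inverse_def m_assoc\<close>)

lemma sinv_sinv [simp]: "s \<in> carrier S \<Longrightarrow> sinv S (sinv S s) = s"
  by (rule sinv_eqI) simp_all

lemma idemsI: "\<lbrakk>e \<in> carrier S; e \<otimes> e = e\<rbrakk> \<Longrightarrow> e \<in> idems S"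
  by (simp add: idems_def)

lemma idems_idem: "e \<in> idems S \<Longrightarrow> e \<otimes> e = e"
  by (simp add: idems_def)

lemma idems_closed: "e \<in> idems S \<Longrightarrow> e \<in> carrier S"
  by (simp add: idems_def)

declare idems_idem [simp] idems_closed [simp]

lemma idems_idem_left [simp]: "\<lbrakk>e \<in> idems S; x \<in> carrier S\<rbrakk> \<Longrightarrow> e \<otimes> (e \<otimes> x) = e \<otimes> x"
  by (metis idems_closed idems_idem m_assoc)

lemma sinv_idem [simp]: "e \<in> idems S \<Longrightarrow> sinv S e = e"
  by (rule sinv_eqI) simp_all

text \<open>If x is the inverse of e f, then f x e is an inverse of e f too, so x = f x e by
  uniqueness. This element is visibly idempotent, hence its own inverse, and so it equals e
  f.\<close>

lemma idems_mult_closed [simp]: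
  assumes "e \<in> idems S" "f \<in> idems S" shows "e \<otimes> f \<in> idems S"
proof -
  define x where "x = sinv S (e \<otimes> f)"
  have c: "e \<in> carrier S" "f \<in> carrier S" "x \<in> carrier S"
    using assms by (simp_all add: x_def)
  have 1: "e \<otimes> (f \<otimes> (x \<otimes> (e \<otimes> f))) = e \<otimes> f"
    using mult_sinv_self[of "e \<otimes> f"] c by (simp add: x_def[symmetric] m_assoc)
  have 2: "x \<otimes> (e \<otimes> (f \<otimes> x)) = x"
    using sinv_mult_self[of "e \<otimes> f"] c by (simp add: x_def[symmetric] m_assoc)
  have 3: "x \<otimes> (e \<otimes> (f \<otimes> (x \<otimes> e))) = x \<otimes> e"
  proof -
    have "x \<otimes> (e \<otimes> (f \<otimes> (x \<otimes> e))) = x \<otimes> (e \<otimes> (f \<otimes> x)) \<otimes> e"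
      using c by (simp only: m_assoc m_closed)
    then show ?thesis by (simp add: 2)
  qed
  have "sinv S (e \<otimes> f) = f \<otimes> (x \<otimes> e)"
    by (rule sinv_eqI) (simp_all add: assms c m_assoc 1 3)
  then have "x = f \<otimes> (x \<otimes> e)" by (simp only: x_def)
  moreover have "f \<otimes> (x \<otimes> e) \<in> idems S"
    using c by (intro idemsI) (simp_all add: m_assoc 3)
  ultimately have "x \<in> idems S" by simp
  then have "e \<otimes> f = x"
    using c sinv_sinv[of "e \<otimes> f"] by (simp add: x_def[symmetric])
  with \<open>x \<in> idems S\<close> show ?thesis by simp
qed

text \<open>Since e f and f e are idempotent, f e is an inverse of e f; but an idempotent is its own
  inverse.\<close>

lemma idems_commute:
  assumes "e \<in> idems S" "f \<in> idems S" shows "e \<otimes> f = f \<otimes> e"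
proof -
  note c = assms[THEN idems_closed]
  have ef: "e \<otimes> f \<in> idems S" and fe: "f \<otimes> e \<in> idems S" using assms by simp_all
  have 1: "e \<otimes> (f \<otimes> (e \<otimes> f)) = e \<otimes> f" using idems_idem[OF ef] c by (simp add: m_assoc)
  have 2: "f \<otimes> (e \<otimes> (f \<otimes> e)) = f \<otimes> e" using idems_idem[OF fe] c by (simp add: m_assoc)
  have "sinv S (e \<otimes> f) = f \<otimes> e"
    by (rule sinv_eqI) (use assms 1 2 in \<open>simp_all add: m_assoc\<close>)
  with ef show ?thesis by simp
qed

lemma idems_left_commute:
  assumes "e \<in> idems S" "f \<in> idems S" "x \<in> carrier S"
  shows "e \<otimes> (f \<otimes> x) = f \<otimes> (e \<otimes> x)"
  using assms idems_commute by (metis idems_closed m_assoc)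

lemma sinv_mult_idem [simp]: "s \<in> carrier S \<Longrightarrow> sinv S s \<otimes> s \<in> idems S"
  by (rule idemsI) (simp_all add: m_assoc)

lemma mult_sinv_idem [simp]: "s \<in> carrier S \<Longrightarrow> s \<otimes> sinv S s \<in> idems S"
  by (rule idemsI) (simp_all add: m_assoc)

text \<open>Both inverse equations reduce to exchanging the commuting idempotents s^-1 s and t
  t^-1.\<close>

lemma sinv_mult:
  assumes s: "s \<in> carrier S" and t: "t \<in> carrier S"
  shows "sinv S (s \<otimes> t) = sinv S t \<otimes> sinv S s"
proof (rule sinv_eqI)
  let ?e = "sinv S s \<otimes> s" and ?f = "t \<otimes> sinv S t"
  have c: "?e \<otimes> ?f = ?f \<otimes> ?e" using s t by (intro idems_commute) simp_all
  have "s \<otimes> t \<otimes> (sinv S t \<otimes> sinv S s \<otimes> (s \<otimes> t)) = s \<otimes> (?f \<otimes> ?e) \<otimes> t"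
    using s t by (simp add: m_assoc)
  also have "\<dots> = s \<otimes> (?e \<otimes> ?f) \<otimes> t" by (simp only: c)
  also have "\<dots> = s \<otimes> t" using s t by (simp add: m_assoc)
  finally show "s \<otimes> t \<otimes> (sinv S t \<otimes> sinv S s \<otimes> (s \<otimes> t)) = s \<otimes> t" .
  have "sinv S t \<otimes> sinv S s \<otimes> (s \<otimes> t \<otimes> (sinv S t \<otimes> sinv S s))
      = sinv S t \<otimes> (?e \<otimes> ?f) \<otimes> sinv S s"
    using s t by (simp add: m_assoc)
  also have "\<dots> = sinv S t \<otimes> (?f \<otimes> ?e) \<otimes> sinv S s" by (simp only: c)
  also have "\<dots> = sinv S t \<otimes> sinv S s" using s t by (simp add: m_assoc)
  finally show "sinv S t \<otimes> sinv S s \<otimes> (s \<otimes> t \<otimes> (sinv S t \<otimes> sinv S s))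
      = sinv S t \<otimes> sinv S s" .
qed (use s t in simp_all)

lemma conj_idem:
  assumes e: "e \<in> idems S" and s: "s \<in> carrier S"
  shows "s \<otimes> (e \<otimes> sinv S s) \<in> idems S"
proof -
  have "s \<otimes> (e \<otimes> sinv S s) = (s \<otimes> e) \<otimes> sinv S (s \<otimes> e)"
    using e s by (simp add: sinv_mult m_assoc)
  then show ?thesis using e s by simp
qed

text \<open>Since e commutes with s^-1 s, it can be carried to the left of s by conjugation. This
  makes the one-sided definition of the natural order symmetric.\<close>

lemma idem_swap:
  assumes e: "e \<in> idems S" and s: "s \<in> carrier S"
  shows "s \<otimes> e = s \<otimes> (e \<otimes> sinv S s) \<otimes> s"
proof -
  have "s \<otimes> (e \<otimes> sinv S s) \<otimes> s = s \<otimes> (e \<otimes> (sinv S s \<otimes> s))"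
    using e s by (simp add: m_assoc)
  also have "\<dots> = s \<otimes> ((sinv S s \<otimes> s) \<otimes> e)" using e s idems_commute by simp
  also have "\<dots> = s \<otimes> e" using e s by (simp add: m_assoc)
  finally show ?thesis by simp
qed

section \<open>The natural partial order and compatible sets\<close>

lemma nle_iff: "s \<preceq> t \<longleftrightarrow> (\<exists>e\<in>idems S. s = t \<otimes> e)"
  by (simp add: natural_order_def)

lemma nleI: "e \<in> idems S \<Longrightarrow> t \<otimes> e \<preceq> t"
  by (auto simp: nle_iff)

lemma nleI_left:
  assumes e: "e \<in> idems S" and t: "t \<in> carrier S" shows "e \<otimes> t \<preceq> t"
proof -
  \<comment> \<open>The witness is t^-1 e t, with t written as a double inverse so that
    \<open>conj_idem\<close> applies.\<close>
  have "sinv S t \<otimes> (e \<otimes> sinv S (sinv S t)) \<in> idems S" using e t by (intro conj_idem) simp_all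
  moreover have "t \<otimes> (sinv S t \<otimes> (e \<otimes> t)) = e \<otimes> t"
    using idems_left_commute[of "t \<otimes> sinv S t" e t] e t by (simp add: m_assoc)
  ultimately show ?thesis using t unfolding nle_iff by (metis sinv_sinv)
qed

lemma nle_iff_left:
  assumes "t \<in> carrier S" shows "s \<preceq> t \<longleftrightarrow> (\<exists>e\<in>idems S. s = e \<otimes> t)"
proof
  assume "s \<preceq> t"
  then obtain e where "e \<in> idems S" "s = t \<otimes> e" using nle_iff by auto
  then show "\<exists>e\<in>idems S. s = e \<otimes> t"
    using assms idem_swap[of e t] conj_idem[of e t] by (intro bexI[of _ "t \<otimes> (e \<otimes> sinv S t)"]) simp_all
qed (use assms nleI_left in auto)

lemma nle_closed: "\<lbrakk>s \<preceq> t; t \<in> carrier S\<rbrakk> \<Longrightarrow> s \<in> carrier S"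
  by (auto simp: nle_iff)

lemma one_idem [simp]: "\<one> \<in> idems S"
  by (rule idemsI) simp_all

lemma nle_refl [simp]: "s \<in> carrier S \<Longrightarrow> s \<preceq> s"
  using nleI[of \<one> s] by simp

lemma nle_trans: "\<lbrakk>s \<preceq> t; t \<preceq> u; u \<in> carrier S\<rbrakk> \<Longrightarrow> s \<preceq> u"
  by (auto simp: nle_iff m_assoc intro!: bexI[OF _ idems_mult_closed])

lemma nle_mult_right:
  assumes "s \<preceq> t" "t \<in> carrier S" "u \<in> carrier S" shows "s \<otimes> u \<preceq> t \<otimes> u"
proof -
  obtain e where "e \<in> idems S" "s = e \<otimes> t" using assms nle_iff_left by auto
  then show ?thesis using assms nleI_left[of e "t \<otimes> u"] by (simp add: m_assoc)
qed

lemma nle_mult_left: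
  assumes "s \<preceq> t" "t \<in> carrier S" "u \<in> carrier S" shows "u \<otimes> s \<preceq> u \<otimes> t"
proof -
  obtain e where "e \<in> idems S" "s = t \<otimes> e" using assms nle_iff by auto
  then show ?thesis using assms nleI[of e "u \<otimes> t"] by (simp add: m_assoc)
qed

lemma nle_mult:
  assumes "s \<preceq> t" "u \<preceq> v" "t \<in> carrier S" "v \<in> carrier S" shows "s \<otimes> u \<preceq> t \<otimes> v"
proof -
  have "s \<otimes> u \<preceq> t \<otimes> u" "t \<otimes> u \<preceq> t \<otimes> v"
    using assms nle_closed nle_mult_left nle_mult_right by auto
  then show ?thesis using assms nle_trans m_closed by blast
qed

lemma nle_sinv:
  assumes "s \<preceq> t" "t \<in> carrier S" shows "sinv S s \<preceq> sinv S t"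
proof -
  obtain e where "e \<in> idems S" "s = t \<otimes> e" using assms nle_iff by auto
  then show ?thesis using assms nleI_left[of e "sinv S t"] by (simp add: sinv_mult)
qed

lemma nle_idem: "\<lbrakk>s \<preceq> e; e \<in> idems S\<rbrakk> \<Longrightarrow> s \<in> idems S"
  by (auto simp: nle_iff)

lemma nle_mult_sinv_mult: "\<lbrakk>s \<in> carrier S; x \<in> carrier S\<rbrakk> \<Longrightarrow> s \<otimes> (sinv S s \<otimes> x) \<preceq> x"
  using nleI_left[of "s \<otimes> sinv S s" x] by (simp add: m_assoc)

lemma nle_sinv_mult_mult: "\<lbrakk>s \<in> carrier S; x \<in> carrier S\<rbrakk> \<Longrightarrow> sinv S s \<otimes> (s \<otimes> x) \<preceq> x"
  using nleI_left[of "sinv S s \<otimes> s" x] by (simp add: m_assoc)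

text \<open>For s and t below b, s^-1 t lies below the idempotent b^-1 b, and everything below an
  idempotent is idempotent. This makes joins available for any family with a common upper
  bound.\<close>

lemma bounded_compatible:
  assumes b: "b \<in> carrier S" and A: "\<And>a. a \<in> A \<Longrightarrow> a \<preceq> b"
  shows "compatible S A"
  unfolding compatible_def
proof (intro conjI ballI)
  show "A \<subseteq> carrier S" using A b nle_closed by blast
  fix s t assume "s \<in> A" "t \<in> A"
  then have st: "s \<preceq> b" "t \<preceq> b" using A by auto
  then have c: "s \<in> carrier S" "t \<in> carrier S" using b nle_closed by auto
  have "sinv S s \<otimes> t \<preceq> sinv S b \<otimes> b" "s \<otimes> sinv S t \<preceq> b \<otimes> sinv S b"
    using st b by (auto intro: nle_mult nle_sinv)
  then show "sinv S s \<otimes> t \<in> idems S" "s \<otimes> sinv S t \<in> idems S"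
    using b nle_idem by auto
qed

lemma compatible_subset: "compatible S A \<Longrightarrow> A \<subseteq> carrier S"
  by (simp add: compatible_def)

lemma compatible_sinv:
  assumes "compatible S A" shows "compatible S (sinv S ` A)"
  using assms unfolding compatible_def by (auto simp: subset_iff)

text \<open>Inversion is an involution that preserves the natural order, hence an order
  automorphism.\<close>

lemma is_join_sinv:
  assumes A: "A \<subseteq> carrier S" and j: "is_join S j A"
  shows "is_join S (sinv S j) (sinv S ` A)"
proof -
  have "sinv S ` A \<subseteq> carrier S" using A by auto
  moreover have "sinv S j \<preceq> u" if u: "u \<in> carrier S" "\<forall>a\<in>A. sinv S a \<preceq> u" for u
  proof -
    have "a \<preceq> sinv S u" if "a \<in> A" for a
      using nle_sinv[of "sinv S a" u] u that A by auto
    then have "j \<preceq> sinv S u" using j u A by (simp add: is_lub_natural_order_iff)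
    then show ?thesis using nle_sinv u by fastforce
  qed
  ultimately show ?thesis
    using j by (auto simp: is_lub_natural_order_iff A intro!: nle_sinv)
qed

text \<open>The product (s a)^-1 (s b) lies below a^-1 b, while (s a)(s b)^-1 is the conjugate by s
  of the idempotent a b^-1.\<close>

lemma compatible_mult_left:
  assumes A: "compatible S A" and s: "s \<in> carrier S"
  shows "compatible S ((\<lambda>a. s \<otimes> a) ` A)"
  unfolding compatible_def
proof (intro conjI ballI)
  have c: "A \<subseteq> carrier S" using A compatible_subset by auto
  then show "(\<lambda>a. s \<otimes> a) ` A \<subseteq> carrier S" using s by auto
  fix x y assume "x \<in> (\<lambda>a. s \<otimes> a) ` A" "y \<in> (\<lambda>a. s \<otimes> a) ` A"
  then obtain a b where ab: "a \<in> A" "b \<in> A" "x = s \<otimes> a" "y = s \<otimes> b" by auto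
  then have c: "a \<in> carrier S" "b \<in> carrier S" using c by auto
  have "sinv S a \<otimes> b \<in> idems S" "a \<otimes> sinv S b \<in> idems S"
    using A ab by (auto simp: compatible_def)
  then have "s \<otimes> ((a \<otimes> sinv S b) \<otimes> sinv S s) \<in> idems S"
    "sinv S a \<otimes> (sinv S s \<otimes> (s \<otimes> b)) \<preceq> sinv S a \<otimes> b"
    using s c conj_idem by (auto intro: nle_mult_left nle_sinv_mult_mult)
  then show "sinv S x \<otimes> y \<in> idems S" "x \<otimes> sinv S y \<in> idems S"
    using ab c s \<open>sinv S a \<otimes> b \<in> idems S\<close> nle_idem by (auto simp: sinv_mult m_assoc)
qed

end

section \<open>Homomorphisms of inverse monoids\<close>

lemma hom_sinv:
  assumes S: "inverse_monoid S" and T: "inverse_monoid T" and h: "h \<in> hom S T" and s: "s \<in> carrier S"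
  shows "h (sinv S s) = sinv T (h s)"
proof -
  interpret S: inverse_monoid S by fact
  interpret T: inverse_monoid T by fact
  have c: "x \<in> carrier S \<Longrightarrow> h x \<in> carrier T" for x using h by (auto simp: hom_def)
  have m: "\<lbrakk>x \<in> carrier S; y \<in> carrier S\<rbrakk> \<Longrightarrow> h x \<otimes>\<^bsub>T\<^esub> h y = h (x \<otimes>\<^bsub>S\<^esub> y)" for x y
    using h by (auto simp: hom_def)
  show ?thesis
    by (rule T.sinv_eqI[symmetric]) (use s in \<open>simp_all add: c m\<close>)
qed

lemma hom_idems:
  assumes "h \<in> hom S T" "e \<in> idems S" shows "h e \<in> idems T"
  using assms unfolding idems_def hom_def by (auto; metis)

lemma hom_nle:
  assumes "h \<in> hom S T" "s \<sqsubseteq>\<^bsub>natural_order S\<^esub> t" "t \<in> carrier S"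
  shows "h s \<sqsubseteq>\<^bsub>natural_order T\<^esub> h t"
proof -
  obtain e where e: "e \<in> idems S" "s = t \<otimes>\<^bsub>S\<^esub> e" using assms by (auto simp: natural_order_def)
  then have "h s = h t \<otimes>\<^bsub>T\<^esub> h e" using assms by (auto simp: hom_def idems_def)
  then show ?thesis using hom_idems[OF assms(1) e(1)] by (auto simp: natural_order_def)
qed

lemma hom_compatible:
  assumes S: "inverse_monoid S" and T: "inverse_monoid T" and h: "h \<in> hom S T" and A: "compatible S A"
  shows "compatible T (h ` A)"
proof -
  interpret S: inverse_monoid S by fact
  have sub: "A \<subseteq> carrier S" using A by (simp add: compatible_def)
  have "sinv T (h s) \<otimes>\<^bsub>T\<^esub> h t \<in> idems T \<and> h s \<otimes>\<^bsub>T\<^esub> sinv T (h t) \<in> idems T" if "s \<in> A" "t \<in> A" for s t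
  proof -
    have c: "s \<in> carrier S" "t \<in> carrier S" using sub that by auto
    have "sinv T (h s) \<otimes>\<^bsub>T\<^esub> h t = h (sinv S s \<otimes>\<^bsub>S\<^esub> t)" "h s \<otimes>\<^bsub>T\<^esub> sinv T (h t) = h (s \<otimes>\<^bsub>S\<^esub> sinv S t)"
      using hom_sinv[OF S T h] c h by (simp_all add: hom_mult)
    then show ?thesis using hom_idems[OF h] A that by (simp add: compatible_def)
  qed
  then show ?thesis using sub h by (auto simp: compatible_def hom_def)
qed

section \<open>Completely prime filters\<close>

context pseudogroup
begin

text \<open>The meet is built as the join of all common lower bounds, a set that is compatible
  because it is bounded by \<open>a\<close>.\<close>

lemma ex_meet:
  assumes "a \<in> carrier S" "b \<in> carrier S" shows "\<exists>m. is_meet S m {a, b}"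
proof -
  let ?L = "{c \<in> carrier S. c \<preceq> a \<and> c \<preceq> b}"
  have "compatible S ?L" using assms by (intro bounded_compatible[of a]) auto
  then obtain m where "is_join S m ?L" using ex_join by auto
  then have "is_meet S m {a, b}"
    using assms by (subst is_glb_natural_order_iff) (auto simp: is_lub_natural_order_iff)
  then show ?thesis ..
qed

text \<open>Properness is primeness for the empty join.\<close>

lemma cp_filters_iff:
  "F \<in> cp_filters S \<longleftrightarrow> F \<subseteq> carrier S \<and> F \<noteq> {} \<and>
    (\<forall>a\<in>F. \<forall>b\<in>carrier S. a \<preceq> b \<longrightarrow> b \<in> F) \<and>
    (\<forall>a\<in>F. \<forall>b\<in>F. \<exists>c\<in>F. c \<preceq> a \<and> c \<preceq> b) \<and>
    (\<forall>A j. compatible S A \<and> is_join S j A \<and> j \<in> F \<longrightarrow> (\<exists>a\<in>A. a \<in> F))"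
proof -
  have "compatible S {}" by (simp add: compatible_def)
  then show ?thesis unfolding cp_filters_def pg_filter_def by blast
qed

lemma cp_closed: "\<lbrakk>F \<in> cp_filters S; x \<in> F\<rbrakk> \<Longrightarrow> x \<in> carrier S"
  unfolding cp_filters_iff by blast

lemma cp_up: "\<lbrakk>F \<in> cp_filters S; a \<in> F; a \<preceq> b; b \<in> carrier S\<rbrakk> \<Longrightarrow> b \<in> F"
  unfolding cp_filters_iff by blast

lemma cp_down:
  assumes "F \<in> cp_filters S" "a \<in> F" "b \<in> F"
  obtains c where "c \<in> F" "c \<preceq> a" "c \<preceq> b"
  using assms unfolding cp_filters_iff by blast

lemma cp_nonempty:
  assumes "F \<in> cp_filters S" obtains a where "a \<in> F" "a \<in> carrier S"
  using assms unfolding cp_filters_iff by blast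

lemma cp_prime:
  assumes "F \<in> cp_filters S" "compatible S A" "is_join S j A" "j \<in> F"
  obtains a where "a \<in> A" "a \<in> F"
  using assms unfolding cp_filters_iff by blast

lemma cp_meet_iff:
  assumes F: "F \<in> cp_filters S" and m: "is_meet S m {a, b}" and c: "a \<in> carrier S" "b \<in> carrier S"
  shows "m \<in> F \<longleftrightarrow> a \<in> F \<and> b \<in> F"
proof -
  have m': "m \<in> carrier S" "m \<preceq> a" "m \<preceq> b" "\<And>u. \<lbrakk>u \<in> carrier S; u \<preceq> a; u \<preceq> b\<rbrakk> \<Longrightarrow> u \<preceq> m"
    using m c by (auto simp: is_glb_natural_order_iff)
  show ?thesis
  proof
    assume "m \<in> F" then show "a \<in> F \<and> b \<in> F" using cp_up[OF F] m' c by blast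
  next
    assume "a \<in> F \<and> b \<in> F"
    then obtain c where "c \<in> F" "c \<preceq> a" "c \<preceq> b" using cp_down[OF F] by blast
    then show "m \<in> F" using cp_up[OF F] m' cp_closed[OF F] by blast
  qed
qed

section \<open>Domain, range and product of completely prime filters\<close>

abbreviation FG where "FG \<equiv> filter_groupoid S"

lemma carrier_FG [simp]: "carrier FG = cp_filters S"
  by (simp add: filter_groupoid_def)

lemma ginv_FG: "ginv FG A = sinv S ` A"
  by (simp add: filter_groupoid_def)

lemma mem_gmult_FG: "x \<in> A \<cdot>\<^bsub>FG\<^esub> B \<longleftrightarrow> x \<in> carrier S \<and> (\<exists>a\<in>A. \<exists>b\<in>B. a \<otimes> b \<preceq> x)"
  by (auto simp: filter_groupoid_def upclosure_def set_mult_def)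

lemma mem_sinv_image:
  assumes "A \<subseteq> carrier S"
  shows "x \<in> sinv S ` A \<longleftrightarrow> x \<in> carrier S \<and> sinv S x \<in> A"
  using assms by (metis (no_types, lifting) imageE image_eqI sinv_closed sinv_sinv subsetD)

lemma sinv_image_image: "A \<subseteq> carrier S \<Longrightarrow> sinv S ` sinv S ` A = A"
  by (force simp: image_image)

lemma cp_subset: "F \<in> cp_filters S \<Longrightarrow> F \<subseteq> carrier S"
  unfolding cp_filters_iff by blast

text \<open>If b^-1 c \<le> x with b, c in F, take d in F below a, b and c: then d^-1 d \<le> x, so
  d = d d^-1 d \<le> a x. Conversely a^-1 (a x) \<le> x. As \<open>a\<close> is arbitrary, the test
  may be run at whichever member of F is convenient.\<close>

lemma mem_gdom_FG:
  assumes F: "F \<in> cp_filters S" and a: "a \<in> F"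
  shows "x \<in> gdom FG F \<longleftrightarrow> x \<in> carrier S \<and> a \<otimes> x \<in> F"
proof
  have ac: "a \<in> carrier S" using cp_closed F a by auto
  assume "x \<in> gdom FG F"
  then obtain b c where x: "x \<in> carrier S" and bc: "b \<in> F" "c \<in> F" "sinv S b \<otimes> c \<preceq> x"
    by (auto simp: gdom_def mem_gmult_FG ginv_FG)
  then have c: "b \<in> carrier S" "c \<in> carrier S" using F cp_closed by auto
  obtain d where d: "d \<in> F" "d \<preceq> b" "d \<preceq> c" "d \<preceq> a"
    using cp_down[OF F bc(1,2)] cp_down[OF F _ a] nle_trans c by metis
  have dc: "d \<in> carrier S" using cp_closed F d by auto
  have "sinv S d \<otimes> d \<preceq> sinv S b \<otimes> c" using d c by (intro nle_mult nle_sinv) auto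
  then have "sinv S d \<otimes> d \<preceq> x" using bc(3) x by (rule nle_trans)
  then have "d \<otimes> (sinv S d \<otimes> d) \<preceq> a \<otimes> x" using d x ac by (intro nle_mult)
  then show "x \<in> carrier S \<and> a \<otimes> x \<in> F" using cp_up[OF F d(1)] dc x ac by simp
next
  assume x: "x \<in> carrier S \<and> a \<otimes> x \<in> F"
  have ac: "a \<in> carrier S" using cp_closed F a by auto
  then have "sinv S a \<otimes> (a \<otimes> x) \<preceq> x" using x nle_sinv_mult_mult by simp
  then show "x \<in> gdom FG F" using x a by (auto simp: gdom_def mem_gmult_FG ginv_FG)
qed

text \<open>The mirror image of \<open>mem_gdom_FG\<close>, with d = d d^-1 d \<le> x a.\<close>

lemma mem_gran_FG:
  assumes F: "F \<in> cp_filters S" and a: "a \<in> F"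
  shows "x \<in> gran FG F \<longleftrightarrow> x \<in> carrier S \<and> x \<otimes> a \<in> F"
proof
  have ac: "a \<in> carrier S" using cp_closed F a by auto
  assume "x \<in> gran FG F"
  then obtain b c where x: "x \<in> carrier S" and bc: "b \<in> F" "c \<in> F" "b \<otimes> sinv S c \<preceq> x"
    by (auto simp: gran_def mem_gmult_FG ginv_FG)
  then have c: "b \<in> carrier S" "c \<in> carrier S" using F cp_closed by auto
  obtain d where d: "d \<in> F" "d \<preceq> b" "d \<preceq> c" "d \<preceq> a"
    using cp_down[OF F bc(1,2)] cp_down[OF F _ a] nle_trans c by metis
  have dc: "d \<in> carrier S" using cp_closed F d by auto
  have "d \<otimes> sinv S d \<preceq> b \<otimes> sinv S c" using d c by (intro nle_mult nle_sinv) auto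
  then have "d \<otimes> sinv S d \<preceq> x" using bc(3) x by (rule nle_trans)
  then have "d \<otimes> sinv S d \<otimes> d \<preceq> x \<otimes> a" using d x ac by (intro nle_mult)
  then show "x \<in> carrier S \<and> x \<otimes> a \<in> F" using cp_up[OF F d(1)] dc x ac by (simp add: m_assoc)
next
  assume x: "x \<in> carrier S \<and> x \<otimes> a \<in> F"
  have ac: "a \<in> carrier S" using cp_closed F a by auto
  then have "x \<otimes> (a \<otimes> sinv S a) \<preceq> x" using nleI by simp
  then have "x \<otimes> a \<otimes> sinv S a \<preceq> x" using x ac by (simp add: m_assoc)
  then show "x \<in> gran FG F" using x a by (auto simp: gran_def mem_gmult_FG ginv_FG)
qed

lemma sinv_mult_in_gdom: "\<lbrakk>F \<in> cp_filters S; a \<in> F\<rbrakk> \<Longrightarrow> sinv S a \<otimes> a \<in> gdom FG F"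
  using mem_gdom_FG cp_closed by (metis m_closed mult_sinv_self sinv_closed)

lemma mult_sinv_in_gran: "\<lbrakk>F \<in> cp_filters S; a \<in> F\<rbrakk> \<Longrightarrow> a \<otimes> sinv S a \<in> gran FG F"
  using mem_gran_FG cp_closed by (metis m_closed mult_sinv_self sinv_closed m_assoc)

text \<open>The element a a^-1 belongs to the range of F, and this membership can be tested at the
  representative x instead of a. The cancellation recovers F from its domain and one member.\<close>

lemma cp_mult_sinv_mult_iff:
  assumes F: "F \<in> cp_filters S" and a: "a \<in> F" and x: "x \<in> carrier S"
  shows "a \<otimes> (sinv S a \<otimes> x) \<in> F \<longleftrightarrow> x \<in> F"
proof
  have ac: "a \<in> carrier S" using cp_closed F a by auto
  show "a \<otimes> (sinv S a \<otimes> x) \<in> F \<Longrightarrow> x \<in> F" using cp_up[OF F] nle_mult_sinv_mult ac x by blast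
  assume "x \<in> F"
  then have "a \<otimes> sinv S a \<otimes> x \<in> F" using mult_sinv_in_gran[OF F a] mem_gran_FG[OF F] by blast
  then show "a \<otimes> (sinv S a \<otimes> x) \<in> F" using ac x by (simp add: m_assoc)
qed

text \<open>If a^-1 a lies in the range of B, this is the upward closure of the coset a B.
  Describing it by division by a makes membership a single test in B rather than an existential
  statement.\<close>

definition translate :: "'a \<Rightarrow> 'a set \<Rightarrow> 'a set"
  where "translate a B = {x \<in> carrier S. sinv S a \<otimes> x \<in> B}"

lemma mem_translate: "x \<in> translate a B \<longleftrightarrow> x \<in> carrier S \<and> sinv S a \<otimes> x \<in> B"
  by (simp add: translate_def)

lemma mult_in_translate:
  assumes B: "B \<in> cp_filters S" and a: "a \<in> carrier S" "sinv S a \<otimes> a \<in> gran FG B" and b: "b \<in> B"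
  shows "a \<otimes> b \<in> translate a B"
proof -
  have "sinv S a \<otimes> a \<otimes> b \<in> B" using mem_gran_FG[OF B b] a by simp
  then show ?thesis using a b cp_closed[OF B] by (simp add: mem_translate m_assoc)
qed

text \<open>For c below a^-1 x and a^-1 y, the product a c is a common lower bound of x and y.
  Primeness transfers because left multiplication by a^-1 preserves compatible joins.\<close>

lemma translate_cp_filter:
  assumes B: "B \<in> cp_filters S" and a: "a \<in> carrier S" "sinv S a \<otimes> a \<in> gran FG B"
  shows "translate a B \<in> cp_filters S"
  unfolding cp_filters_iff
proof (intro conjI ballI allI impI)
  obtain b where "b \<in> B" using cp_nonempty B by blast
  then show "translate a B \<noteq> {}" using mult_in_translate[OF B a] by blast
  show "translate a B \<subseteq> carrier S" by (auto simp: mem_translate)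
  fix x y assume x: "x \<in> translate a B"
  { assume "y \<in> carrier S" "x \<preceq> y"
    then show "y \<in> translate a B"
      using x a cp_up[OF B] nle_mult_left[of x y "sinv S a"] by (auto simp: mem_translate) }
  { assume y: "y \<in> translate a B"
    then obtain c where c: "c \<in> B" "c \<preceq> sinv S a \<otimes> x" "c \<preceq> sinv S a \<otimes> y"
      using x cp_down[OF B] by (auto simp: mem_translate)
    then have cc: "c \<in> carrier S" using cp_closed B by auto
    have "a \<otimes> c \<preceq> z" if "z \<in> carrier S" "c \<preceq> sinv S a \<otimes> z" for z
    proof -
      have "a \<otimes> c \<preceq> a \<otimes> (sinv S a \<otimes> z)" using that a by (intro nle_mult_left) auto
      then show ?thesis using nle_mult_sinv_mult a that nle_trans by blast
    qed
    then have "a \<otimes> c \<preceq> x" "a \<otimes> c \<preceq> y" using x y c by (auto simp: mem_translate)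
    then show "\<exists>c\<in>translate a B. c \<preceq> x \<and> c \<preceq> y"
      using mult_in_translate[OF B a c(1)] by blast }
next
  fix A j assume h: "compatible S A \<and> is_join S j A \<and> j \<in> translate a B"
  then have "is_join S (sinv S a \<otimes> j) ((\<lambda>x. sinv S a \<otimes> x) ` A)"
    "compatible S ((\<lambda>x. sinv S a \<otimes> x) ` A)" "sinv S a \<otimes> j \<in> B"
    using distrib_left compatible_mult_left a by (auto simp: mem_translate)
  then obtain y where "y \<in> (\<lambda>x. sinv S a \<otimes> x) ` A" "y \<in> B" using cp_prime[OF B] by blast
  then show "\<exists>x\<in>A. x \<in> translate a B"
    using h compatible_subset by (auto simp: mem_translate)
qed

text \<open>With b in B, the translate contains a b, and testing x at a b asks whether (a^-1 a b) x
  lies in B. Since a^-1 a b is itself a member of B, this is the domain test for B.\<close>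

lemma gdom_translate:
  assumes B: "B \<in> cp_filters S" and a: "a \<in> carrier S" "sinv S a \<otimes> a \<in> gran FG B"
  shows "gdom FG (translate a B) = gdom FG B"
proof -
  obtain b where b: "b \<in> B" "b \<in> carrier S" using cp_nonempty B by blast
  then have "sinv S a \<otimes> a \<otimes> b \<in> B" using mem_gran_FG[OF B] a by blast
  then show ?thesis
    using a b by (auto simp: mem_gdom_FG[OF translate_cp_filter[OF assms] mult_in_translate[OF assms b(1)]]
        mem_gdom_FG[OF B] mem_translate m_assoc)
qed

lemma gmult_eq_translate:
  assumes A: "A \<in> cp_filters S" and B: "B \<in> cp_filters S" and AB: "gdom FG A = gran FG B"
    and a: "a \<in> A"
  shows "A \<cdot>\<^bsub>FG\<^esub> B = translate a B"
proof (rule Set.set_eqI)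
  fix x
  have ac: "a \<in> carrier S" using cp_closed A a by auto
  show "x \<in> A \<cdot>\<^bsub>FG\<^esub> B \<longleftrightarrow> x \<in> translate a B"
  proof
    assume "x \<in> A \<cdot>\<^bsub>FG\<^esub> B"
    then obtain a1 b where h: "x \<in> carrier S" "a1 \<in> A" "b \<in> B" "a1 \<otimes> b \<preceq> x"
      by (auto simp: mem_gmult_FG)
    then have c: "a1 \<in> carrier S" "b \<in> carrier S" using A B cp_closed by auto
    \<comment> \<open>A common lower bound of the two representatives: d^-1 d lies in the domain of
      A, which is the range of B, so d^-1 d b stays in B, and it lies below a^-1 a1 b, hence below
      a^-1 x.\<close>
    obtain d where d: "d \<in> A" "d \<preceq> a" "d \<preceq> a1" using cp_down[OF A a h(2)] by blast
    then have dc: "d \<in> carrier S" using cp_closed A by auto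
    have 1: "sinv S d \<otimes> d \<otimes> b \<in> B"
      using sinv_mult_in_gdom[OF A d(1)] mem_gran_FG[OF B h(3)] AB by simp
    have "sinv S d \<otimes> (d \<otimes> b) \<preceq> sinv S a \<otimes> (a1 \<otimes> b)"
      using c d ac by (intro nle_mult nle_sinv nle_refl m_closed) auto
    moreover have "sinv S a \<otimes> (a1 \<otimes> b) \<preceq> sinv S a \<otimes> x" using h ac by (intro nle_mult_left) auto
    ultimately have "sinv S d \<otimes> (d \<otimes> b) \<preceq> sinv S a \<otimes> x"
      using nle_trans h ac by (metis m_closed sinv_closed)
    then show "x \<in> translate a B"
      using cp_up[OF B 1] c dc ac h by (simp add: mem_translate m_assoc)
  next
    assume "x \<in> translate a B"
    then show "x \<in> A \<cdot>\<^bsub>FG\<^esub> B"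
      using a ac nle_mult_sinv_mult by (auto simp: mem_translate mem_gmult_FG)
  qed
qed

lemma sinv_image_cp_filter:
  assumes F: "F \<in> cp_filters S" shows "sinv S ` F \<in> cp_filters S"
proof -
  note m = mem_sinv_image[OF cp_subset[OF F]]
  show ?thesis
    unfolding cp_filters_iff
  proof (intro conjI ballI allI impI)
    show "sinv S ` F \<subseteq> carrier S" using m by auto
    show "sinv S ` F \<noteq> {}" using cp_nonempty[OF F] by auto
    fix x y assume x: "x \<in> sinv S ` F"
    show "y \<in> sinv S ` F" if "y \<in> carrier S" "x \<preceq> y"
      using that x cp_up[OF F] nle_sinv by (auto simp: m)
    assume "y \<in> sinv S ` F"
    with x obtain c where c: "c \<in> F" "c \<preceq> sinv S x" "c \<preceq> sinv S y" "x \<in> carrier S" "y \<in> carrier S"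
      using cp_down[OF F] by (auto simp: m)
    then have "sinv S c \<preceq> x" "sinv S c \<preceq> y" using nle_sinv by fastforce+
    then show "\<exists>c\<in>sinv S ` F. c \<preceq> x \<and> c \<preceq> y" using c by auto
  next
    fix A j assume h: "compatible S A \<and> is_join S j A \<and> j \<in> sinv S ` F"
    then have "is_join S (sinv S j) (sinv S ` A)" "compatible S (sinv S ` A)" "sinv S j \<in> F"
      using is_join_sinv compatible_sinv compatible_subset by (auto simp: m)
    then obtain y where "y \<in> sinv S ` A" "y \<in> F" using cp_prime[OF F] by blast
    then show "\<exists>a\<in>A. a \<in> sinv S ` F" using h compatible_subset by (auto simp: m subset_iff)
  qed
qed

lemma ginv_ginv_FG: "A \<in> cp_filters S \<Longrightarrow> ginv FG (ginv FG A) = A"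
  by (simp add: ginv_FG sinv_image_image cp_subset)

lemma gdom_ginv_FG: "A \<in> cp_filters S \<Longrightarrow> gdom FG (ginv FG A) = gran FG A"
  by (simp add: gdom_def gran_def ginv_ginv_FG)

lemma gran_ginv_FG: "A \<in> cp_filters S \<Longrightarrow> gran FG (ginv FG A) = gdom FG A"
  by (simp add: gdom_def gran_def ginv_ginv_FG)

lemma gmult_cp_filter:
  assumes A: "A \<in> cp_filters S" and B: "B \<in> cp_filters S" and AB: "gdom FG A = gran FG B"
  shows "A \<cdot>\<^bsub>FG\<^esub> B \<in> cp_filters S" "gdom FG (A \<cdot>\<^bsub>FG\<^esub> B) = gdom FG B"
proof -
  obtain a where a: "a \<in> A" "a \<in> carrier S" using cp_nonempty A by blast
  have "sinv S a \<otimes> a \<in> gran FG B" using sinv_mult_in_gdom[OF A a(1)] AB by simp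
  then show "A \<cdot>\<^bsub>FG\<^esub> B \<in> cp_filters S" "gdom FG (A \<cdot>\<^bsub>FG\<^esub> B) = gdom FG B"
    using gmult_eq_translate[OF assms a(1)] translate_cp_filter[OF B] gdom_translate[OF B] a by auto
qed

text \<open>By definition the domain is the product of the inverse of A with A, and these two
  filters are composable.\<close>

lemma gdom_cp_filter: "A \<in> cp_filters S \<Longrightarrow> gdom FG A \<in> cp_filters S"
  using gmult_cp_filter(1)[of "ginv FG A" A] gdom_ginv_FG[of A] sinv_image_cp_filter[of A]
  by (simp add: gdom_def ginv_FG)

lemma mult_in_gmult_FG:
  assumes "A \<in> cp_filters S" "B \<in> cp_filters S" "a \<in> A" "b \<in> B"
  shows "a \<otimes> b \<in> A \<cdot>\<^bsub>FG\<^esub> B"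
proof -
  have "a \<otimes> b \<in> carrier S" using assms cp_closed by blast
  then show ?thesis using assms nle_refl unfolding mem_gmult_FG by blast
qed

text \<open>Testing x at a b, membership of x a b in the product means that (a^-1 x a) b lies in B.
  So a^-1 x a is in the range of B, that is, in the domain of A; then a a^-1 x a, and with it x a,
  lies in A.\<close>

lemma gran_gmult_FG:
  assumes A: "A \<in> cp_filters S" and B: "B \<in> cp_filters S" and AB: "gdom FG A = gran FG B"
  shows "gran FG (A \<cdot>\<^bsub>FG\<^esub> B) = gran FG A"
proof -
  obtain a where a: "a \<in> A" "a \<in> carrier S" using cp_nonempty A by blast
  obtain b where b: "b \<in> B" "b \<in> carrier S" using cp_nonempty B by blast
  have "x \<otimes> (a \<otimes> b) \<in> A \<cdot>\<^bsub>FG\<^esub> B \<longleftrightarrow> x \<otimes> a \<in> A" if x: "x \<in> carrier S" for x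
  proof
    assume "x \<otimes> (a \<otimes> b) \<in> A \<cdot>\<^bsub>FG\<^esub> B"
    then have "sinv S a \<otimes> (x \<otimes> a) \<otimes> b \<in> B"
      using gmult_eq_translate[OF assms a(1)] a b x by (simp add: mem_translate m_assoc)
    then have "sinv S a \<otimes> (x \<otimes> a) \<in> gdom FG A" using AB mem_gran_FG[OF B b(1)] a x by simp
    then have "a \<otimes> (sinv S a \<otimes> (x \<otimes> a)) \<in> A" using mem_gdom_FG[OF A a(1)] by simp
    then show "x \<otimes> a \<in> A" using cp_mult_sinv_mult_iff[OF A a(1)] x a by simp
  next
    assume "x \<otimes> a \<in> A"
    then have "x \<otimes> a \<otimes> b \<in> A \<cdot>\<^bsub>FG\<^esub> B" using mult_in_gmult_FG A B b by blast
    then show "x \<otimes> (a \<otimes> b) \<in> A \<cdot>\<^bsub>FG\<^esub> B" using a b x by (simp add: m_assoc)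
  qed
  then show ?thesis
    using mem_gran_FG[OF gmult_cp_filter(1)[OF assms] mult_in_gmult_FG[OF A B a(1) b(1)]]
      mem_gran_FG[OF A a(1)] by blast
qed

lemma gran_gdom_FG:
  assumes A: "A \<in> cp_filters S" shows "gran FG (gdom FG A) = gdom FG A"
proof -
  obtain a where a: "a \<in> A" "a \<in> carrier S" using cp_nonempty A by blast
  note e = sinv_mult_in_gdom[OF A a(1)]
  have "x \<otimes> (sinv S a \<otimes> a) \<in> gdom FG A \<longleftrightarrow> a \<otimes> x \<in> A" if x: "x \<in> carrier S" for x
  proof -
    have "x \<otimes> (sinv S a \<otimes> a) \<in> gdom FG A \<longleftrightarrow> a \<otimes> x \<otimes> (sinv S a \<otimes> a) \<in> A"
      using x a by (simp add: mem_gdom_FG[OF A a(1)] m_assoc)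
    also have "\<dots> \<longleftrightarrow> a \<otimes> x \<in> A"
    proof
      show "a \<otimes> x \<otimes> (sinv S a \<otimes> a) \<in> A \<Longrightarrow> a \<otimes> x \<in> A" using cp_up[OF A] nleI x a by simp
      assume "a \<otimes> x \<in> A"
      \<comment> \<open>The domain test is applied with a x, rather than a, as the representative of
        A.\<close>
      then have "sinv S a \<otimes> a \<in> gdom FG A \<longleftrightarrow> a \<otimes> x \<otimes> (sinv S a \<otimes> a) \<in> A"
        using mem_gdom_FG[OF A] a by simp
      then show "a \<otimes> x \<otimes> (sinv S a \<otimes> a) \<in> A" using e by simp
    qed
    finally show ?thesis .
  qed
  then show ?thesis using mem_gran_FG[OF gdom_cp_filter[OF A] e] mem_gdom_FG[OF A a(1)] by blast
qed

lemma gdom_gdom_FG: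
  assumes A: "A \<in> cp_filters S" shows "gdom FG (gdom FG A) = gdom FG A"
proof -
  obtain a where a: "a \<in> A" "a \<in> carrier S" using cp_nonempty A by blast
  note e = sinv_mult_in_gdom[OF A a(1)]
  show ?thesis
    using a by (auto simp: mem_gdom_FG[OF gdom_cp_filter[OF A] e] mem_gdom_FG[OF A a(1)] m_assoc)
qed

lemma gmult_gdom_FG:
  assumes A: "A \<in> cp_filters S" shows "A \<cdot>\<^bsub>FG\<^esub> gdom FG A = A"
proof -
  obtain a where a: "a \<in> A" "a \<in> carrier S" using cp_nonempty A by blast
  have "A \<cdot>\<^bsub>FG\<^esub> gdom FG A = translate a (gdom FG A)"
    using A a by (intro gmult_eq_translate gdom_cp_filter) (auto simp: gran_gdom_FG)
  also have "\<dots> = A"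
    using a cp_mult_sinv_mult_iff[OF A a(1)] cp_closed[OF A]
    by (auto simp: mem_translate mem_gdom_FG[OF A a(1)])
  finally show ?thesis .
qed

lemma gran_gmult_self_FG:
  assumes A: "A \<in> cp_filters S" shows "gran FG A \<cdot>\<^bsub>FG\<^esub> A = A"
proof -
  obtain a where a: "a \<in> A" "a \<in> carrier S" using cp_nonempty A by blast
  have R: "gran FG A = gdom FG (ginv FG A)" "ginv FG A \<in> cp_filters S"
    using gdom_ginv_FG[OF A] sinv_image_cp_filter[OF A] by (simp_all add: ginv_FG)
  have "gran FG A \<cdot>\<^bsub>FG\<^esub> A = translate (a \<otimes> sinv S a) A"
    using A a R gdom_cp_filter[OF R(2)] gdom_gdom_FG[OF R(2)] mult_sinv_in_gran[OF A a(1)]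
    by (intro gmult_eq_translate) auto
  also have "\<dots> = A"
    using a cp_mult_sinv_mult_iff[OF A a(1)] cp_closed[OF A]
    by (auto simp: mem_translate m_assoc)
  finally show ?thesis .
qed

text \<open>Both sides are translates of C by a b, since dividing by a b is dividing by a and then
  by b.\<close>

lemma gmult_assoc_FG:
  assumes A: "A \<in> cp_filters S" and B: "B \<in> cp_filters S" and C: "C \<in> cp_filters S"
    and AB: "gdom FG A = gran FG B" and BC: "gdom FG B = gran FG C"
  shows "A \<cdot>\<^bsub>FG\<^esub> B \<cdot>\<^bsub>FG\<^esub> C = A \<cdot>\<^bsub>FG\<^esub> (B \<cdot>\<^bsub>FG\<^esub> C)"
proof -
  obtain a where a: "a \<in> A" "a \<in> carrier S" using cp_nonempty A by blast
  obtain b where b: "b \<in> B" "b \<in> carrier S" using cp_nonempty B by blast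
  have "A \<cdot>\<^bsub>FG\<^esub> B \<cdot>\<^bsub>FG\<^esub> C = translate (a \<otimes> b) C"
    using gmult_cp_filter[OF A B AB] C BC mult_in_gmult_FG[OF A B a(1) b(1)]
    by (intro gmult_eq_translate) auto
  also have "\<dots> = translate a (translate b C)"
    using a b by (auto simp: mem_translate sinv_mult m_assoc)
  also have "translate b C = B \<cdot>\<^bsub>FG\<^esub> C" using gmult_eq_translate[OF B C BC b(1)] by simp
  also have "translate a (B \<cdot>\<^bsub>FG\<^esub> C) = A \<cdot>\<^bsub>FG\<^esub> (B \<cdot>\<^bsub>FG\<^esub> C)"
    using gmult_cp_filter[OF B C BC] gran_gmult_FG[OF B C BC] A AB a
    by (intro gmult_eq_translate[symmetric]) auto
  finally show ?thesis .
qed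

lemma groupoid_FG: "groupoid FG"
  by unfold_locales
    (auto simp: composable_def ginv_FG[symmetric] gdom_ginv_FG gran_ginv_FG gdom_gdom_FG gran_gdom_FG
      gmult_cp_filter gran_gmult_FG gmult_assoc_FG gmult_gdom_FG gran_gmult_self_FG
      sinv_image_cp_filter[folded ginv_FG])

text \<open>A filter is determined by its domain and one member: x is in A iff a a^-1 x is in A iff
  a^-1 x is in the domain of A. All injectivity statements about the domain map on filters rest on
  this.\<close>

lemma cp_filter_eqI:
  assumes A: "A \<in> cp_filters S" and B: "B \<in> cp_filters S" and a: "a \<in> A" "a \<in> B"
    and d: "gdom FG A = gdom FG B"
  shows "A = B"
proof -
  have "x \<in> A \<longleftrightarrow> x \<in> B" if "x \<in> carrier S" for x
    using cp_mult_sinv_mult_iff[OF A a(1) that] cp_mult_sinv_mult_iff[OF B a(2) that]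
      mem_gdom_FG[OF A a(1), of "sinv S a \<otimes> x"] mem_gdom_FG[OF B a(2), of "sinv S a \<otimes> x"]
      d that cp_closed[OF A a(1)] by simp
  then show ?thesis using cp_subset A B by blast
qed

end

section \<open>Etale groupoids\<close>

lemma local_homeomorphism_mapI:
  assumes c: "continuous_map X Y f" and o: "open_map X Y f"
    and inj: "\<And>x. x \<in> topspace X \<Longrightarrow> \<exists>U. openin X U \<and> x \<in> U \<and> inj_on f U"
  shows "local_homeomorphism_map X Y f"
  unfolding local_homeomorphism_map_def
proof
  fix x assume "x \<in> topspace X"
  then obtain U where U: "openin X U" "x \<in> U" "inj_on f U" using inj by blast
  have fU: "openin Y (f ` U)" using o U(1) by (simp add: open_map_def)
  have "homeomorphic_map (subtopology X U) (subtopology Y (f ` U)) f"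
  proof (rule bijective_open_imp_homeomorphic_map)
    show "continuous_map (subtopology X U) (subtopology Y (f ` U)) f"
      using c by (simp add: continuous_map_in_subtopology continuous_map_from_subtopology)
    show "open_map (subtopology X U) (subtopology Y (f ` U)) f"
      unfolding open_map_def
    proof (intro allI impI)
      fix W assume "openin (subtopology X U) W"
      then have "openin X W" "W \<subseteq> U" using U(1) by (auto simp: openin_open_subtopology)
      then show "openin (subtopology Y (f ` U)) (f ` W)"
        using o fU by (auto simp: openin_open_subtopology open_map_def)
    qed
    show "f ` topspace (subtopology X U) = topspace (subtopology Y (f ` U))"
      "inj_on f (topspace (subtopology X U))"
      using U fU[THEN openin_subset] U(1)[THEN openin_subset] by (auto simp: Int_absorb1)
  qed
  with U fU show "\<exists>U. openin X U \<and> x \<in> U \<and> openin Y (f ` U) \<and>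
      homeomorphic_map (subtopology X U) (subtopology Y (f ` U)) f" by blast
qed

lemma local_homeomorphism_map_imp_open_map:
  assumes f: "local_homeomorphism_map X Y f" shows "open_map X Y f"
  unfolding open_map_def
proof (intro allI impI)
  fix V assume V: "openin X V"
  show "openin Y (f ` V)"
  proof (subst openin_subopen, intro ballI)
    fix y assume "y \<in> f ` V"
    then obtain x where x: "x \<in> V" "y = f x" by blast
    then have "x \<in> topspace X" using openin_subset[OF V] by blast
    then obtain U where U: "openin X U" "x \<in> U" "openin Y (f ` U)"
      "homeomorphic_map (subtopology X U) (subtopology Y (f ` U)) f"
      using f unfolding local_homeomorphism_map_def by blast
    have "openin (subtopology X U) (V \<inter> U)" using V by (auto simp: openin_subtopology)
    then have "openin (subtopology Y (f ` U)) (f ` (V \<inter> U))"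
      using homeomorphic_imp_open_map[OF U(4)] by (simp add: open_map_def)
    then have "openin Y (f ` (V \<inter> U))" using U(3) openin_trans_full by blast
    then show "\<exists>T. openin Y T \<and> y \<in> T \<and> T \<subseteq> f ` V" using x U(2) by blast
  qed
qed

lemma local_homeomorphism_map_locally_inj:
  assumes "local_homeomorphism_map X Y f" "x \<in> topspace X"
  obtains U where "openin X U" "x \<in> U" "inj_on f U"
proof -
  obtain U where U: "openin X U" "x \<in> U"
    "homeomorphic_map (subtopology X U) (subtopology Y (f ` U)) f"
    using assms unfolding local_homeomorphism_map_def by blast
  then have "inj_on f U"
    using homeomorphic_imp_injective_map[OF U(3)] openin_subset[OF U(1)] by (simp add: Int_absorb1)
  with U that show thesis by blast
qed

section \<open>Algebra of groupoids and bisections\<close>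

context groupoid
begin

lemma composable_iff:
  "(x, y) \<in> composable G \<longleftrightarrow> x \<in> carrier G \<and> y \<in> carrier G \<and> gdom G x = gran G y"
  by (simp add: composable_def)

lemma ginv_comp_self: "x \<in> carrier G \<Longrightarrow> (ginv G x, x) \<in> composable G"
  by (simp add: composable_iff ginv_closed gdom_ginv)

lemma gdom_closed: "x \<in> carrier G \<Longrightarrow> gdom G x \<in> carrier G"
  using gmult_closed ginv_comp_self by (simp add: gdom_def)

text \<open>With y the inverse of x and z the inverse of y, associate z y x in two ways: z y is the
  domain of y, which is the range of x, so the product is x; and it is also z times the domain of x,
  which is z.\<close>

lemma ginv_ginv:
  assumes x: "x \<in> carrier G" shows "ginv G (ginv G x) = x"
proof -
  let ?y = "ginv G x" and ?z = "ginv G (ginv G x)"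
  have c: "?y \<in> carrier G" "?z \<in> carrier G" using x by (simp_all add: ginv_closed)
  have "?z \<cdot> (?y \<cdot> x) = ?z \<cdot> ?y \<cdot> x" using ginv_comp_self x c by (intro gmult_assoc[symmetric]) auto
  also have "\<dots> = gran G x \<cdot> x" using gdom_ginv[OF x] by (simp add: gdom_def)
  also have "\<dots> = x" using x by (rule gran_gmult_self)
  finally have "?z \<cdot> gdom G x = x" by (simp add: gdom_def)
  moreover have "gdom G ?z = gdom G x" using gdom_ginv[OF c(1)] gran_ginv[OF x] by simp
  ultimately show ?thesis using gmult_gdom[OF c(2)] by simp
qed

lemma comp_self_ginv: "x \<in> carrier G \<Longrightarrow> (x, ginv G x) \<in> composable G"
  by (simp add: composable_iff ginv_closed gran_ginv)

lemma gran_closed: "x \<in> carrier G \<Longrightarrow> gran G x \<in> carrier G"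
  using gmult_closed comp_self_ginv by (simp add: gran_def)

lemma ginv_gmult_cancel:
  assumes "(x, y) \<in> composable G" shows "ginv G x \<cdot> (x \<cdot> y) = y"
proof -
  have "x \<in> carrier G" "y \<in> carrier G" "gdom G x = gran G y" using assms by (auto simp: composable_iff)
  then show ?thesis
    using gmult_assoc[OF ginv_comp_self assms] gran_gmult_self[of y] by (simp flip: gdom_def)
qed

lemma gmult_ginv_cancel:
  assumes "(x, y) \<in> composable G" shows "x \<cdot> y \<cdot> ginv G y = x"
proof -
  have "x \<in> carrier G" "y \<in> carrier G" "gdom G x = gran G y" using assms by (auto simp: composable_iff)
  then show ?thesis
    using gmult_assoc[OF assms comp_self_ginv] gmult_gdom[of x] by (simp flip: gran_def)
qed

lemma gmult_ginv_gmult: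
  assumes "x \<in> carrier G" "y \<in> carrier G" "gdom G x = gdom G y"
  shows "(x, ginv G y) \<in> composable G" "(x \<cdot> ginv G y, y) \<in> composable G" "x \<cdot> ginv G y \<cdot> y = x"
proof -
  show c: "(x, ginv G y) \<in> composable G" using assms by (simp add: composable_iff ginv_closed gran_ginv)
  show "(x \<cdot> ginv G y, y) \<in> composable G"
    using assms c by (simp add: composable_iff gmult_closed gdom_gmult gdom_ginv)
  show "x \<cdot> ginv G y \<cdot> y = x" using gmult_ginv_cancel[OF c] assms by (simp add: ginv_ginv)
qed

lemma identities_iff: "e \<in> identities G \<longleftrightarrow> e \<in> carrier G \<and> gdom G e = e"
  by (simp add: identities_def)

lemma gdom_in_identities: "x \<in> carrier G \<Longrightarrow> gdom G x \<in> identities G"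
  by (simp add: identities_iff gdom_closed gdom_gdom)

lemma gran_in_identities: "x \<in> carrier G \<Longrightarrow> gran G x \<in> identities G"
  using gdom_in_identities[of "ginv G x"] by (simp add: ginv_closed gdom_ginv)

lemma identities_gran: "e \<in> identities G \<Longrightarrow> gran G e = e"
  using gran_gdom[of e] by (simp add: identities_iff)

lemma identity_gmult: "\<lbrakk>(e, x) \<in> composable G; e \<in> identities G\<rbrakk> \<Longrightarrow> e \<cdot> x = x"
  using gran_gmult_self by (auto simp: composable_iff identities_iff)

lemma gmult_identity: "\<lbrakk>(x, e) \<in> composable G; e \<in> identities G\<rbrakk> \<Longrightarrow> x \<cdot> e = x"
  using gmult_gdom identities_gran by (auto simp: composable_iff)

lemma comp_gdom: "x \<in> carrier G \<Longrightarrow> (x, gdom G x) \<in> composable G"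
  by (simp add: composable_iff gdom_closed gran_gdom)

lemma comp_gran: "x \<in> carrier G \<Longrightarrow> (gran G x, x) \<in> composable G"
  using gran_in_identities by (simp add: composable_iff identities_iff)

lemma ginv_eqI:
  assumes "(x, y) \<in> composable G" "x \<cdot> y \<in> identities G" shows "ginv G x = y"
proof -
  have c: "x \<in> carrier G" "y \<in> carrier G" using assms by (auto simp: composable_iff)
  have "x \<cdot> y = gran G x" using identities_gran[OF assms(2)] gran_gmult[OF assms(1)] by simp
  then have "y = ginv G x \<cdot> gran G x" using ginv_gmult_cancel[OF assms(1)] by simp
  also have "\<dots> = ginv G x" using gmult_gdom[of "ginv G x"] c by (simp add: ginv_closed gdom_ginv)
  finally show ?thesis by simp
qed

lemma ginv_gmult_identity_iff:
  assumes "x \<in> carrier G" "y \<in> carrier G" "gran G x = gran G y"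
  shows "ginv G x \<cdot> y \<in> identities G \<longleftrightarrow> x = y"
proof
  assume "ginv G x \<cdot> y \<in> identities G"
  then have "ginv G (ginv G x) = y"
    using assms by (intro ginv_eqI) (simp_all add: composable_iff ginv_closed gdom_ginv)
  then show "x = y" using assms by (simp add: ginv_ginv)
next
  assume "x = y" then show "ginv G x \<cdot> y \<in> identities G"
    using assms gdom_in_identities by (simp flip: gdom_def)
qed

lemma gmult_ginv_identity_iff:
  assumes "x \<in> carrier G" "y \<in> carrier G" "gdom G x = gdom G y"
  shows "x \<cdot> ginv G y \<in> identities G \<longleftrightarrow> x = y"
  using ginv_gmult_identity_iff[of "ginv G x" "ginv G y"] assms ginv_ginv
  by (metis ginv_closed gran_ginv)

text \<open>The product of x^-1 and y is defined exactly when x and y have the same range, and it is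
  an identity exactly when x = y. So each of the two inclusions is injectivity of range or
  domain.\<close>

lemma bisection_iff:
  "bisection G A \<longleftrightarrow> A \<subseteq> carrier G \<and> inj_on (gdom G) A \<and> inj_on (gran G) A"
proof (cases "A \<subseteq> carrier G")
  case True
  then have c: "x \<in> carrier G" if "x \<in> A" for x using that by blast
  have "bisection_mult G (ginv G ` A) A \<subseteq> identities G \<longleftrightarrow>
      (\<forall>x\<in>A. \<forall>y\<in>A. gran G x = gran G y \<longrightarrow> ginv G x \<cdot> y \<in> identities G)"
    using c by (fastforce simp: bisection_mult_def composable_iff gdom_ginv ginv_closed)
  also have "\<dots> \<longleftrightarrow> inj_on (gran G) A"
    using c ginv_gmult_identity_iff by (simp add: inj_on_def cong: ball_cong imp_cong)
  finally have "bisection_mult G (ginv G ` A) A \<subseteq> identities G \<longleftrightarrow> inj_on (gran G) A" .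
  moreover
  have "bisection_mult G A (ginv G ` A) \<subseteq> identities G \<longleftrightarrow>
      (\<forall>x\<in>A. \<forall>y\<in>A. gdom G x = gdom G y \<longrightarrow> x \<cdot> ginv G y \<in> identities G)"
    using c by (fastforce simp: bisection_mult_def composable_iff gran_ginv ginv_closed)
  then have "bisection_mult G A (ginv G ` A) \<subseteq> identities G \<longleftrightarrow> inj_on (gdom G) A"
    using c gmult_ginv_identity_iff by (simp add: inj_on_def cong: ball_cong imp_cong)
  ultimately show ?thesis using True by (auto simp: bisection_def)
qed (auto simp: bisection_def)

end

section \<open>Open sets in topological and etale groupoids\<close>

context topological_groupoid
begin

lemma openin_subset_carrier: "openin (gtop G) U \<Longrightarrow> U \<subseteq> carrier G"
  using openin_subset topspace_gtop by metis

lemma continuous_gmult_compose: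
  assumes f: "continuous_map X (gtop G) f" and g: "continuous_map X (gtop G) g"
    and comp: "\<And>x. x \<in> topspace X \<Longrightarrow> (f x, g x) \<in> composable G"
  shows "continuous_map X (gtop G) (\<lambda>x. f x \<cdot> g x)"
proof -
  have "continuous_map X (subtopology (prod_topology (gtop G) (gtop G)) (composable G)) (\<lambda>x. (f x, g x))"
    using f g comp by (auto simp: continuous_map_in_subtopology continuous_map_pairwise o_def)
  from continuous_map_compose[OF this continuous_gmult] show ?thesis by (simp add: o_def)
qed

lemma continuous_gdom: "continuous_map (gtop G) (gtop G) (gdom G)"
  using continuous_gmult_compose[OF continuous_ginv continuous_map_id[unfolded id_def]]
  by (simp add: gdom_def[abs_def] ginv_comp_self topspace_gtop)

lemma openin_ginv_image:
  assumes "openin (gtop G) U" shows "openin (gtop G) (ginv G ` U)"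
proof -
  have "ginv G ` U = {x \<in> topspace (gtop G). ginv G x \<in> U}"
    using openin_subset_carrier[OF assms]
    by (auto simp: topspace_gtop ginv_closed ginv_ginv subset_iff image_iff) (metis ginv_ginv)
  then show ?thesis using openin_continuous_map_preimage[OF continuous_ginv assms] by simp
qed

end

context etale_groupoid
begin

lemma open_map_gdom: "open_map (gtop G) (subtopology (gtop G) (identities G)) (gdom G)"
  using local_homeomorphism_gdom by (rule local_homeomorphism_map_imp_open_map)

text \<open>Near an identity e the domain map is injective on some open U. If both x and its domain
  lie in U, they have the same domain and therefore coincide, so x is an identity.\<close>

lemma openin_identities: "openin (gtop G) (identities G)"
proof (subst openin_subopen, intro ballI)
  fix e assume e: "e \<in> identities G"
  then have "e \<in> topspace (gtop G)" by (simp add: identities_iff topspace_gtop)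
  then obtain U where U: "openin (gtop G) U" "e \<in> U" "inj_on (gdom G) U"
    using local_homeomorphism_map_locally_inj[OF local_homeomorphism_gdom] by blast
  let ?W = "U \<inter> {x \<in> topspace (gtop G). gdom G x \<in> U}"
  have "openin (gtop G) ?W"
    using U(1) openin_continuous_map_preimage[OF continuous_gdom U(1)] by blast
  moreover have "e \<in> ?W" using e U by (simp add: identities_iff topspace_gtop)
  moreover have "?W \<subseteq> identities G"
  proof
    fix x assume x: "x \<in> ?W"
    then have "gdom G x = x"
      by (intro inj_onD[OF U(3), of "gdom G x" x]) (simp_all add: gdom_gdom topspace_gtop)
    then show "x \<in> identities G" using x by (simp add: identities_iff topspace_gtop)
  qed
  ultimately show "\<exists>T. openin (gtop G) T \<and> e \<in> T \<and> T \<subseteq> identities G" by blast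
qed

lemma openin_gdom_image:
  assumes "openin (gtop G) U" shows "openin (gtop G) (gdom G ` U)"
proof -
  have "openin (subtopology (gtop G) (identities G)) (gdom G ` U)"
    using open_map_gdom assms by (simp add: open_map_def)
  then show ?thesis using openin_identities by (rule openin_trans_full)
qed

text \<open>As the domain map is injective on B, the only possible right factor of g is the element
  \<open>?s (gdom G g)\<close> of B with the same domain as g. Hence the product is the preimage of
  A under the continuous map \<open>?f\<close>, which divides g by this element, on the open set
  \<open>?P\<close> where it exists.\<close>

lemma openin_bisection_mult:
  assumes A: "openin (gtop G) A" and B: "openin (gtop G) B" and inj: "inj_on (gdom G) B"
  shows "openin (gtop G) (bisection_mult G A B)"
proof -
  let ?D = "gdom G ` B"
  let ?s = "inv_into B (gdom G)"
  let ?P = "{g \<in> topspace (gtop G). gdom G g \<in> ?D}"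
  let ?f = "\<lambda>g. g \<cdot> ginv G (?s (gdom G g))"
  have Bc: "B \<subseteq> carrier G" "A \<subseteq> carrier G" using A B openin_subset_carrier by auto
  have D: "openin (gtop G) ?D" by (rule openin_gdom_image[OF B])
  have P: "openin (gtop G) ?P" by (rule openin_continuous_map_preimage[OF continuous_gdom D])
  have s: "?s (gdom G b) = b" if "b \<in> B" for b using inj that by simp
  \<comment> \<open>Continuity of the section comes from openness of the domain map: the preimage of
    U is the image of the open set B \<inter> U.\<close>
  have sc: "continuous_map (subtopology (gtop G) ?D) (gtop G) ?s"
    unfolding continuous_map_def
  proof (intro conjI allI impI)
    show "?s \<in> topspace (subtopology (gtop G) ?D) \<rightarrow> topspace (gtop G)"
      using Bc s by (auto simp: topspace_gtop)
    fix U assume U: "openin (gtop G) U"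
    have "{x \<in> topspace (subtopology (gtop G) ?D). ?s x \<in> U} = gdom G ` (B \<inter> U)"
      using Bc s by (auto simp: topspace_gtop gdom_closed)
    moreover have "openin (gtop G) (gdom G ` (B \<inter> U))" using B U openin_gdom_image by blast
    ultimately show "openin (subtopology (gtop G) ?D) {x \<in> topspace (subtopology (gtop G) ?D). ?s x \<in> U}"
      using D by (auto simp: openin_open_subtopology)
  qed
  have "continuous_map (subtopology (gtop G) ?P) (subtopology (gtop G) ?D) (gdom G)"
    using continuous_gdom by (auto simp: continuous_map_in_subtopology continuous_map_from_subtopology)
  from continuous_map_compose[OF continuous_map_compose[OF this sc] continuous_ginv]
  have "continuous_map (subtopology (gtop G) ?P) (gtop G) (\<lambda>g. ginv G (?s (gdom G g)))"
    by (simp add: o_def)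
  then have "continuous_map (subtopology (gtop G) ?P) (gtop G) ?f"
  proof (rule continuous_gmult_compose[rotated])
    show "continuous_map (subtopology (gtop G) ?P) (gtop G) (\<lambda>x. x)"
      using continuous_map_from_subtopology[OF continuous_map_id] by (simp add: id_def)
    fix g assume "g \<in> topspace (subtopology (gtop G) ?P)"
    then obtain b where "g \<in> carrier G" "b \<in> B" "gdom G g = gdom G b" by (auto simp: topspace_gtop)
    then show "(g, ginv G (?s (gdom G g))) \<in> composable G"
      using s Bc gmult_ginv_gmult(1) by auto
  qed
  from openin_continuous_map_preimage[OF this A]
  have "openin (gtop G) {g \<in> topspace (subtopology (gtop G) ?P). ?f g \<in> A}"
    using P openin_trans_full by blast
  moreover have "{g \<in> topspace (subtopology (gtop G) ?P). ?f g \<in> A} = bisection_mult G A B"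
  proof (intro equalityI subsetI)
    fix g assume "g \<in> {g \<in> topspace (subtopology (gtop G) ?P). ?f g \<in> A}"
    then obtain b where b: "g \<in> carrier G" "b \<in> B" "gdom G g = gdom G b" "?f g \<in> A"
      by (auto simp: topspace_gtop)
    then have "g \<cdot> ginv G b \<in> A" using s by simp
    then show "g \<in> bisection_mult G A B"
      using gmult_ginv_gmult(2,3)[of g b] b Bc unfolding bisection_mult_def by force
  next
    fix g assume "g \<in> bisection_mult G A B"
    then obtain a b where ab: "a \<in> A" "b \<in> B" "(a, b) \<in> composable G" "g = a \<cdot> b"
      by (auto simp: bisection_mult_def)
    then have "gdom G g = gdom G b" "g \<in> carrier G" "g \<cdot> ginv G b = a"
      by (auto simp: gdom_gmult gmult_closed gmult_ginv_cancel)
    then show "g \<in> {g \<in> topspace (subtopology (gtop G) ?P). ?f g \<in> A}"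
      using ab s by (auto simp: topspace_gtop)
  qed
  ultimately show ?thesis by simp
qed

end

section \<open>The groupoid of completely prime filters\<close>

context pseudogroup
begin

definition basic_open :: "'a \<Rightarrow> 'a set set"
  where "basic_open s = {F \<in> cp_filters S. s \<in> F}"

lemma mem_basic_open: "F \<in> basic_open s \<longleftrightarrow> F \<in> cp_filters S \<and> s \<in> F"
  by (simp add: basic_open_def)

lemma basic_open_subset: "basic_open s \<subseteq> cp_filters S"
  by (auto simp: mem_basic_open)

lemma basic_open_meet:
  assumes "a \<in> carrier S" "b \<in> carrier S" "is_meet S m {a, b}"
  shows "basic_open m = basic_open a \<inter> basic_open b"
  using cp_meet_iff assms by (auto simp: mem_basic_open)

text \<open>The sets \<open>basic_open s\<close> are closed under binary intersection, because the
  intersection for a and b is the basic open set of their meet. So the generated family of unions is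
  a topology and openness can be tested locally.\<close>

lemma openin_FG_iff:
  "openin (gtop FG) U \<longleftrightarrow> U \<subseteq> cp_filters S \<and> (\<forall>F\<in>U. \<exists>s\<in>F. basic_open s \<subseteq> U)"
proof -
  let ?P = "\<lambda>U. \<exists>s\<in>carrier S. U = basic_open s"
  have "istopology (arbitrary union_of ?P)"
  proof (rule istopology_base)
    fix U V assume "?P U" "?P V"
    then obtain a b where ab: "a \<in> carrier S" "b \<in> carrier S" "U = basic_open a" "V = basic_open b"
      by blast
    then obtain m where m: "is_meet S m {a, b}" using ex_meet by blast
    then have "m \<in> carrier S" using ab by (simp add: is_glb_natural_order_iff)
    then show "?P (U \<inter> V)" using basic_open_meet[OF ab(1,2) m] ab by blast
  qed
  then have "openin (gtop FG) U \<longleftrightarrow> (arbitrary union_of ?P) U"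
    by (simp add: filter_groupoid_def basic_open_def[symmetric])
  also have "\<dots> \<longleftrightarrow> U \<subseteq> cp_filters S \<and> (\<forall>F\<in>U. \<exists>s\<in>F. basic_open s \<subseteq> U)"
    unfolding arbitrary_union_of_alt
  proof (intro iffI conjI ballI subsetI)
    fix F assume "\<forall>x\<in>U. \<exists>V. ?P V \<and> x \<in> V \<and> V \<subseteq> U" "F \<in> U"
    then show "F \<in> cp_filters S" "\<exists>s\<in>F. basic_open s \<subseteq> U" by (force simp: mem_basic_open)+
  next
    fix F assume h: "U \<subseteq> cp_filters S \<and> (\<forall>F\<in>U. \<exists>s\<in>F. basic_open s \<subseteq> U)" "F \<in> U"
    then obtain s where s: "s \<in> F" "basic_open s \<subseteq> U" "F \<in> cp_filters S" by blast
    then have "s \<in> carrier S" "F \<in> basic_open s" using cp_closed by (auto simp: mem_basic_open)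
    then show "\<exists>V. ?P V \<and> F \<in> V \<and> V \<subseteq> U" using s by blast
  qed
  finally show ?thesis .
qed

lemma openin_basic_open: "openin (gtop FG) (basic_open s)"
  unfolding openin_FG_iff by (auto simp: mem_basic_open)

lemma topspace_FG: "topspace (gtop FG) = cp_filters S"
proof
  show "topspace (gtop FG) \<subseteq> cp_filters S"
    using openin_topspace[of "gtop FG"] unfolding openin_FG_iff by blast
  have "openin (gtop FG) (cp_filters S)"
    unfolding openin_FG_iff using basic_open_subset cp_nonempty by (metis subset_refl)
  then show "cp_filters S \<subseteq> topspace (gtop FG)" by (rule openin_subset)
qed

lemma continuous_map_into_FG:
  assumes f: "\<And>x. x \<in> topspace X \<Longrightarrow> f x \<in> cp_filters S"
    and o: "\<And>s. s \<in> carrier S \<Longrightarrow> openin X {x \<in> topspace X. s \<in> f x}"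
  shows "continuous_map X (gtop FG) f"
  unfolding continuous_map_def
proof (intro conjI allI impI)
  show "f \<in> topspace X \<rightarrow> topspace (gtop FG)" using f by (simp add: topspace_FG)
  fix U assume U: "openin (gtop FG) U"
  show "openin X {x \<in> topspace X. f x \<in> U}"
  proof (subst openin_subopen, intro ballI)
    fix x assume x: "x \<in> {x \<in> topspace X. f x \<in> U}"
    then obtain s where s: "s \<in> f x" "basic_open s \<subseteq> U" using U unfolding openin_FG_iff by blast
    let ?T = "{x \<in> topspace X. s \<in> f x}"
    have "openin X ?T" using o cp_closed f x s by auto
    moreover have "x \<in> ?T" using x s by simp
    moreover have "?T \<subseteq> {x \<in> topspace X. f x \<in> U}" using s f by (auto simp: mem_basic_open)
    ultimately show "\<exists>T. openin X T \<and> x \<in> T \<and> T \<subseteq> {x \<in> topspace X. f x \<in> U}" by blast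
  qed
qed

lemma mem_ginv_FG:
  "F \<in> cp_filters S \<Longrightarrow> s \<in> ginv FG F \<longleftrightarrow> s \<in> carrier S \<and> sinv S s \<in> F"
  by (simp add: ginv_FG mem_sinv_image cp_subset)

lemma topological_groupoid_FG: "topological_groupoid FG"
proof (intro topological_groupoid.intro groupoid_FG topological_groupoid_axioms.intro)
  interpret F: groupoid FG by (rule groupoid_FG)
  show "topspace (gtop FG) = carrier FG" by (simp add: topspace_FG)
  show "continuous_map (gtop FG) (gtop FG) (ginv FG)"
  proof (rule continuous_map_into_FG)
    fix s assume s: "s \<in> carrier S"
    have "{F \<in> topspace (gtop FG). s \<in> ginv FG F} = basic_open (sinv S s)"
      using s by (auto simp: topspace_FG mem_basic_open mem_ginv_FG)
    then show "openin (gtop FG) {F \<in> topspace (gtop FG). s \<in> ginv FG F}"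
      using openin_basic_open by simp
  qed (simp add: topspace_FG ginv_FG sinv_image_cp_filter)
  let ?X = "prod_topology (gtop FG) (gtop FG)"
  show "continuous_map (subtopology ?X (composable FG)) (gtop FG) (\<lambda>(A, B). A \<cdot>\<^bsub>FG\<^esub> B)"
  proof (rule continuous_map_into_FG)
    fix p assume "p \<in> topspace (subtopology ?X (composable FG))"
    then show "(case p of (A, B) \<Rightarrow> A \<cdot>\<^bsub>FG\<^esub> B) \<in> cp_filters S" using F.gmult_closed by auto
  next
    fix s assume s: "s \<in> carrier S"
    \<comment> \<open>A product of filters contains s exactly when a b \<le> s for some members a
      and b of the two factors, so the preimage is a union of open rectangles, cut down to the
      composable pairs.\<close>
    let ?T = "\<Union>(a, b)\<in>{(a, b). a \<otimes> b \<preceq> s}. basic_open a \<times> basic_open b"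
    have "openin ?X ?T"
      by (intro openin_Union) (auto simp: openin_prod_Times_iff openin_basic_open)
    moreover have "{p \<in> topspace (subtopology ?X (composable FG)). s \<in> (case p of (A, B) \<Rightarrow> A \<cdot>\<^bsub>FG\<^esub> B)}
        = ?T \<inter> composable FG"
      using s by (auto simp: topspace_FG mem_basic_open mem_gmult_FG F.composable_iff) blast+
    ultimately show "openin (subtopology ?X (composable FG))
        {p \<in> topspace (subtopology ?X (composable FG)). s \<in> (case p of (A, B) \<Rightarrow> A \<cdot>\<^bsub>FG\<^esub> B)}"
      unfolding openin_subtopology by blast
  qed
qed

text \<open>An identity E containing c^-1 c is the domain of its translate by c, and that translate
  contains c. This is what makes the domain map open.\<close>

lemma gdom_basic_open:
  assumes c: "c \<in> carrier S"
  shows "gdom FG ` basic_open c = basic_open (sinv S c \<otimes> c) \<inter> identities FG"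
proof (intro equalityI subsetI)
  interpret F: groupoid FG by (rule groupoid_FG)
  fix E
  { assume "E \<in> gdom FG ` basic_open c"
    then show "E \<in> basic_open (sinv S c \<otimes> c) \<inter> identities FG"
      using sinv_mult_in_gdom gdom_cp_filter F.gdom_in_identities by (auto simp: mem_basic_open) }
  { assume "E \<in> basic_open (sinv S c \<otimes> c) \<inter> identities FG"
    then have E: "E \<in> cp_filters S" "sinv S c \<otimes> c \<in> E" "gran FG E = E" "gdom FG E = E"
      using F.identities_gran by (auto simp: mem_basic_open F.identities_iff)
    then have "translate c E \<in> basic_open c"
      using c by (auto simp: mem_basic_open mem_translate translate_cp_filter)
    moreover have "gdom FG (translate c E) = E" using gdom_translate[of E c] E c by simp
    ultimately show "E \<in> gdom FG ` basic_open c" by blast }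
qed

lemma inj_on_gdom_basic_open: "inj_on (gdom FG) (basic_open a)"
proof (rule inj_onI)
  fix A B assume "A \<in> basic_open a" "B \<in> basic_open a" "gdom FG A = gdom FG B"
  then show "A = B" using cp_filter_eqI[of A B a] by (simp add: mem_basic_open)
qed

lemma etale_groupoid_FG: "etale_groupoid FG"
proof (intro etale_groupoid.intro topological_groupoid_FG etale_groupoid_axioms.intro)
  interpret F: topological_groupoid FG by (rule topological_groupoid_FG)
  show "local_homeomorphism_map (gtop FG) (subtopology (gtop FG) (identities FG)) (gdom FG)"
  proof (rule local_homeomorphism_mapI)
    show "continuous_map (gtop FG) (subtopology (gtop FG) (identities FG)) (gdom FG)"
      using F.continuous_gdom F.gdom_in_identities
      by (auto simp: continuous_map_in_subtopology topspace_FG)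
    show "open_map (gtop FG) (subtopology (gtop FG) (identities FG)) (gdom FG)"
      unfolding open_map_def
    proof (intro allI impI)
      fix U assume U: "openin (gtop FG) U"
      let ?C = "{c \<in> carrier S. basic_open c \<subseteq> U}"
      have "U = (\<Union>c\<in>?C. basic_open c)"
      proof (intro equalityI subsetI)
        fix F assume "F \<in> U"
        then obtain s where "s \<in> F" "basic_open s \<subseteq> U" "F \<in> cp_filters S"
          using U unfolding openin_FG_iff by blast
        then show "F \<in> (\<Union>c\<in>?C. basic_open c)" using cp_closed by (auto simp: mem_basic_open)
      qed auto
      then have "gdom FG ` U = (\<Union>c\<in>?C. gdom FG ` basic_open c)" by (metis image_UN)
      also have "\<dots> = (\<Union>c\<in>?C. basic_open (sinv S c \<otimes> c)) \<inter> identities FG"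
        by (auto simp: gdom_basic_open)
      finally have "gdom FG ` U = (\<Union>c\<in>?C. basic_open (sinv S c \<otimes> c)) \<inter> identities FG" .
      moreover have "openin (gtop FG) (\<Union>c\<in>?C. basic_open (sinv S c \<otimes> c))"
        by (intro openin_Union) (auto simp: openin_basic_open)
      ultimately show "openin (subtopology (gtop FG) (identities FG)) (gdom FG ` U)"
        unfolding openin_subtopology by blast
    qed
    fix F assume "F \<in> topspace (gtop FG)"
    then obtain a where "a \<in> F" "F \<in> basic_open a"
      using cp_nonempty by (auto simp: topspace_FG mem_basic_open)
    then show "\<exists>U. openin (gtop FG) U \<and> F \<in> U \<and> inj_on (gdom FG) U"
      using openin_basic_open inj_on_gdom_basic_open by blast
  qed
qed

end

section \<open>Preimages of filters under callitic morphisms\<close>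

locale callitic_morphism = S: pseudogroup S + T: pseudogroup T for S T +
  fixes \<theta>
  assumes callitic: "callitic S T \<theta>"
begin

lemma hom: "\<theta> \<in> hom S T"
  using callitic by (simp add: callitic_def meet_morphism_def pg_morphism_def)

lemma closed: "s \<in> carrier S \<Longrightarrow> \<theta> s \<in> carrier T"
  using hom by (rule hom_in_carrier)

lemma mult: "\<lbrakk>s \<in> carrier S; t \<in> carrier S\<rbrakk> \<Longrightarrow> \<theta> (s \<otimes>\<^bsub>S\<^esub> t) = \<theta> s \<otimes>\<^bsub>T\<^esub> \<theta> t"
  using hom by (rule hom_mult)

lemma sinv: "s \<in> carrier S \<Longrightarrow> \<theta> (sinv S s) = sinv T (\<theta> s)"
  using hom_sinv[OF S.inverse_monoid_axioms T.inverse_monoid_axioms hom] .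

lemma join: "\<lbrakk>compatible S A; is_join S j A\<rbrakk> \<Longrightarrow> is_join T (\<theta> j) (\<theta> ` A)"
  using callitic by (simp add: callitic_def meet_morphism_def pg_morphism_def)

lemma meet: "\<lbrakk>a \<in> carrier S; b \<in> carrier S; is_meet S m {a, b}\<rbrakk> \<Longrightarrow> is_meet T (\<theta> m) {\<theta> a, \<theta> b}"
  using callitic by (simp add: callitic_def meet_morphism_def)

definition preimage :: "_ set \<Rightarrow> _ set"
  where "preimage F = {s \<in> carrier S. \<theta> s \<in> F}"

lemma mem_preimage: "s \<in> preimage F \<longleftrightarrow> s \<in> carrier S \<and> \<theta> s \<in> F"
  by (simp add: preimage_def)

text \<open>The clauses of callitic match those of a filter: meeting the image gives non-emptiness,
  preservation of meets gives directedness, and preservation of joins gives primeness.\<close>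

lemma preimage_cp_filter:
  assumes F: "F \<in> cp_filters T" shows "preimage F \<in> cp_filters S"
  unfolding S.cp_filters_iff
proof (intro conjI ballI allI impI)
  show "preimage F \<subseteq> carrier S" by (auto simp: mem_preimage)
  have "F \<inter> \<theta> ` carrier S \<noteq> {}" using callitic F by (simp add: callitic_def)
  then show "preimage F \<noteq> {}" using mem_preimage by blast
  fix a b assume a: "a \<in> preimage F"
  { assume "b \<in> carrier S" "a \<sqsubseteq>\<^bsub>natural_order S\<^esub> b"
    then show "b \<in> preimage F"
      using a T.cp_up[OF F] hom_nle[OF hom] closed by (auto simp: mem_preimage) }
  { assume b: "b \<in> preimage F"
    then have c: "a \<in> carrier S" "b \<in> carrier S" "\<theta> a \<in> F" "\<theta> b \<in> F" using a by (auto simp: mem_preimage)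
    then obtain m where m: "is_meet S m {a, b}" using S.ex_meet by blast
    then have "\<theta> m \<in> F" using T.cp_meet_iff[OF F meet] c closed by simp
    then show "\<exists>c\<in>preimage F. c \<sqsubseteq>\<^bsub>natural_order S\<^esub> a \<and> c \<sqsubseteq>\<^bsub>natural_order S\<^esub> b"
      using m c by (auto simp: mem_preimage is_glb_natural_order_iff) }
next
  fix A j assume h: "compatible S A \<and> is_join S j A \<and> j \<in> preimage F"
  then have "compatible T (\<theta> ` A)" "is_join T (\<theta> j) (\<theta> ` A)" "\<theta> j \<in> F"
    using hom_compatible[OF S.inverse_monoid_axioms T.inverse_monoid_axioms hom] join
    by (auto simp: mem_preimage)
  then obtain y where "y \<in> \<theta> ` A" "y \<in> F" using T.cp_prime[OF F] by blast
  then show "\<exists>a\<in>A. a \<in> preimage F" using h S.compatible_subset by (auto simp: mem_preimage)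
qed

lemma gdom_preimage:
  assumes F: "F \<in> cp_filters T" shows "gdom S.FG (preimage F) = preimage (gdom T.FG F)"
proof -
  obtain a where a: "a \<in> preimage F" "a \<in> carrier S" "\<theta> a \<in> F"
    using S.cp_nonempty[OF preimage_cp_filter[OF F]] by (auto simp: mem_preimage)
  show ?thesis
    using a by (auto simp: S.mem_gdom_FG[OF preimage_cp_filter[OF F] a(1)] T.mem_gdom_FG[OF F a(3)]
        mem_preimage mult closed)
qed

lemma gran_preimage:
  assumes F: "F \<in> cp_filters T" shows "gran S.FG (preimage F) = preimage (gran T.FG F)"
proof -
  obtain a where a: "a \<in> preimage F" "a \<in> carrier S" "\<theta> a \<in> F"
    using S.cp_nonempty[OF preimage_cp_filter[OF F]] by (auto simp: mem_preimage)
  show ?thesis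
    using a by (auto simp: S.mem_gran_FG[OF preimage_cp_filter[OF F] a(1)] T.mem_gran_FG[OF F a(3)]
        mem_preimage mult closed)
qed

lemma gmult_preimage:
  assumes A: "A \<in> cp_filters T" and B: "B \<in> cp_filters T" and AB: "gdom T.FG A = gran T.FG B"
  shows "preimage (A \<cdot>\<^bsub>T.FG\<^esub> B) = preimage A \<cdot>\<^bsub>S.FG\<^esub> preimage B"
proof -
  note p = preimage_cp_filter[OF A] preimage_cp_filter[OF B]
  obtain a where a: "a \<in> preimage A" "a \<in> carrier S" "\<theta> a \<in> A"
    using S.cp_nonempty[OF p(1)] by (auto simp: mem_preimage)
  have "gdom S.FG (preimage A) = gran S.FG (preimage B)"
    using AB A B by (simp add: gdom_preimage gran_preimage)
  then show ?thesis
    using a by (auto simp: S.gmult_eq_translate[OF p _ a(1)] T.gmult_eq_translate[OF A B AB a(3)]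
        mem_preimage T.mem_translate S.mem_translate mult sinv closed)
qed

text \<open>For h in H, h^-1 h lies in the domain of H, hence in the preimage of E, so
  \<theta>(h)^-1 \<theta>(h) is in E. The lift of H is therefore the translate of E by
  \<theta>(h).\<close>

lemma preimage_covering:
  assumes E: "E \<in> identities T.FG" and H: "H \<in> cp_filters S" and eq: "preimage E = gdom S.FG H"
  obtains F where "F \<in> cp_filters T" "gdom T.FG F = E" "preimage F = H"
proof -
  interpret GT: groupoid T.FG by (rule T.groupoid_FG)
  have Ec: "E \<in> cp_filters T" "gdom T.FG E = E" "gran T.FG E = E"
    using E GT.identities_gran by (auto simp: GT.identities_iff)
  obtain h where h: "h \<in> H" "h \<in> carrier S" using S.cp_nonempty[OF H] by blast
  have "sinv S h \<otimes>\<^bsub>S\<^esub> h \<in> preimage E" using S.sinv_mult_in_gdom[OF H h(1)] eq by simp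
  then have e: "\<theta> h \<in> carrier T" "sinv T (\<theta> h) \<otimes>\<^bsub>T\<^esub> \<theta> h \<in> gran T.FG E"
    using h Ec by (auto simp: mem_preimage mult sinv closed)
  let ?F = "T.translate (\<theta> h) E"
  have "preimage ?F = {x \<in> carrier S. sinv S h \<otimes>\<^bsub>S\<^esub> x \<in> preimage E}"
    using h by (auto simp: mem_preimage T.mem_translate mult sinv closed)
  also have "\<dots> = {x \<in> carrier S. h \<otimes>\<^bsub>S\<^esub> (sinv S h \<otimes>\<^bsub>S\<^esub> x) \<in> H}"
    using h by (auto simp: eq S.mem_gdom_FG[OF H h(1)])
  also have "\<dots> = H" using S.cp_mult_sinv_mult_iff[OF H h(1)] S.cp_subset[OF H] by auto
  finally show thesis
    using that[of ?F] T.translate_cp_filter[OF Ec(1) e] T.gdom_translate[OF Ec(1) e] Ec by simp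
qed

lemma filter_map_eq: "F \<in> cp_filters T \<Longrightarrow> filter_map S T \<theta> F = preimage F"
  by (simp add: filter_map_def preimage_def)

lemma filter_map_Etale_hom: "filter_map S T \<theta> \<in> Etale_hom T.FG S.FG"
proof -
  interpret GT: groupoid T.FG by (rule T.groupoid_FG)
  have "continuous_map (gtop T.FG) (gtop S.FG) (filter_map S T \<theta>)"
  proof (rule S.continuous_map_into_FG)
    fix s assume s: "s \<in> carrier S"
    \<comment> \<open>The preimage of the basic open set of s is the basic open set of
      \<theta>(s).\<close>
    have "{F \<in> topspace (gtop T.FG). s \<in> filter_map S T \<theta> F} = T.basic_open (\<theta> s)"
      using s by (auto simp: T.topspace_FG filter_map_eq T.mem_basic_open mem_preimage)
    then show "openin (gtop T.FG) {F \<in> topspace (gtop T.FG). s \<in> filter_map S T \<theta> F}"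
      using T.openin_basic_open by simp
  qed (simp add: T.topspace_FG filter_map_eq preimage_cp_filter)
  moreover have "gfunctor T.FG S.FG (filter_map S T \<theta>)"
    unfolding gfunctor_def
    using T.gdom_cp_filter GT.gran_closed T.gmult_cp_filter(1)
    by (auto simp: filter_map_eq preimage_cp_filter gdom_preimage gran_preimage gmult_preimage
        GT.composable_iff)
  moreover have "F = F'" if F: "F \<in> cp_filters T" "F' \<in> cp_filters T" "gdom T.FG F = gdom T.FG F'"
    "preimage F = preimage F'" for F F'
  proof -
    \<comment> \<open>The image of a member of the common preimage belongs to both F and F', so
      equality of domains decides.\<close>
    obtain a where "a \<in> preimage F" using S.cp_nonempty[OF preimage_cp_filter[OF F(1)]] by blast
    then have "\<theta> a \<in> F" "\<theta> a \<in> F'" using F(4) by (auto simp: mem_preimage)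
    then show ?thesis using T.cp_filter_eqI F by blast
  qed
  moreover have "\<exists>F\<in>cp_filters T. gdom T.FG F = E \<and> filter_map S T \<theta> F = H"
    if E: "E \<in> identities T.FG" "H \<in> cp_filters S" "filter_map S T \<theta> E = gdom S.FG H" for E H
  proof -
    have "E \<in> cp_filters T" using E(1) by (simp add: GT.identities_iff)
    then have "preimage E = gdom S.FG H" using E(3) by (simp add: filter_map_eq)
    then obtain F where "F \<in> cp_filters T" "gdom T.FG F = E" "preimage F = H"
      using preimage_covering[OF E(1,2)] by blast
    then show ?thesis by (auto simp: filter_map_eq)
  qed
  ultimately show ?thesis
    unfolding Etale_hom_def covering_functor_def
    by (auto simp: filter_map_eq) (simp add: filter_map_def)
qed

end

section \<open>Identities and composites in the two categories\<close>

lemma Inv_hom_callitic_morphism: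
  "\<lbrakk>pseudogroup S; pseudogroup T; \<theta> \<in> Inv_hom S T\<rbrakk> \<Longrightarrow> callitic_morphism S T \<theta>"
  by (simp add: callitic_morphism_def callitic_morphism_axioms_def Inv_hom_def)

lemma Inv_hom_id:
  assumes "pseudogroup S" shows "restrict id (carrier S) \<in> Inv_hom S S"
proof -
  interpret pseudogroup S by fact
  have i: "restrict id (carrier S) ` A = A" if "A \<subseteq> carrier S" for A
    using that by (force simp: subset_iff)
  have "is_join S (restrict id (carrier S) j) (restrict id (carrier S) ` A)"
    if "compatible S A" "is_join S j A" for A j
    unfolding i[OF compatible_subset[OF that(1)]]
    using that compatible_subset[OF that(1)] by (simp add: is_lub_natural_order_iff)
  moreover have "is_meet S (restrict id (carrier S) m) {a, b}"
    if "a \<in> carrier S" "b \<in> carrier S" "is_meet S m {a, b}" for a b m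
    using that by (simp add: is_glb_natural_order_iff)
  moreover have "F \<inter> carrier S \<noteq> {}" if "F \<in> cp_filters S" for F
    using cp_nonempty[OF that] by auto
  ultimately show ?thesis
    by (auto simp: Inv_hom_def callitic_def meet_morphism_def pg_morphism_def hom_def i)
qed

lemma Inv_hom_compose:
  assumes S: "pseudogroup S" and T: "pseudogroup T" and U: "pseudogroup U"
    and \<theta>: "\<theta> \<in> Inv_hom S T" and \<psi>: "\<psi> \<in> Inv_hom T U"
  shows "compose (carrier S) \<psi> \<theta> \<in> Inv_hom S U"
proof -
  interpret t: callitic_morphism S T \<theta> using S T \<theta> by (rule Inv_hom_callitic_morphism)
  interpret p: callitic_morphism T U \<psi> using T U \<psi> by (rule Inv_hom_callitic_morphism)
  let ?c = "compose (carrier S) \<psi> \<theta>"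
  have c: "?c s = \<psi> (\<theta> s)" if "s \<in> carrier S" for s using that by (simp add: compose_eq)
  have "?c \<in> hom S U"
    by (rule homI) (simp_all add: c t.closed p.closed t.mult p.mult)
  moreover have "is_join U (?c j) (?c ` A)" if A: "compatible S A" and j: "is_join S j A" for A j
  proof -
    have sub: "A \<subseteq> carrier S" using A t.S.compatible_subset by blast
    then have "j \<in> carrier S" using j by (simp add: is_lub_natural_order_iff)
    have "is_join U (\<psi> (\<theta> j)) (\<psi> ` \<theta> ` A)"
      by (rule p.join[OF hom_compatible[OF t.S.inverse_monoid_axioms t.T.inverse_monoid_axioms t.hom A]
            t.join[OF A j]])
    moreover have "\<psi> ` \<theta> ` A = ?c ` A"
      unfolding image_image using sub c by (intro image_cong) auto
    ultimately show ?thesis using c[OF \<open>j \<in> carrier S\<close>] by simp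
  qed
  moreover have "is_meet U (?c m) {?c a, ?c b}"
    if "a \<in> carrier S" "b \<in> carrier S" "is_meet S m {a, b}" for a b m
  proof -
    have "m \<in> carrier S" using that by (simp add: is_glb_natural_order_iff)
    then show ?thesis using that by (simp add: c p.meet t.meet t.closed)
  qed
  moreover have "F \<inter> ?c ` carrier S \<noteq> {}" if F: "F \<in> cp_filters U" for F
  proof -
    \<comment> \<open>Since the preimage of F under \<psi> is a completely prime filter of T, the
      condition on \<theta> applies to it.\<close>
    obtain s where "s \<in> carrier S" "\<theta> s \<in> p.preimage F"
      using t.callitic p.preimage_cp_filter[OF F] unfolding callitic_def by blast
    then have "?c s \<in> F" "s \<in> carrier S" by (simp_all add: c p.mem_preimage)
    then show ?thesis by blast
  qed
  ultimately show ?thesis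
    by (simp add: Inv_hom_def callitic_def meet_morphism_def pg_morphism_def)
qed

lemma Etale_hom_id:
  assumes "etale_groupoid G" shows "restrict id (carrier G) \<in> Etale_hom G G"
proof -
  interpret etale_groupoid G by fact
  have "continuous_map (gtop G) (gtop G) (restrict id (carrier G))"
    by (rule continuous_map_eq[OF continuous_map_id]) (simp add: topspace_gtop)
  then show ?thesis
    by (auto simp: Etale_hom_def covering_functor_def gfunctor_def gdom_closed gran_closed
        gmult_closed composable_iff identities_iff)
qed

lemma Etale_hom_compose:
  assumes G: "etale_groupoid G" and H: "etale_groupoid H"
    and \<alpha>: "\<alpha> \<in> Etale_hom G H" and \<beta>: "\<beta> \<in> Etale_hom H K"
  shows "compose (carrier G) \<beta> \<alpha> \<in> Etale_hom G K"
proof -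
  interpret G: etale_groupoid G by fact
  interpret H: etale_groupoid H by fact
  have fa: "gfunctor G H \<alpha>" and ca: "covering_functor G H \<alpha>" and fb: "gfunctor H K \<beta>"
    and cb: "covering_functor H K \<beta>" and cont: "continuous_map (gtop G) (gtop H) \<alpha>"
      "continuous_map (gtop H) (gtop K) \<beta>"
    using \<alpha> \<beta> by (auto simp: Etale_hom_def covering_functor_def)
  have a: "\<alpha> x \<in> carrier H" "gdom H (\<alpha> x) = \<alpha> (gdom G x)" "gran H (\<alpha> x) = \<alpha> (gran G x)"
    if "x \<in> carrier G" for x using fa that by (auto simp: gfunctor_def)
  have am: "\<alpha> (x \<cdot>\<^bsub>G\<^esub> y) = \<alpha> x \<cdot>\<^bsub>H\<^esub> \<alpha> y" if "(x, y) \<in> composable G" for x y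
    using fa that by (auto simp: gfunctor_def)
  have b: "\<beta> x \<in> carrier K" "gdom K (\<beta> x) = \<beta> (gdom H x)" "gran K (\<beta> x) = \<beta> (gran H x)"
    if "x \<in> carrier H" for x using fb that by (auto simp: gfunctor_def)
  have bm: "\<beta> (x \<cdot>\<^bsub>H\<^esub> y) = \<beta> x \<cdot>\<^bsub>K\<^esub> \<beta> y" if "(x, y) \<in> composable H" for x y
    using fb that by (auto simp: gfunctor_def)
  have comp: "(\<alpha> x, \<alpha> y) \<in> composable H" if "(x, y) \<in> composable G" for x y
    using that a by (auto simp: G.composable_iff H.composable_iff)
  let ?c = "compose (carrier G) \<beta> \<alpha>"
  have c: "?c x = \<beta> (\<alpha> x)" if "x \<in> carrier G" for x using that by (simp add: compose_eq)
  have "continuous_map (gtop G) (gtop K) ?c"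
    by (rule continuous_map_eq[OF continuous_map_compose[OF cont]]) (simp add: c G.topspace_gtop)
  moreover have "gfunctor G K ?c"
    unfolding gfunctor_def
    using a b am bm comp
    by (auto simp: c G.gdom_closed G.gran_closed G.gmult_closed) (auto simp: c G.composable_iff)
  moreover have "g = g'" if "g \<in> carrier G" "g' \<in> carrier G" "gdom G g = gdom G g'" "?c g = ?c g'" for g g'
  proof -
    have "gdom H (\<alpha> g) = gdom H (\<alpha> g')" using that a by simp
    then have "\<alpha> g = \<alpha> g'" using cb that a c unfolding covering_functor_def by simp
    then show ?thesis using ca that unfolding covering_functor_def by simp
  qed
  moreover have "\<exists>g\<in>carrier G. gdom G g = e \<and> ?c g = k"
    if e: "e \<in> identities G" and k: "k \<in> carrier K" "?c e = gdom K k" for e k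
  proof -
    have ec: "e \<in> carrier G" "gdom G e = e" using e by (auto simp: G.identities_iff)
    then have "\<alpha> e \<in> identities H" using a by (simp add: H.identities_iff)
    then obtain h where h: "h \<in> carrier H" "gdom H h = \<alpha> e" "\<beta> h = k"
      using cb k c[OF ec(1)] unfolding covering_functor_def by metis
    then obtain g where "g \<in> carrier G" "gdom G g = e" "\<alpha> g = h"
      using ca e unfolding covering_functor_def by metis
    then show ?thesis using h c by auto
  qed
  ultimately show ?thesis unfolding Etale_hom_def covering_functor_def by simp
qed

section \<open>The pseudogroup of open bisections\<close>

context etale_groupoid
begin

abbreviation BG where "BG \<equiv> bisection_monoid G"

lemma mem_BG_iff:
  "A \<in> carrier BG \<longleftrightarrow> openin (gtop G) A \<and> inj_on (gdom G) A \<and> inj_on (gran G) A"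
  using openin_subset_carrier by (auto simp: bisection_monoid_def bisection_iff)

lemma BG_subset_carrier: "A \<in> carrier BG \<Longrightarrow> A \<subseteq> carrier G"
  using openin_subset_carrier by (simp add: mem_BG_iff)

lemma BG_carrier: "\<lbrakk>A \<in> carrier BG; x \<in> A\<rbrakk> \<Longrightarrow> x \<in> carrier G"
  using BG_subset_carrier by blast

lemma BG_gdom_inj: "\<lbrakk>A \<in> carrier BG; x \<in> A; y \<in> A; gdom G x = gdom G y\<rbrakk> \<Longrightarrow> x = y"
  by (auto simp: mem_BG_iff inj_on_def)

lemma BG_gran_inj: "\<lbrakk>A \<in> carrier BG; x \<in> A; y \<in> A; gran G x = gran G y\<rbrakk> \<Longrightarrow> x = y"
  by (auto simp: mem_BG_iff inj_on_def)

lemma BG_subset: "\<lbrakk>A \<in> carrier BG; openin (gtop G) C; C \<subseteq> A\<rbrakk> \<Longrightarrow> C \<in> carrier BG"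
  by (auto simp: mem_BG_iff intro: inj_on_subset)

lemma mult_BG: "A \<otimes>\<^bsub>BG\<^esub> B = bisection_mult G A B"
  by (simp add: bisection_monoid_def)

lemma mem_mult_BG: "x \<in> A \<otimes>\<^bsub>BG\<^esub> B \<longleftrightarrow> (\<exists>a\<in>A. \<exists>b\<in>B. (a, b) \<in> composable G \<and> x = a \<cdot> b)"
  by (auto simp: mult_BG bisection_mult_def)

lemma mult_BGE:
  assumes "x \<in> A \<otimes>\<^bsub>BG\<^esub> B"
  obtains a b where "a \<in> A" "b \<in> B" "(a, b) \<in> composable G" "x = a \<cdot> b"
  using assms by (auto simp: mem_mult_BG)

lemma mult_BGI:
  "\<lbrakk>a \<in> A; b \<in> B; (a, b) \<in> composable G; x = a \<cdot> b\<rbrakk> \<Longrightarrow> x \<in> A \<otimes>\<^bsub>BG\<^esub> B"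
  by (auto simp: mem_mult_BG)

text \<open>The domain of a product fixes its right factor within B, and composability then fixes
  the left factor within A; ranges work the other way round.\<close>

lemma mult_BG_closed:
  assumes A: "A \<in> carrier BG" and B: "B \<in> carrier BG" shows "A \<otimes>\<^bsub>BG\<^esub> B \<in> carrier BG"
  unfolding mem_BG_iff
proof (intro conjI inj_onI)
  show "openin (gtop G) (A \<otimes>\<^bsub>BG\<^esub> B)"
    using A B openin_bisection_mult by (simp add: mult_BG mem_BG_iff)
  fix x y assume "x \<in> A \<otimes>\<^bsub>BG\<^esub> B" "y \<in> A \<otimes>\<^bsub>BG\<^esub> B"
  then obtain a b a' b' where x: "a \<in> A" "b \<in> B" "(a, b) \<in> composable G" "x = a \<cdot> b"
    and y: "a' \<in> A" "b' \<in> B" "(a', b') \<in> composable G" "y = a' \<cdot> b'"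
    by (auto simp: mem_mult_BG)
  have d: "gdom G a = gran G b" "gdom G a' = gran G b'" using x y by (auto simp: composable_iff)
  { assume "gdom G x = gdom G y"
    then have "gdom G b = gdom G b'" using x y by (simp add: gdom_gmult)
    then have "b = b'" using BG_gdom_inj[OF B] x y by blast
    then have "a = a'" using d BG_gdom_inj[OF A] x y by simp
    then show "x = y" using x y \<open>b = b'\<close> by simp }
  { assume "gran G x = gran G y"
    then have "gran G a = gran G a'" using x y by (simp add: gran_gmult)
    then have "a = a'" using BG_gran_inj[OF A] x y by blast
    then have "b = b'" using d BG_gran_inj[OF B] x y by simp
    then show "x = y" using x y \<open>a = a'\<close> by simp }
qed

lemma identities_subset_BG:
  assumes "openin (gtop G) E" "E \<subseteq> identities G" shows "E \<in> carrier BG"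
  using assms identities_gran by (auto simp: mem_BG_iff identities_iff inj_on_def subset_iff)

lemma monoid_BG: "Group.monoid BG"
proof (rule monoidI)
  show "\<one>\<^bsub>BG\<^esub> \<in> carrier BG"
    using identities_subset_BG openin_identities by (simp add: bisection_monoid_def)
  fix A assume A: "A \<in> carrier BG"
  have "x \<in> \<one>\<^bsub>BG\<^esub> \<otimes>\<^bsub>BG\<^esub> A \<longleftrightarrow> x \<in> A" for x
  proof
    assume "x \<in> \<one>\<^bsub>BG\<^esub> \<otimes>\<^bsub>BG\<^esub> A"
    then show "x \<in> A" unfolding mem_mult_BG using identity_gmult by (auto simp: bisection_monoid_def)
  next
    assume "x \<in> A"
    moreover have "x \<in> carrier G" using BG_carrier A \<open>x \<in> A\<close> by blast
    ultimately show "x \<in> \<one>\<^bsub>BG\<^esub> \<otimes>\<^bsub>BG\<^esub> A"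
      unfolding mem_mult_BG using gran_in_identities comp_gran gran_gmult_self
      by (force simp: bisection_monoid_def)
  qed
  then show "\<one>\<^bsub>BG\<^esub> \<otimes>\<^bsub>BG\<^esub> A = A" by blast
  have "x \<in> A \<otimes>\<^bsub>BG\<^esub> \<one>\<^bsub>BG\<^esub> \<longleftrightarrow> x \<in> A" for x
  proof
    assume "x \<in> A \<otimes>\<^bsub>BG\<^esub> \<one>\<^bsub>BG\<^esub>"
    then show "x \<in> A" unfolding mem_mult_BG using gmult_identity by (auto simp: bisection_monoid_def)
  next
    assume "x \<in> A"
    moreover have "x \<in> carrier G" using BG_carrier A \<open>x \<in> A\<close> by blast
    ultimately show "x \<in> A \<otimes>\<^bsub>BG\<^esub> \<one>\<^bsub>BG\<^esub>"
      unfolding mem_mult_BG using gdom_in_identities comp_gdom gmult_gdom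
      by (force simp: bisection_monoid_def)
  qed
  then show "A \<otimes>\<^bsub>BG\<^esub> \<one>\<^bsub>BG\<^esub> = A" by blast
next
  fix A B C
  show "A \<otimes>\<^bsub>BG\<^esub> B \<otimes>\<^bsub>BG\<^esub> C = A \<otimes>\<^bsub>BG\<^esub> (B \<otimes>\<^bsub>BG\<^esub> C)"
  proof (intro equalityI subsetI)
    fix x assume "x \<in> A \<otimes>\<^bsub>BG\<^esub> B \<otimes>\<^bsub>BG\<^esub> C"
    then obtain a b c where abc: "a \<in> A" "b \<in> B" "c \<in> C" "(a, b) \<in> composable G"
      "(a \<cdot> b, c) \<in> composable G" "x = a \<cdot> b \<cdot> c"
      by (blast elim: mult_BGE)
    then have bc: "(b, c) \<in> composable G" by (auto simp: composable_iff gdom_gmult)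
    moreover have "(a, b \<cdot> c) \<in> composable G"
      using abc(4) bc by (auto simp: composable_iff gran_gmult gmult_closed)
    moreover have "x = a \<cdot> (b \<cdot> c)" using gmult_assoc[OF abc(4) bc] abc(6) by simp
    ultimately show "x \<in> A \<otimes>\<^bsub>BG\<^esub> (B \<otimes>\<^bsub>BG\<^esub> C)"
      using abc bc by (blast intro: mult_BGI)
  next
    fix x assume "x \<in> A \<otimes>\<^bsub>BG\<^esub> (B \<otimes>\<^bsub>BG\<^esub> C)"
    then obtain a b c where abc: "a \<in> A" "b \<in> B" "c \<in> C" "(b, c) \<in> composable G"
      "(a, b \<cdot> c) \<in> composable G" "x = a \<cdot> (b \<cdot> c)"
      by (blast elim: mult_BGE)
    then have ab: "(a, b) \<in> composable G" by (auto simp: composable_iff gran_gmult)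
    moreover have "(a \<cdot> b, c) \<in> composable G"
      using abc(4) ab by (auto simp: composable_iff gdom_gmult gmult_closed)
    moreover have "x = a \<cdot> b \<cdot> c" using gmult_assoc[OF ab abc(4)] abc(6) by simp
    ultimately show "x \<in> A \<otimes>\<^bsub>BG\<^esub> B \<otimes>\<^bsub>BG\<^esub> C"
      using abc ab by (blast intro: mult_BGI)
  qed
qed (rule mult_BG_closed)

lemma ginv_image_BG:
  assumes A: "A \<in> carrier BG" shows "ginv G ` A \<in> carrier BG"
  unfolding mem_BG_iff
proof (intro conjI)
  note c = BG_carrier[OF A]
  show "openin (gtop G) (ginv G ` A)" using A openin_ginv_image by (simp add: mem_BG_iff)
  show "inj_on (gdom G) (ginv G ` A)" using c BG_gran_inj[OF A] by (auto simp: inj_on_def gdom_ginv)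
  show "inj_on (gran G) (ginv G ` A)" using c BG_gdom_inj[OF A] by (auto simp: inj_on_def gran_ginv)
qed

lemma ginv_ginv_image: "A \<in> carrier BG \<Longrightarrow> ginv G ` ginv G ` A = A"
  using BG_carrier by (force simp: image_image ginv_ginv)

text \<open>In a composable product a b^-1 c with all three in A, a and b share their domain and b
  and c their range, so all three coincide.\<close>

lemma mult_ginv_image_mult:
  assumes A: "A \<in> carrier BG" shows "A \<otimes>\<^bsub>BG\<^esub> ginv G ` A \<otimes>\<^bsub>BG\<^esub> A = A"
proof (intro equalityI subsetI)
  fix x assume "x \<in> A \<otimes>\<^bsub>BG\<^esub> ginv G ` A \<otimes>\<^bsub>BG\<^esub> A"
  then obtain a b c where abc: "a \<in> A" "b \<in> A" "c \<in> A" "(a, ginv G b) \<in> composable G"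
      "(a \<cdot> ginv G b, c) \<in> composable G" "x = a \<cdot> ginv G b \<cdot> c"
    by (blast elim: mult_BGE)
  note c = abc(1-3)[THEN BG_carrier[OF A]]
  have "a = b" by (rule BG_gdom_inj[OF A]) (use abc c in \<open>auto simp: composable_iff gran_ginv\<close>)
  moreover have "b = c"
    by (rule BG_gran_inj[OF A])
      (use abc(2,3,5) c gdom_gmult[OF abc(4)] in \<open>auto simp: composable_iff gdom_ginv\<close>)
  ultimately show "x \<in> A" using abc c gran_gmult_self by (simp flip: gran_def)
next
  fix a assume a: "a \<in> A"
  note c = BG_carrier[OF A a]
  have "a = a \<cdot> ginv G a \<cdot> a" using gran_gmult_self[OF c] by (simp flip: gran_def)
  moreover have "(a \<cdot> ginv G a, a) \<in> composable G" using comp_gran[OF c] by (simp flip: gran_def)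
  ultimately show "a \<in> A \<otimes>\<^bsub>BG\<^esub> ginv G ` A \<otimes>\<^bsub>BG\<^esub> A"
    using a comp_self_ginv[OF c] by (blast intro: mult_BGI)
qed

text \<open>Writing a = a1 b a2, comparison of ranges and domains forces a1 = a2 = a, so b can only
  be the inverse of a. This is one inclusion in the uniqueness of the generalized inverse.\<close>

lemma ginv_image_subset:
  assumes A: "A \<in> carrier BG" and eq: "A \<otimes>\<^bsub>BG\<^esub> B \<otimes>\<^bsub>BG\<^esub> A = A"
  shows "ginv G ` A \<subseteq> B"
proof
  fix y assume "y \<in> ginv G ` A"
  then obtain a where a: "a \<in> A" "y = ginv G a" by blast
  then have "a \<in> A \<otimes>\<^bsub>BG\<^esub> B \<otimes>\<^bsub>BG\<^esub> A" using eq by simp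
  then obtain a1 b a2 where h: "a1 \<in> A" "b \<in> B" "a2 \<in> A" "(a1, b) \<in> composable G"
      "(a1 \<cdot> b, a2) \<in> composable G" "a = a1 \<cdot> b \<cdot> a2"
    by (blast elim: mult_BGE)
  have "gran G a = gran G a1" "gdom G a = gdom G a2"
    using h(6) gran_gmult[OF h(5)] gdom_gmult[OF h(5)] gran_gmult[OF h(4)] by simp_all
  then have "a1 = a" "a2 = a"
    using BG_gran_inj[OF A h(1) a(1)] BG_gdom_inj[OF A h(3) a(1)] by simp_all
  then have "a \<cdot> b = a \<cdot> ginv G a"
    using gmult_ginv_cancel[OF h(5)] h(6)[symmetric] by simp
  then have "ginv G a = b"
    using h(4) \<open>a1 = a\<close> gran_in_identities[OF BG_carrier[OF A a(1)]]
    by (intro ginv_eqI) (simp_all add: gran_def)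
  then show "y \<in> B" using a h by simp
qed

lemma generalized_inverse_BG:
  assumes A: "A \<in> carrier BG" shows "generalized_inverse BG A B \<longleftrightarrow> B = ginv G ` A"
proof
  assume "generalized_inverse BG A B"
  then have B: "B \<in> carrier BG" "A \<otimes>\<^bsub>BG\<^esub> B \<otimes>\<^bsub>BG\<^esub> A = A" "B \<otimes>\<^bsub>BG\<^esub> A \<otimes>\<^bsub>BG\<^esub> B = B"
    by (auto simp: generalized_inverse_def)
  \<comment> \<open>The generalized inverse relation is symmetric, so the same lemma with A and B
    exchanged gives the opposite inclusion after inverting.\<close>
  have "ginv G ` B \<subseteq> A" using ginv_image_subset[OF B(1,3)] .
  then have "ginv G ` ginv G ` B \<subseteq> ginv G ` A" by (rule image_mono)
  then have "B \<subseteq> ginv G ` A" using ginv_ginv_image[OF B(1)] by simp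
  then show "B = ginv G ` A" using ginv_image_subset[OF A B(2)] by blast
next
  assume "B = ginv G ` A"
  then show "generalized_inverse BG A B"
    using mult_ginv_image_mult[OF A] mult_ginv_image_mult[OF ginv_image_BG[OF A]] ginv_image_BG[OF A]
    by (simp add: generalized_inverse_def ginv_ginv_image[OF A])
qed

lemma inverse_monoid_BG: "inverse_monoid BG"
  by (intro inverse_monoid.intro monoid_BG inverse_monoid_axioms.intro)
    (auto simp: generalized_inverse_BG)

lemma sinv_BG: "A \<in> carrier BG \<Longrightarrow> sinv BG A = ginv G ` A"
  by (simp add: sinv_def generalized_inverse_BG)

text \<open>If E E = E, then e in E factors as e1 e2 within E; comparing range and domain gives e1 =
  e2 = e, and e e = e makes e an identity.\<close>

lemma idems_BG: "idems BG = {E. openin (gtop G) E \<and> E \<subseteq> identities G}"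
proof (intro equalityI subsetI)
  fix E assume "E \<in> idems BG"
  then have E: "E \<in> carrier BG" "E \<otimes>\<^bsub>BG\<^esub> E = E" by (auto simp: idems_def)
  have "e \<in> identities G" if e: "e \<in> E" for e
  proof -
    obtain e1 e2 where h: "e1 \<in> E" "e2 \<in> E" "(e1, e2) \<in> composable G" "e = e1 \<cdot> e2"
      using e E(2) mem_mult_BG[of e E E] by auto
    have "gran G e = gran G e1" "gdom G e = gdom G e2"
      using h(4) gran_gmult[OF h(3)] gdom_gmult[OF h(3)] by simp_all
    then have "e1 = e" "e2 = e"
      using BG_gran_inj[OF E(1) h(1) e] BG_gdom_inj[OF E(1) h(2) e] by simp_all
    then have ee: "(e, e) \<in> composable G" "e \<cdot> e = e" using h(3) h(4)[symmetric] by simp_all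
    then have "gdom G e = e" using ginv_gmult_cancel[OF ee(1)] by (simp add: gdom_def)
    then show ?thesis using BG_carrier[OF E(1) e] by (simp add: identities_iff)
  qed
  then show "E \<in> {E. openin (gtop G) E \<and> E \<subseteq> identities G}" using E by (auto simp: mem_BG_iff)
next
  fix E assume "E \<in> {E. openin (gtop G) E \<and> E \<subseteq> identities G}"
  then have E: "openin (gtop G) E" "E \<subseteq> identities G" by auto
  have "x \<in> E \<otimes>\<^bsub>BG\<^esub> E \<longleftrightarrow> x \<in> E" for x
  proof
    assume "x \<in> E \<otimes>\<^bsub>BG\<^esub> E"
    then show "x \<in> E" unfolding mem_mult_BG using identity_gmult E(2) by auto
  next
    assume x: "x \<in> E"
    then have "x \<in> carrier G" "gdom G x = x" using E(2) by (auto simp: identities_iff)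
    then have "(x, x) \<in> composable G" "x = x \<cdot> x" using comp_gdom[of x] gmult_gdom[of x] by auto
    then show "x \<in> E \<otimes>\<^bsub>BG\<^esub> E" unfolding mem_mult_BG using x by blast
  qed
  then have "E \<otimes>\<^bsub>BG\<^esub> E = E" by blast
  then show "E \<in> idems BG" using identities_subset_BG E by (simp add: idems_def)
qed

lemma nle_BG_iff:
  assumes B: "B \<in> carrier BG"
  shows "A \<sqsubseteq>\<^bsub>natural_order BG\<^esub> B \<longleftrightarrow> openin (gtop G) A \<and> A \<subseteq> B"
proof
  assume "A \<sqsubseteq>\<^bsub>natural_order BG\<^esub> B"
  then obtain E where E: "E \<in> idems BG" "A = B \<otimes>\<^bsub>BG\<^esub> E" by (auto simp: natural_order_def)
  then have "A \<in> carrier BG" using B mult_BG_closed by (simp add: idems_def)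
  moreover have "A \<subseteq> B" using E gmult_identity by (auto simp: idems_BG mem_mult_BG subset_iff)
  ultimately show "openin (gtop G) A \<and> A \<subseteq> B" by (simp add: mem_BG_iff)
next
  assume A: "openin (gtop G) A \<and> A \<subseteq> B"
  have c: "x \<in> carrier G" if "x \<in> B" for x using BG_carrier[OF B that] .
  \<comment> \<open>The idempotent cutting A out of B is the set of domains of A. It is open because
    the domain map is open, and injectivity of domains on B lets no other element through.\<close>
  have "A = B \<otimes>\<^bsub>BG\<^esub> gdom G ` A"
  proof (intro equalityI subsetI)
    fix x assume "x \<in> A"
    then show "x \<in> B \<otimes>\<^bsub>BG\<^esub> gdom G ` A"
      unfolding mem_mult_BG using A c[of x] comp_gdom[of x] gmult_gdom[of x] by force
  next
    fix x assume "x \<in> B \<otimes>\<^bsub>BG\<^esub> gdom G ` A"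
    then obtain b a where h: "b \<in> B" "a \<in> A" "(b, gdom G a) \<in> composable G" "x = b \<cdot> gdom G a"
      by (blast elim: mult_BGE)
    then have "gdom G b = gdom G a" "a \<in> B" using A c by (auto simp: composable_iff gran_gdom)
    then have "b = a" using BG_gdom_inj[OF B] h by blast
    then show "x \<in> A" using h c gmult_gdom by simp
  qed
  moreover have "gdom G ` A \<in> idems BG"
    using A openin_gdom_image gdom_in_identities c by (auto simp: idems_BG)
  ultimately show "A \<sqsubseteq>\<^bsub>natural_order BG\<^esub> B" by (auto simp: natural_order_def)
qed

lemma is_join_BG_iff:
  assumes A: "\<A> \<subseteq> carrier BG" and U: "\<Union>\<A> \<in> carrier BG"
  shows "is_join BG J \<A> \<longleftrightarrow> J = \<Union>\<A>"
proof -
  have o: "openin (gtop G) X" if "X \<in> \<A>" for X using A that by (auto simp: mem_BG_iff)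
  have oU: "openin (gtop G) (\<Union>\<A>)" using U by (simp add: mem_BG_iff)
  show ?thesis
  proof
    assume "is_join BG J \<A>"
    then have J: "J \<in> carrier BG" "\<And>X. X \<in> \<A> \<Longrightarrow> X \<sqsubseteq>\<^bsub>natural_order BG\<^esub> J"
      "\<And>K. \<lbrakk>K \<in> carrier BG; \<And>X. X \<in> \<A> \<Longrightarrow> X \<sqsubseteq>\<^bsub>natural_order BG\<^esub> K\<rbrakk> \<Longrightarrow> J \<sqsubseteq>\<^bsub>natural_order BG\<^esub> K"
      using A by (auto simp: is_lub_natural_order_iff)
    have "\<Union>\<A> \<subseteq> J" using J(2) nle_BG_iff[OF J(1)] by blast
    moreover have "J \<sqsubseteq>\<^bsub>natural_order BG\<^esub> \<Union>\<A>"
      using o by (intro J(3) U) (auto simp: nle_BG_iff[OF U])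
    ultimately show "J = \<Union>\<A>" using nle_BG_iff[OF U] by blast
  next
    assume "J = \<Union>\<A>"
    then show "is_join BG J \<A>"
      using U o oU A by (auto simp: is_lub_natural_order_iff nle_BG_iff)
  qed
qed

lemma is_meet_BG_iff:
  assumes A: "A \<in> carrier BG" and B: "B \<in> carrier BG"
  shows "is_meet BG M {A, B} \<longleftrightarrow> M = A \<inter> B"
proof -
  have o: "openin (gtop G) (A \<inter> B)" using A B by (auto simp: mem_BG_iff)
  then have c: "A \<inter> B \<in> carrier BG" using BG_subset A by blast
  have iff: "is_meet BG M {A, B} \<longleftrightarrow> M \<in> carrier BG \<and> M \<subseteq> A \<and> M \<subseteq> B \<and>
      (\<forall>K\<in>carrier BG. K \<subseteq> A \<and> K \<subseteq> B \<longrightarrow> K \<sqsubseteq>\<^bsub>natural_order BG\<^esub> M)"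
    using A B by (subst is_glb_natural_order_iff) (auto simp: nle_BG_iff mem_BG_iff)
  show ?thesis
  proof
    assume "is_meet BG M {A, B}"
    then have M: "M \<in> carrier BG" "M \<subseteq> A" "M \<subseteq> B" "A \<inter> B \<sqsubseteq>\<^bsub>natural_order BG\<^esub> M"
      using c unfolding iff by blast+
    then show "M = A \<inter> B" using nle_BG_iff[OF M(1)] by blast
  next
    assume "M = A \<inter> B"
    then show "is_meet BG M {A, B}"
      unfolding iff using c nle_BG_iff[OF c] by (simp add: mem_BG_iff)
  qed
qed

text \<open>For x and y with equal domains, compatibility of their bisections makes x y^-1 an
  identity, so x = y; equal ranges are treated with x^-1 y.\<close>

lemma compatible_Union_BG:
  assumes A: "compatible BG \<A>" shows "\<Union>\<A> \<in> carrier BG"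
proof -
  have c: "X \<in> carrier BG" if "X \<in> \<A>" for X using A that by (auto simp: compatible_def)
  have "x = y" if h: "X \<in> \<A>" "x \<in> X" "Y \<in> \<A>" "y \<in> Y" "gdom G x = gdom G y" for x y X Y
  proof -
    have xy: "x \<in> carrier G" "y \<in> carrier G" using c BG_carrier h by blast+
    have "X \<otimes>\<^bsub>BG\<^esub> ginv G ` Y \<in> idems BG" using A h c by (auto simp: compatible_def sinv_BG)
    moreover have "x \<cdot> ginv G y \<in> X \<otimes>\<^bsub>BG\<^esub> ginv G ` Y"
      unfolding mem_mult_BG using gmult_ginv_gmult(1)[OF xy h(5)] h by blast
    ultimately have "x \<cdot> ginv G y \<in> identities G" by (auto simp: idems_BG)
    then show ?thesis using gmult_ginv_identity_iff[OF xy h(5)] by simp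
  qed
  moreover have "x = y" if h: "X \<in> \<A>" "x \<in> X" "Y \<in> \<A>" "y \<in> Y" "gran G x = gran G y" for x y X Y
  proof -
    have xy: "x \<in> carrier G" "y \<in> carrier G" using c BG_carrier h by blast+
    have "ginv G ` X \<otimes>\<^bsub>BG\<^esub> Y \<in> idems BG" using A h c by (auto simp: compatible_def sinv_BG)
    moreover have "ginv G x \<cdot> y \<in> ginv G ` X \<otimes>\<^bsub>BG\<^esub> Y"
      by (rule mult_BGI) (use xy h in \<open>simp_all add: composable_iff ginv_closed gdom_ginv\<close>)
    ultimately have "ginv G x \<cdot> y \<in> identities G" by (auto simp: idems_BG)
    then show ?thesis using ginv_gmult_identity_iff[OF xy h(5)] by simp
  qed
  ultimately show ?thesis
    using c by (auto simp: mem_BG_iff inj_on_def)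
qed

text \<open>Joins of compatible families are unions, and the elementwise product distributes over
  unions.\<close>

lemma pseudogroup_BG: "pseudogroup BG"
proof (intro pseudogroup.intro inverse_monoid_BG pseudogroup_axioms.intro)
  fix \<A> assume A: "compatible BG \<A>"
  then have c: "\<A> \<subseteq> carrier BG" by (simp add: compatible_def)
  note join = is_join_BG_iff[OF c compatible_Union_BG[OF A]]
  show "\<exists>J. is_join BG J \<A>" using join by blast
  fix J C assume h: "is_join BG J \<A>" "C \<in> carrier BG"
  then have J: "J = \<Union>\<A>" "J \<in> carrier BG" using join compatible_Union_BG[OF A] by auto
  have u: "C \<otimes>\<^bsub>BG\<^esub> J = \<Union>((\<lambda>X. C \<otimes>\<^bsub>BG\<^esub> X) ` \<A>)" "J \<otimes>\<^bsub>BG\<^esub> C = \<Union>((\<lambda>X. X \<otimes>\<^bsub>BG\<^esub> C) ` \<A>)"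
    unfolding J(1) by (auto simp: mult_BG bisection_mult_def)
  have "C \<otimes>\<^bsub>BG\<^esub> J \<in> carrier BG" "J \<otimes>\<^bsub>BG\<^esub> C \<in> carrier BG" using h J mult_BG_closed by auto
  moreover have "(\<lambda>X. C \<otimes>\<^bsub>BG\<^esub> X) ` \<A> \<subseteq> carrier BG" "(\<lambda>X. X \<otimes>\<^bsub>BG\<^esub> C) ` \<A> \<subseteq> carrier BG"
    using c h mult_BG_closed by auto
  ultimately show "is_join BG (C \<otimes>\<^bsub>BG\<^esub> J) ((\<lambda>X. C \<otimes>\<^bsub>BG\<^esub> X) ` \<A>)"
    "is_join BG (J \<otimes>\<^bsub>BG\<^esub> C) ((\<lambda>X. X \<otimes>\<^bsub>BG\<^esub> C) ` \<A>)"
    by (simp_all add: is_join_BG_iff u[symmetric])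
qed

text \<open>Local injectivity is given for domains only. Applied near the inverse of x and carried
  back by inversion, it yields a neighbourhood of x on which ranges are injective.\<close>

lemma BG_basis:
  assumes U: "openin (gtop G) U" and x: "x \<in> U"
  obtains A where "A \<in> carrier BG" "x \<in> A" "A \<subseteq> U"
proof -
  have xc: "x \<in> carrier G" using openin_subset_carrier U x by blast
  then have "x \<in> topspace (gtop G)" "ginv G x \<in> topspace (gtop G)" by (simp_all add: topspace_gtop ginv_closed)
  note inj = this[THEN local_homeomorphism_map_locally_inj[OF local_homeomorphism_gdom]]
  obtain V where V: "openin (gtop G) V" "x \<in> V" "inj_on (gdom G) V" using inj(1) .
  obtain W where W: "openin (gtop G) W" "ginv G x \<in> W" "inj_on (gdom G) W" using inj(2) .
  let ?A = "U \<inter> V \<inter> ginv G ` W"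
  have "inj_on (gran G) (ginv G ` W)"
    using W(3) openin_subset_carrier[OF W(1)] by (auto simp: inj_on_def gran_ginv subset_iff)
  then have "?A \<in> carrier BG"
    using U V openin_ginv_image[OF W(1)] by (auto simp: mem_BG_iff intro: inj_on_subset)
  moreover have "x \<in> ?A" using x V W(2) ginv_ginv[OF xc] by force
  ultimately show thesis using that by blast
qed

text \<open>The pieces A \<inter> U are bounded by A, hence compatible, and their join is A, so
  primeness puts one of them in F. This verifies the image condition of callitic morphisms without
  any points of F.\<close>

lemma cp_filter_BG_cover:
  assumes F: "F \<in> cp_filters BG" and A: "A \<in> F"
    and cover: "\<And>x. x \<in> A \<Longrightarrow> \<exists>U. openin (gtop G) U \<and> x \<in> U \<and> P U"
  obtains U where "openin (gtop G) U" "P U" "A \<inter> U \<in> F"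
proof -
  interpret B: pseudogroup BG by (rule pseudogroup_BG)
  let ?C = "{A \<inter> U |U. openin (gtop G) U \<and> P U}"
  have Ac: "A \<in> carrier BG" using B.cp_closed[OF F A] .
  then have oA: "openin (gtop G) A" by (simp add: mem_BG_iff)
  have sub: "?C \<subseteq> carrier BG" using BG_subset[OF Ac] oA by blast
  have "compatible BG ?C"
    using oA by (intro B.bounded_compatible[OF Ac]) (auto simp: nle_BG_iff[OF Ac])
  moreover have "\<Union>?C = A" using cover by blast
  then have "is_join BG A ?C" using is_join_BG_iff[OF sub] Ac by simp
  ultimately obtain X where "X \<in> ?C" "X \<in> F" using B.cp_prime[OF F] A by blast
  then show thesis using that by blast
qed

end

section \<open>Preimages of open bisections under covering functors\<close>

locale etale_morphism = G: etale_groupoid G + H: etale_groupoid H for G H +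
  fixes \<alpha>
  assumes Etale_hom: "\<alpha> \<in> Etale_hom G H"
begin

lemma continuous: "continuous_map (gtop G) (gtop H) \<alpha>"
  using Etale_hom by (simp add: Etale_hom_def)

lemma closed: "x \<in> carrier G \<Longrightarrow> \<alpha> x \<in> carrier H"
  and gdom: "x \<in> carrier G \<Longrightarrow> gdom H (\<alpha> x) = \<alpha> (gdom G x)"
  and gran: "x \<in> carrier G \<Longrightarrow> gran H (\<alpha> x) = \<alpha> (gran G x)"
  and mult: "(x, y) \<in> composable G \<Longrightarrow> \<alpha> (x \<cdot>\<^bsub>G\<^esub> y) = \<alpha> x \<cdot>\<^bsub>H\<^esub> \<alpha> y"
  using Etale_hom by (auto simp: Etale_hom_def covering_functor_def gfunctor_def)

lemma star_injective:
  "\<lbrakk>x \<in> carrier G; y \<in> carrier G; gdom G x = gdom G y; \<alpha> x = \<alpha> y\<rbrakk> \<Longrightarrow> x = y"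
  using Etale_hom by (simp add: Etale_hom_def covering_functor_def)

lemma star_surjective:
  assumes "e \<in> identities G" "h \<in> carrier H" "\<alpha> e = gdom H h"
  obtains g where "g \<in> carrier G" "gdom G g = e" "\<alpha> g = h"
proof -
  have "covering_functor G H \<alpha>" using Etale_hom by (simp add: Etale_hom_def)
  then show thesis using assms that unfolding covering_functor_def by blast
qed

lemma composable: "(x, y) \<in> composable G \<Longrightarrow> (\<alpha> x, \<alpha> y) \<in> composable H"
  by (simp add: G.composable_iff H.composable_iff closed gdom gran)

lemma ginv:
  assumes "x \<in> carrier G" shows "\<alpha> (ginv G x) = ginv H (\<alpha> x)"
proof (rule H.ginv_eqI[symmetric])
  note c = G.comp_self_ginv[OF assms]
  show "(\<alpha> x, \<alpha> (ginv G x)) \<in> Defs.composable H" using composable[OF c] .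
  have "\<alpha> x \<cdot>\<^bsub>H\<^esub> \<alpha> (ginv G x) = gran H (\<alpha> x)"
    using mult[OF c] gran[OF assms] by (simp flip: gran_def)
  then show "\<alpha> x \<cdot>\<^bsub>H\<^esub> \<alpha> (ginv G x) \<in> identities H"
    using H.gran_in_identities closed assms by simp
qed

definition preimage :: "_ set \<Rightarrow> _ set"
  where "preimage U = {g \<in> carrier G. \<alpha> g \<in> U}"

lemma mem_preimage: "g \<in> preimage U \<longleftrightarrow> g \<in> carrier G \<and> \<alpha> g \<in> U"
  by (simp add: preimage_def)

lemma openin_preimage: "openin (gtop H) U \<Longrightarrow> openin (gtop G) (preimage U)"
  using openin_continuous_map_preimage[OF continuous] by (simp add: preimage_def G.topspace_gtop)

lemma preimage_BG:
  assumes U: "U \<in> carrier H.BG" shows "preimage U \<in> carrier G.BG"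
  unfolding G.mem_BG_iff
proof (intro conjI inj_onI)
  show "openin (gtop G) (preimage U)" using U openin_preimage by (simp add: H.mem_BG_iff)
  fix x y assume "x \<in> preimage U" "y \<in> preimage U"
  then have xy: "x \<in> carrier G" "y \<in> carrier G" "\<alpha> x \<in> U" "\<alpha> y \<in> U" by (auto simp: mem_preimage)
  { assume d: "gdom G x = gdom G y"
    then have "\<alpha> x = \<alpha> y" using H.BG_gdom_inj[OF U xy(3,4)] xy gdom by simp
    then show "x = y" using star_injective xy d by blast }
  { assume r: "gran G x = gran G y"
    then have "\<alpha> x = \<alpha> y" using H.BG_gran_inj[OF U xy(3,4)] xy gran by simp
    \<comment> \<open>Star injectivity compares arrows with equal domains, so equal ranges are
      handled by passing to inverses.\<close>
    then have "ginv G x = ginv G y"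
      by (intro star_injective[of "ginv G x" "ginv G y"])
        (use xy r \<open>\<alpha> x = \<alpha> y\<close> in \<open>simp_all add: G.ginv_closed G.gdom_ginv ginv\<close>)
    then have "ginv G (ginv G x) = ginv G (ginv G y)" by (rule arg_cong)
    then show "x = y" by (simp only: G.ginv_ginv xy) }
qed

text \<open>If \<alpha>(g) = u v, star surjectivity lifts v to some y with the domain of g. Then g =
  (g y^-1) y, and \<alpha>(g y^-1) = u v v^-1 = u.\<close>

lemma preimage_mult:
  assumes V: "V \<in> carrier H.BG"
  shows "preimage (U \<otimes>\<^bsub>H.BG\<^esub> V) = preimage U \<otimes>\<^bsub>G.BG\<^esub> preimage V"
proof (intro equalityI subsetI)
  fix g assume "g \<in> preimage (U \<otimes>\<^bsub>H.BG\<^esub> V)"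
  then obtain u v where g: "g \<in> carrier G" and uv: "u \<in> U" "v \<in> V" "(u, v) \<in> Defs.composable H" "\<alpha> g = u \<cdot>\<^bsub>H\<^esub> v"
    by (auto simp: mem_preimage H.mem_mult_BG)
  have "\<alpha> (gdom G g) = gdom H v" using gdom[OF g] uv H.gdom_gmult by simp
  then obtain y where y: "y \<in> carrier G" "gdom G y = gdom G g" "\<alpha> y = v"
    using star_surjective[OF G.gdom_in_identities[OF g] H.BG_carrier[OF V uv(2)]] by blast
  note c = G.gmult_ginv_gmult[OF g y(1) y(2)[symmetric]]
  have "\<alpha> (g \<cdot>\<^bsub>G\<^esub> ginv G y) = u \<cdot>\<^bsub>H\<^esub> v \<cdot>\<^bsub>H\<^esub> ginv H v"
    using mult[OF c(1)] ginv y uv by simp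
  also have "\<dots> = u" using H.gmult_ginv_cancel[OF uv(3)] .
  finally have "g \<cdot>\<^bsub>G\<^esub> ginv G y \<in> preimage U"
    using uv G.gmult_closed[OF c(1)] by (simp add: mem_preimage)
  moreover have "y \<in> preimage V" using y uv by (simp add: mem_preimage)
  ultimately show "g \<in> preimage U \<otimes>\<^bsub>G.BG\<^esub> preimage V"
    using c(2) c(3)[symmetric] by (rule G.mult_BGI)
next
  fix g assume "g \<in> preimage U \<otimes>\<^bsub>G.BG\<^esub> preimage V"
  then obtain x y where "x \<in> preimage U" "y \<in> preimage V" "(x, y) \<in> Defs.composable G" "g = x \<cdot>\<^bsub>G\<^esub> y"
    by (auto simp: G.mem_mult_BG)
  then show "g \<in> preimage (U \<otimes>\<^bsub>H.BG\<^esub> V)"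
    using G.gmult_closed mult composable by (auto simp: mem_preimage intro: H.mult_BGI)
qed

lemma bisection_map_eq: "U \<in> carrier H.BG \<Longrightarrow> bisection_map G H \<alpha> U = preimage U"
  by (simp add: bisection_map_def preimage_def)

lemma bisection_map_Inv_hom: "bisection_map G H \<alpha> \<in> Inv_hom H.BG G.BG"
proof -
  let ?m = "bisection_map G H \<alpha>"
  interpret BG: pseudogroup G.BG by (rule G.pseudogroup_BG)
  interpret BH: pseudogroup H.BG by (rule H.pseudogroup_BG)
  have "?m \<in> hom H.BG G.BG"
    by (rule homI) (simp_all add: bisection_map_eq preimage_BG preimage_mult)
  moreover have "is_join G.BG (?m J) (?m ` \<A>)" if A: "compatible H.BG \<A>" and J: "is_join H.BG J \<A>" for \<A> J
  proof -
    have sub: "\<A> \<subseteq> carrier H.BG" using A by (simp add: compatible_def)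
    have J': "J = \<Union>\<A>" "J \<in> carrier H.BG"
      using H.is_join_BG_iff[OF sub] H.compatible_Union_BG[OF A] J by auto
    have "?m ` \<A> \<subseteq> carrier G.BG" using sub by (auto simp: bisection_map_eq preimage_BG subset_iff)
    moreover have "?m J = \<Union>(?m ` \<A>)"
    proof -
      have "?m ` \<A> = preimage ` \<A>" using sub by (intro image_cong) (auto simp: bisection_map_eq)
      then show ?thesis using J' by (auto simp: bisection_map_eq mem_preimage)
    qed
    moreover have "?m J \<in> carrier G.BG" using J' by (simp add: bisection_map_eq preimage_BG)
    ultimately show ?thesis using G.is_join_BG_iff[of "?m ` \<A>"] by simp
  qed
  moreover have "is_meet G.BG (?m M) {?m A, ?m B}"
    if AB: "A \<in> carrier H.BG" "B \<in> carrier H.BG" "is_meet H.BG M {A, B}" for A B M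
  proof -
    have "M = A \<inter> B" using H.is_meet_BG_iff AB by blast
    moreover have "M \<in> carrier H.BG" using AB by (simp add: is_glb_natural_order_iff)
    moreover have "preimage (A \<inter> B) = preimage A \<inter> preimage B" by (auto simp: mem_preimage)
    ultimately show ?thesis using AB by (simp add: bisection_map_eq G.is_meet_BG_iff preimage_BG)
  qed
  moreover have "F \<inter> ?m ` carrier H.BG \<noteq> {}" if F: "F \<in> cp_filters G.BG" for F
  proof -
    obtain A where A: "A \<in> F" "A \<in> carrier G.BG" using BG.cp_nonempty[OF F] by blast
    \<comment> \<open>Open bisections cover H, so their preimages cover A; one intersection lies in
      F, and F is upward closed.\<close>
    obtain V where V: "\<exists>U\<in>carrier H.BG. V = preimage U" "A \<inter> V \<in> F"
    proof (rule G.cp_filter_BG_cover[OF F A(1), where P = "\<lambda>V. \<exists>U\<in>carrier H.BG. V = preimage U"])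
      fix x assume x: "x \<in> A"
      then have xc: "x \<in> carrier G" using G.BG_carrier A by blast
      have "\<alpha> x \<in> topspace (gtop H)" using xc closed H.topspace_gtop by simp
      then obtain U where U: "U \<in> carrier H.BG" "\<alpha> x \<in> U" using H.BG_basis[OF openin_topspace] by blast
      then have "openin (gtop G) (preimage U)" "x \<in> preimage U"
        using openin_preimage xc by (auto simp: H.mem_BG_iff mem_preimage)
      then show "\<exists>V. openin (gtop G) V \<and> x \<in> V \<and> (\<exists>U\<in>carrier H.BG. V = preimage U)"
        using U by blast
    qed
    then obtain U where U: "U \<in> carrier H.BG" "V = preimage U" by blast
    have "A \<inter> V \<in> carrier G.BG" using BG.cp_closed[OF F V(2)] .
    then have "A \<inter> V \<sqsubseteq>\<^bsub>natural_order G.BG\<^esub> V"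
      using U preimage_BG by (simp add: G.nle_BG_iff G.mem_BG_iff)
    then have "preimage U \<in> F" using BG.cp_up[OF F V(2)] U preimage_BG by simp
    then have "?m U \<in> F" using U by (simp add: bisection_map_eq)
    then show ?thesis using U by blast
  qed
  ultimately show ?thesis
    by (simp add: Inv_hom_def callitic_def meet_morphism_def pg_morphism_def)
      (simp add: bisection_map_def)
qed

end

section \<open>The adjunction\<close>

context etale_groupoid
begin

definition germ :: "'a \<Rightarrow> 'a set set"
  where "germ g = {A \<in> carrier BG. g \<in> A}"

lemma mem_germ: "A \<in> germ g \<longleftrightarrow> A \<in> carrier BG \<and> g \<in> A"
  by (simp add: germ_def)

lemma germ_cp_filter:
  assumes g: "g \<in> carrier G" shows "germ g \<in> cp_filters BG"
proof -
  interpret B: pseudogroup BG by (rule pseudogroup_BG)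
  show ?thesis
    unfolding B.cp_filters_iff
  proof (intro conjI ballI allI impI)
    show "germ g \<subseteq> carrier BG" by (auto simp: mem_germ)
    have "g \<in> topspace (gtop G)" using g by (simp add: topspace_gtop)
    then show "germ g \<noteq> {}" using BG_basis[OF openin_topspace] by (metis mem_germ empty_iff)
    fix A B assume A: "A \<in> germ g"
    show "B \<in> germ g" if "B \<in> carrier BG" "A \<sqsubseteq>\<^bsub>natural_order BG\<^esub> B"
      using that A by (auto simp: mem_germ nle_BG_iff)
    assume B: "B \<in> germ g"
    have o: "openin (gtop G) (A \<inter> B)" using A B by (auto simp: mem_germ mem_BG_iff)
    then have "A \<inter> B \<in> germ g" using A B BG_subset[OF _ o, of A] by (auto simp: mem_germ)
    then show "\<exists>C\<in>germ g. C \<sqsubseteq>\<^bsub>natural_order BG\<^esub> A \<and> C \<sqsubseteq>\<^bsub>natural_order BG\<^esub> B"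
      using A B o by (intro bexI[of _ "A \<inter> B"]) (auto simp: mem_germ nle_BG_iff)
  next
    fix \<A> J assume h: "compatible BG \<A> \<and> is_join BG J \<A> \<and> J \<in> germ g"
    then have c: "\<A> \<subseteq> carrier BG" by (simp add: compatible_def)
    then have "J = \<Union>\<A>" using h is_join_BG_iff compatible_Union_BG by blast
    then show "\<exists>A\<in>\<A>. A \<in> germ g" using h c by (auto simp: mem_germ)
  qed
qed

lemma obtain_germ:
  assumes g: "g \<in> carrier G"
  obtains A where "A \<in> germ g" "A \<in> carrier BG" "g \<in> A"
proof -
  interpret B: pseudogroup BG by (rule pseudogroup_BG)
  show thesis using that B.cp_nonempty[OF germ_cp_filter[OF g]] mem_germ by blast
qed

text \<open>The domain is tested at a bisection A through g. The only element of A with the range of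
  g is g itself, so g lies in the product of A and X exactly when its domain lies in X.\<close>

lemma gdom_germ:
  assumes g: "g \<in> carrier G" shows "gdom (filter_groupoid BG) (germ g) = germ (gdom G g)"
proof -
  interpret B: pseudogroup BG by (rule pseudogroup_BG)
  obtain A where A: "A \<in> germ g" "A \<in> carrier BG" "g \<in> A" using obtain_germ[OF g] .
  have "g \<in> A \<otimes>\<^bsub>BG\<^esub> X \<longleftrightarrow> gdom G g \<in> X" for X
  proof
    assume "g \<in> A \<otimes>\<^bsub>BG\<^esub> X"
    then obtain a x where h: "a \<in> A" "x \<in> X" "(a, x) \<in> composable G" "g = a \<cdot> x" by (rule mult_BGE)
    have "gran G a = gran G g" using h gran_gmult by simp
    then have "a = g" using BG_gran_inj[OF A(2) h(1) A(3)] by blast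
    then have "x = gdom G g" using ginv_gmult_cancel[OF h(3)] h(4)[symmetric] by (simp add: gdom_def)
    then show "gdom G g \<in> X" using h by simp
  next
    assume "gdom G g \<in> X"
    then show "g \<in> A \<otimes>\<^bsub>BG\<^esub> X"
      using A(3) comp_gdom[OF g] gmult_gdom[OF g, symmetric] by (intro mult_BGI)
  qed
  then have "X \<in> gdom (filter_groupoid BG) (germ g) \<longleftrightarrow> X \<in> germ (gdom G g)" for X
    unfolding B.mem_gdom_FG[OF germ_cp_filter[OF g] A(1)] mem_germ
    using mult_BG_closed[OF A(2)] by blast
  then show ?thesis by blast
qed

lemma ginv_germ:
  assumes g: "g \<in> carrier G" shows "ginv (filter_groupoid BG) (germ g) = germ (ginv G g)"
proof (rule Set.set_eqI)
  interpret B: pseudogroup BG by (rule pseudogroup_BG)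
  fix A
  have "g \<in> ginv G ` A \<longleftrightarrow> ginv G g \<in> A" if "A \<in> carrier BG"
  proof
    show "g \<in> ginv G ` A \<Longrightarrow> ginv G g \<in> A" using BG_carrier[OF that] by (auto simp: ginv_ginv)
    assume "ginv G g \<in> A"
    then have "ginv G (ginv G g) \<in> ginv G ` A" by blast
    then show "g \<in> ginv G ` A" by (simp add: ginv_ginv g)
  qed
  then show "A \<in> ginv (filter_groupoid BG) (germ g) \<longleftrightarrow> A \<in> germ (ginv G g)"
    by (auto simp: B.mem_ginv_FG[OF germ_cp_filter[OF g]] mem_germ sinv_BG ginv_image_BG)
qed

lemma gran_germ:
  assumes g: "g \<in> carrier G" shows "gran (filter_groupoid BG) (germ g) = germ (gran G g)"
proof -
  interpret B: pseudogroup BG by (rule pseudogroup_BG)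
  have "gran (filter_groupoid BG) (germ g) = gdom (filter_groupoid BG) (germ (ginv G g))"
    using B.gdom_ginv_FG[OF germ_cp_filter[OF g]] by (simp add: ginv_germ[OF g])
  then show ?thesis using gdom_germ[of "ginv G g"] g by (simp add: ginv_closed gdom_ginv)
qed

text \<open>The product is the translate by a bisection A through g. Since A has no other element
  with the domain of g, h lies in the product of the inverse of A with X exactly when g \<cdot> h
  lies in X.\<close>

lemma gmult_germ:
  assumes gh: "(g, h) \<in> composable G"
  shows "germ (g \<cdot> h) = germ g \<cdot>\<^bsub>filter_groupoid BG\<^esub> germ h"
proof -
  interpret B: pseudogroup BG by (rule pseudogroup_BG)
  have c: "g \<in> carrier G" "h \<in> carrier G" "gdom G g = gran G h" using gh by (auto simp: composable_iff)
  obtain A where A: "A \<in> germ g" "A \<in> carrier BG" "g \<in> A" using obtain_germ[OF c(1)] .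
  have eq: "germ g \<cdot>\<^bsub>filter_groupoid BG\<^esub> germ h = B.translate A (germ h)"
    using c A(1) by (intro B.gmult_eq_translate germ_cp_filter) (simp_all add: gdom_germ gran_germ)
  have "h \<in> ginv G ` A \<otimes>\<^bsub>BG\<^esub> X \<longleftrightarrow> g \<cdot> h \<in> X" if X: "X \<in> carrier BG" for X
  proof
    assume "h \<in> ginv G ` A \<otimes>\<^bsub>BG\<^esub> X"
    then obtain a x where x: "a \<in> A" "x \<in> X" "(ginv G a, x) \<in> composable G" "h = ginv G a \<cdot> x"
      by (blast elim: mult_BGE)
    have ac: "a \<in> carrier G" using BG_carrier[OF A(2) x(1)] .
    have "gdom G a = gdom G g" using gran_gmult[OF x(3)] x(4) c(3) gran_ginv[OF ac] by simp
    then have "a = g" using BG_gdom_inj[OF A(2) x(1) A(3)] by blast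
    then have "g \<cdot> h = x" using ginv_gmult_cancel[OF x(3)] x(4) c(1) by (simp add: ginv_ginv)
    then show "g \<cdot> h \<in> X" using x by simp
  next
    assume "g \<cdot> h \<in> X"
    moreover have "(ginv G g, g \<cdot> h) \<in> composable G"
      using c gh by (simp add: composable_iff ginv_closed gmult_closed gdom_ginv gran_gmult)
    ultimately show "h \<in> ginv G ` A \<otimes>\<^bsub>BG\<^esub> X"
      using A(3) ginv_gmult_cancel[OF gh] by (intro mult_BGI) auto
  qed
  moreover have "ginv G ` A \<otimes>\<^bsub>BG\<^esub> X \<in> carrier BG" if "X \<in> carrier BG" for X
    using mult_BG_closed ginv_image_BG A(2) that by blast
  ultimately show ?thesis
    by (auto simp: eq B.mem_translate mem_germ sinv_BG[OF A(2)])
qed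

lemma germ_Etale_hom: "(\<lambda>g\<in>carrier G. germ g) \<in> Etale_hom G (filter_groupoid BG)"
proof -
  interpret B: pseudogroup BG by (rule pseudogroup_BG)
  interpret F: groupoid B.FG by (rule B.groupoid_FG)
  have "continuous_map (gtop G) (gtop B.FG) (\<lambda>g\<in>carrier G. germ g)"
  proof (rule B.continuous_map_into_FG)
    fix A assume A: "A \<in> carrier BG"
    \<comment> \<open>The preimage of the basic open set of A is A itself.\<close>
    have "{g \<in> topspace (gtop G). A \<in> (\<lambda>g\<in>carrier G. germ g) g} = A"
      using A BG_subset_carrier[OF A] by (auto simp: topspace_gtop mem_germ)
    then show "openin (gtop G) {g \<in> topspace (gtop G). A \<in> (\<lambda>g\<in>carrier G. germ g) g}"
      using A by (simp add: mem_BG_iff)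
  qed (simp add: topspace_gtop germ_cp_filter)
  moreover have "gfunctor G B.FG (\<lambda>g\<in>carrier G. germ g)"
    unfolding gfunctor_def
    by (auto simp: germ_cp_filter gdom_germ gran_germ gdom_closed gran_closed gmult_closed gmult_germ
        composable_iff)
  moreover have "g = g'" if h: "g \<in> carrier G" "g' \<in> carrier G" "gdom G g = gdom G g'" "germ g = germ g'" for g g'
  proof -
    obtain A where A: "A \<in> germ g" "A \<in> carrier BG" "g \<in> A" using obtain_germ[OF h(1)] .
    then have "g' \<in> A" using h(4) by (simp add: mem_germ)
    then show ?thesis using BG_gdom_inj[OF A(2,3)] h(3) by blast
  qed
  moreover have "\<exists>g\<in>carrier G. gdom G g = e \<and> germ g = F"
    if e: "e \<in> identities G" and F: "F \<in> cp_filters BG" "germ e = gdom B.FG F" for e F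
  proof -
    \<comment> \<open>For A in F, the product of its inverse with A lies in the domain of F, so e =
      a^-1 b with a, b in A. This forces a = b, an arrow with domain e; its germ shares the member A
      and the domain with F.\<close>
    obtain A where A: "A \<in> F" "A \<in> carrier BG" using B.cp_nonempty[OF F(1)] .
    have "ginv G ` A \<otimes>\<^bsub>BG\<^esub> A \<in> germ e"
      using B.sinv_mult_in_gdom[OF F(1) A(1)] F(2) sinv_BG[OF A(2)] by simp
    then obtain a b where ab: "a \<in> A" "b \<in> A" "(ginv G a, b) \<in> composable G" "e = ginv G a \<cdot> b"
      unfolding mem_germ by (blast elim: mult_BGE)
    have c: "a \<in> carrier G" "b \<in> carrier G" using BG_carrier[OF A(2)] ab by auto
    then have "gran G a = gran G b" using ab(3) by (simp add: composable_iff gdom_ginv)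
    then have "a = b" using BG_gran_inj[OF A(2) ab(1,2)] by blast
    then have d: "gdom G a = e" using ab(4) by (simp add: gdom_def)
    have "germ a = F"
      using A ab(1) F d
      by (intro B.cp_filter_eqI[OF germ_cp_filter[OF c(1)] F(1), of A]) (simp_all add: mem_germ gdom_germ c)
    then show ?thesis using c d by blast
  qed
  ultimately show ?thesis
    unfolding Etale_hom_def covering_functor_def by (simp add: identities_iff)
qed

end

section \<open>The counit: basic open sets as bisections\<close>

context pseudogroup
begin

text \<open>Injectivity of ranges reduces to \<open>cp_filter_eqI\<close> applied to the inverse
  filters, which share the member s^-1.\<close>

lemma basic_open_BG:
  assumes s: "s \<in> carrier S" shows "basic_open s \<in> carrier (bisection_monoid FG)"
proof -
  interpret F: etale_groupoid FG by (rule etale_groupoid_FG)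
  have "inj_on (gran FG) (basic_open s)"
  proof (rule inj_onI)
    fix A B assume "A \<in> basic_open s" "B \<in> basic_open s" and r: "gran FG A = gran FG B"
    then have AB: "A \<in> cp_filters S" "B \<in> cp_filters S" "s \<in> A" "s \<in> B" by (auto simp: mem_basic_open)
    have "ginv FG A \<in> cp_filters S" "ginv FG B \<in> cp_filters S"
      using AB sinv_image_cp_filter by (simp_all add: ginv_FG)
    moreover have "sinv S s \<in> ginv FG A" "sinv S s \<in> ginv FG B" using AB by (simp_all add: ginv_FG)
    moreover have "gdom FG (ginv FG A) = gdom FG (ginv FG B)" using AB r by (simp add: gdom_ginv_FG)
    ultimately have "ginv FG A = ginv FG B" by (rule cp_filter_eqI)
    then have "ginv FG (ginv FG A) = ginv FG (ginv FG B)" by (rule arg_cong)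
    then show "A = B" by (simp only: ginv_ginv_FG AB)
  qed
  then show ?thesis using openin_basic_open inj_on_gdom_basic_open by (simp add: F.mem_BG_iff)
qed

text \<open>To factor a filter A containing s t, note that (s t)^-1 (s t) \<le> t^-1 t, so t^-1 t
  lies in the domain of A. Translating that domain by t gives the right factor C, and the left
  factor A C^-1 contains s t t^-1, hence s.\<close>

lemma basic_open_mult:
  assumes s: "s \<in> carrier S" and t: "t \<in> carrier S"
  shows "basic_open (s \<otimes> t) = basic_open s \<otimes>\<^bsub>bisection_monoid FG\<^esub> basic_open t"
proof (intro equalityI subsetI)
  interpret F: etale_groupoid FG by (rule etale_groupoid_FG)
  fix A
  { assume "A \<in> basic_open s \<otimes>\<^bsub>bisection_monoid FG\<^esub> basic_open t"
    then obtain B C where "B \<in> basic_open s" "C \<in> basic_open t" "(B, C) \<in> composable FG" "A = B \<cdot>\<^bsub>FG\<^esub> C"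
      by (rule F.mult_BGE)
    then show "A \<in> basic_open (s \<otimes> t)"
      using mult_in_gmult_FG F.gmult_closed by (auto simp: mem_basic_open) }
  { assume "A \<in> basic_open (s \<otimes> t)"
    then have A: "A \<in> cp_filters S" "s \<otimes> t \<in> A" by (auto simp: mem_basic_open)
    let ?D = "gdom FG A"
    have D: "?D \<in> cp_filters S" "gran FG ?D = ?D" "gdom FG ?D = ?D"
      using A gdom_cp_filter gran_gdom_FG gdom_gdom_FG by auto
    have "sinv S (s \<otimes> t) \<otimes> (s \<otimes> t) \<preceq> sinv S t \<otimes> t"
    proof -
      have "sinv S t \<otimes> (sinv S s \<otimes> (s \<otimes> t)) \<preceq> sinv S t \<otimes> t"
        using s t by (intro nle_mult_left nle_sinv_mult_mult) auto
      then show ?thesis using s t by (simp add: sinv_mult m_assoc)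
    qed
    then have e: "sinv S t \<otimes> t \<in> ?D" using cp_up[OF D(1) sinv_mult_in_gdom[OF A]] s t by simp
    define C where "C = translate t ?D"
    have C: "C \<in> cp_filters S" "gdom FG C = ?D" "t \<in> C"
      using translate_cp_filter[OF D(1) t] gdom_translate[OF D(1) t] e t D
      by (simp_all add: C_def mem_translate)
    note AC = F.gmult_ginv_gmult[of A C, simplified, OF A(1) C(1) C(2)[symmetric]]
    let ?B = "A \<cdot>\<^bsub>FG\<^esub> ginv FG C"
    have B: "?B \<in> cp_filters S" using F.gmult_closed[OF AC(1)] by simp
    have "s \<otimes> t \<otimes> sinv S t \<in> ?B"
      using A C AC(1) by (intro mult_in_gmult_FG) (auto simp: F.composable_iff, simp add: ginv_FG)
    moreover have "s \<otimes> t \<otimes> sinv S t \<preceq> s" using s t nleI[of "t \<otimes> sinv S t" s] by (simp add: m_assoc)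
    ultimately have "s \<in> ?B" using cp_up[OF B] s by blast
    then show "A \<in> basic_open s \<otimes>\<^bsub>bisection_monoid FG\<^esub> basic_open t"
      using B C AC(2) AC(3)[symmetric] by (intro F.mult_BGI[of ?B _ C]) (simp_all add: mem_basic_open) }
qed

text \<open>Primeness turns joins into unions and directedness turns meets into intersections. The
  image condition holds because filters are non-empty, so that the basic open sets cover.\<close>

lemma basic_open_Inv_hom: "(\<lambda>s\<in>carrier S. basic_open s) \<in> Inv_hom S (bisection_monoid FG)"
proof -
  interpret F: etale_groupoid FG by (rule etale_groupoid_FG)
  interpret B: pseudogroup F.BG by (rule F.pseudogroup_BG)
  let ?m = "\<lambda>s\<in>carrier S. basic_open s"
  have "?m \<in> hom S F.BG"
    by (rule homI) (simp_all add: basic_open_BG basic_open_mult)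
  moreover have "is_join F.BG (?m j) (?m ` A)" if A: "compatible S A" and j: "is_join S j A" for A j
  proof -
    have sub: "A \<subseteq> carrier S" using A by (rule compatible_subset)
    have jc: "j \<in> carrier S" "\<And>a. a \<in> A \<Longrightarrow> a \<preceq> j" using j sub by (auto simp: is_lub_natural_order_iff)
    have "?m ` A = basic_open ` A" using sub by (intro image_cong) auto
    moreover have "?m j = \<Union>(basic_open ` A)"
    proof -
      have "F \<in> basic_open j \<longleftrightarrow> F \<in> \<Union>(basic_open ` A)" for F
      proof
        assume "F \<in> basic_open j"
        then have "F \<in> cp_filters S" "j \<in> F" by (auto simp: mem_basic_open)
        then obtain a where "a \<in> A" "a \<in> F" using cp_prime[OF _ A j] by blast
        then show "F \<in> \<Union>(basic_open ` A)" using \<open>F \<in> cp_filters S\<close> by (auto simp: mem_basic_open)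
      next
        assume "F \<in> \<Union>(basic_open ` A)"
        then show "F \<in> basic_open j" using cp_up jc by (auto simp: mem_basic_open)
      qed
      then show ?thesis using jc by auto
    qed
    moreover have "basic_open ` A \<subseteq> carrier F.BG" "?m j \<in> carrier F.BG"
      using sub basic_open_BG jc by auto
    ultimately show ?thesis using F.is_join_BG_iff[of "basic_open ` A"] by simp
  qed
  moreover have "is_meet F.BG (?m m) {?m a, ?m b}"
    if "a \<in> carrier S" "b \<in> carrier S" "is_meet S m {a, b}" for a b m
  proof -
    have "m \<in> carrier S" using that by (simp add: is_glb_natural_order_iff)
    then show ?thesis using that by (simp add: F.is_meet_BG_iff basic_open_BG basic_open_meet)
  qed
  moreover have "\<F> \<inter> ?m ` carrier S \<noteq> {}" if \<F>: "\<F> \<in> cp_filters F.BG" for \<F>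
  proof -
    obtain U where U: "U \<in> \<F>" "U \<in> carrier F.BG" using B.cp_nonempty[OF \<F>] .
    obtain V where V: "\<exists>s\<in>carrier S. V = basic_open s" "U \<inter> V \<in> \<F>"
    proof (rule F.cp_filter_BG_cover[OF \<F> U(1), where P = "\<lambda>V. \<exists>s\<in>carrier S. V = basic_open s"])
      fix F assume "F \<in> U"
      then have F: "F \<in> cp_filters S" using F.BG_carrier[OF U(2)] by simp
      then obtain s where "s \<in> F" "s \<in> carrier S" using cp_nonempty by blast
      then show "\<exists>V. openin (gtop FG) V \<and> F \<in> V \<and> (\<exists>s\<in>carrier S. V = basic_open s)"
        using F openin_basic_open by (auto simp: mem_basic_open intro!: exI[of _ "basic_open s"])
    qed
    then obtain s where s: "s \<in> carrier S" "V = basic_open s" by blast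
    have "U \<inter> V \<in> carrier F.BG" using B.cp_closed[OF \<F> V(2)] .
    then have "U \<inter> V \<sqsubseteq>\<^bsub>natural_order F.BG\<^esub> V"
      using s basic_open_BG by (simp add: F.nle_BG_iff F.mem_BG_iff)
    then have "?m s \<in> \<F>" using B.cp_up[OF \<F> V(2)] s basic_open_BG by simp
    then show ?thesis using s by blast
  qed
  ultimately show ?thesis
    by (simp add: Inv_hom_def callitic_def meet_morphism_def pg_morphism_def)
qed

end

section \<open>Functor laws\<close>

lemma filter_map_id:
  assumes "pseudogroup S"
  shows "filter_map S S (restrict id (carrier S)) = restrict id (carrier (filter_groupoid S))"
proof -
  interpret pseudogroup S by fact
  show ?thesis using cp_closed by (fastforce simp: filter_map_def fun_eq_iff)
qed

lemma filter_map_compose: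
  assumes T: "pseudogroup T" and U: "pseudogroup U" and \<psi>: "\<psi> \<in> Inv_hom T U"
    and \<theta>: "\<theta> \<in> carrier S \<rightarrow> carrier T"
  shows "filter_map S U (compose (carrier S) \<psi> \<theta>) =
    compose (carrier (filter_groupoid U)) (filter_map S T \<theta>) (filter_map T U \<psi>)"
proof -
  interpret callitic_morphism T U \<psi> using T U \<psi> by (rule Inv_hom_callitic_morphism)
  show ?thesis
    using \<theta> by (auto simp: fun_eq_iff compose_def filter_map_def[of S U] filter_map_eq
        filter_map_def[of S T] preimage_cp_filter mem_preimage Pi_iff)
qed

lemma Etale_hom_etale_morphism:
  "\<lbrakk>etale_groupoid G; etale_groupoid H; \<alpha> \<in> Etale_hom G H\<rbrakk> \<Longrightarrow> etale_morphism G H \<alpha>"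
  by (simp add: etale_morphism_def etale_morphism_axioms_def)

lemma bisection_map_id:
  assumes "etale_groupoid G"
  shows "bisection_map G G (restrict id (carrier G)) = restrict id (carrier (bisection_monoid G))"
proof -
  interpret etale_groupoid G by fact
  show ?thesis using BG_carrier by (fastforce simp: bisection_map_def fun_eq_iff)
qed

lemma bisection_map_compose:
  assumes H: "etale_groupoid H" and K: "etale_groupoid K" and \<beta>: "\<beta> \<in> Etale_hom H K"
    and \<alpha>: "\<alpha> \<in> carrier G \<rightarrow> carrier H"
  shows "bisection_map G K (compose (carrier G) \<beta> \<alpha>) =
    compose (carrier (bisection_monoid K)) (bisection_map G H \<alpha>) (bisection_map H K \<beta>)"
proof -
  interpret etale_morphism H K \<beta> using H K \<beta> by (rule Etale_hom_etale_morphism)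
  show ?thesis
    using \<alpha> by (auto simp: fun_eq_iff compose_def bisection_map_def[of G K] bisection_map_eq
        bisection_map_def[of G H] preimage_BG mem_preimage Pi_iff)
qed

lemma Inv_hom_funcset: "\<theta> \<in> Inv_hom S T \<Longrightarrow> \<theta> \<in> carrier S \<rightarrow> carrier T"
  by (simp add: Inv_hom_def callitic_def meet_morphism_def pg_morphism_def hom_def)

lemma Etale_hom_funcset: "\<alpha> \<in> Etale_hom G H \<Longrightarrow> \<alpha> \<in> carrier G \<rightarrow> carrier H"
  by (simp add: Etale_hom_def covering_functor_def gfunctor_def)

section \<open>The bijection of hom-sets and its naturality\<close>

lemma transpose_arrow_Etale_hom:
  assumes S: "pseudogroup S" and G: "etale_groupoid G" and \<phi>: "\<phi> \<in> Inv_hom S (bisection_monoid G)"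
  shows "transpose_arrow S G \<phi> \<in> Etale_hom G (filter_groupoid S)"
proof -
  interpret G: etale_groupoid G by fact
  interpret callitic_morphism S G.BG \<phi>
    using S G.pseudogroup_BG \<phi> by (rule Inv_hom_callitic_morphism)
  have "compose (carrier G) (filter_map S G.BG \<phi>) (\<lambda>g\<in>carrier G. G.germ g) \<in> Etale_hom G (filter_groupoid S)"
    using G T.etale_groupoid_FG G.germ_Etale_hom filter_map_Etale_hom by (rule Etale_hom_compose)
  \<comment> \<open>Membership of s in the composite at g says that \<phi>(s) is in the germ of g;
    as \<phi>(s) is an open bisection, this is just g \<in> \<phi>(s).\<close>
  also have "compose (carrier G) (filter_map S G.BG \<phi>) (\<lambda>g\<in>carrier G. G.germ g) = transpose_arrow S G \<phi>"
    using closed by (auto simp: fun_eq_iff compose_def transpose_arrow_def filter_map_eq G.germ_cp_filter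
        mem_preimage G.mem_germ)
  finally show ?thesis .
qed

text \<open>The transpose records the relation g \<in> \<phi>(s) with the roles of s and g
  exchanged. It determines \<phi> because every \<phi>(s) is contained in the carrier of G.\<close>

lemma bij_betw_transpose_arrow:
  assumes S: "pseudogroup S" and G: "etale_groupoid G"
  shows "bij_betw (transpose_arrow S G) (Inv_hom S (bisection_monoid G)) (Etale_hom G (filter_groupoid S))"
  unfolding bij_betw_def
proof (intro conjI inj_onI equalityI subsetI)
  interpret S: pseudogroup S by fact
  interpret G: etale_groupoid G by fact
  fix \<phi> \<psi> assume h: "\<phi> \<in> Inv_hom S G.BG" "\<psi> \<in> Inv_hom S G.BG"
    "transpose_arrow S G \<phi> = transpose_arrow S G \<psi>"
  show "\<phi> = \<psi>"
  proof (rule extensionalityI)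
    show "\<phi> \<in> extensional (carrier S)" "\<psi> \<in> extensional (carrier S)" using h by (auto simp: Inv_hom_def)
    fix s assume s: "s \<in> carrier S"
    have "\<phi> s \<subseteq> carrier G" "\<psi> s \<subseteq> carrier G"
      using h(1,2)[THEN Inv_hom_funcset] s G.BG_subset_carrier by (simp_all add: Pi_iff)
    moreover have "g \<in> \<phi> s \<longleftrightarrow> g \<in> \<psi> s" if "g \<in> carrier G" for g
    proof -
      have "{s \<in> carrier S. g \<in> \<phi> s} = {s \<in> carrier S. g \<in> \<psi> s}"
        using fun_cong[OF h(3), of g] that by (simp add: transpose_arrow_def)
      then show ?thesis using s by blast
    qed
    ultimately show "\<phi> s = \<psi> s" by blast
  qed
next
  fix \<alpha> assume "\<alpha> \<in> transpose_arrow S G ` Inv_hom S (bisection_monoid G)"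
  then show "\<alpha> \<in> Etale_hom G (filter_groupoid S)" using transpose_arrow_Etale_hom[OF S G] by blast
next
  interpret S: pseudogroup S by fact
  interpret F: etale_groupoid S.FG by (rule S.etale_groupoid_FG)
  fix \<alpha> assume \<alpha>: "\<alpha> \<in> Etale_hom G S.FG"
  interpret etale_morphism G S.FG \<alpha>
    using G S.etale_groupoid_FG \<alpha> by (rule Etale_hom_etale_morphism)
  \<comment> \<open>For this candidate, g \<in> \<phi>(s) iff \<alpha>(g) is in the basic open set
    of s iff s \<in> \<alpha>(g).\<close>
  let ?\<phi> = "compose (carrier S) (bisection_map G S.FG \<alpha>) (\<lambda>s\<in>carrier S. S.basic_open s)"
  have "?\<phi> \<in> Inv_hom S G.BG"
    using S F.pseudogroup_BG G.pseudogroup_BG S.basic_open_Inv_hom bisection_map_Inv_hom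
    by (rule Inv_hom_compose)
  moreover have "\<alpha> = transpose_arrow S G ?\<phi>"
  proof (rule extensionalityI)
    show "\<alpha> \<in> extensional (carrier G)" using \<alpha> by (simp add: Etale_hom_def)
    show "transpose_arrow S G ?\<phi> \<in> extensional (carrier G)" by (simp add: transpose_arrow_def)
    fix g assume g: "g \<in> carrier G"
    have "\<alpha> g \<in> cp_filters S" using closed[OF g] by simp
    then show "\<alpha> g = transpose_arrow S G ?\<phi> g"
      using g S.cp_closed
      by (auto simp: transpose_arrow_def compose_eq bisection_map_eq S.basic_open_BG mem_preimage S.mem_basic_open)
  qed
  ultimately show "\<alpha> \<in> transpose_arrow S G ` Inv_hom S G.BG" by blast
qed

text \<open>At an arrow g of G' both sides are the set of s in S' with \<alpha>(g) \<in>
  \<phi>(\<theta>(s)).\<close>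

lemma transpose_arrow_natural:
  assumes S: "pseudogroup S" and G: "etale_groupoid G" and G': "etale_groupoid G'"
    and \<theta>: "\<theta> \<in> Inv_hom S' S" and \<phi>: "\<phi> \<in> Inv_hom S (bisection_monoid G)" and \<alpha>: "\<alpha> \<in> Etale_hom G' G"
  shows "transpose_arrow S' G'
      (compose (carrier S') (bisection_map G' G \<alpha>) (compose (carrier S') \<phi> \<theta>)) =
    compose (carrier G') (filter_map S' S \<theta>) (compose (carrier G') (transpose_arrow S G \<phi>) \<alpha>)"
proof
  fix g
  interpret etale_morphism G' G \<alpha> using G' G \<alpha> by (rule Etale_hom_etale_morphism)
  show "transpose_arrow S' G'
      (compose (carrier S') (bisection_map G' G \<alpha>) (compose (carrier S') \<phi> \<theta>)) g =
    compose (carrier G') (filter_map S' S \<theta>) (compose (carrier G') (transpose_arrow S G \<phi>) \<alpha>) g"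
  proof (cases "g \<in> carrier G'")
    case True
    have \<theta>c: "\<theta> s \<in> carrier S" if "s \<in> carrier S'" for s using Inv_hom_funcset[OF \<theta>] that by blast
    have \<phi>c: "\<phi> s \<in> carrier H.BG" if "s \<in> carrier S" for s using Inv_hom_funcset[OF \<phi>] that by blast
    \<comment> \<open>The map \<open>filter_map\<close> is restricted to completely prime filters,
      so its argument must be known to be one before it can be evaluated.\<close>
    have "transpose_arrow S G \<phi> (\<alpha> g) \<in> cp_filters S"
      using Etale_hom_funcset[OF transpose_arrow_Etale_hom[OF S G \<phi>]] closed[OF True]
      by (auto simp: Pi_iff filter_groupoid_def)
    then show ?thesis
      using True \<theta>c \<phi>c closed[OF True]
      by (auto simp: compose_eq filter_map_def transpose_arrow_def bisection_map_eq mem_preimage)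
  qed (simp add: transpose_arrow_def compose_def)
qed

text \<open>Objects joined by a morphism may live in different types, hence the separate type
  variables. The naturality clause moves both variables at once; taking \<theta> or \<alpha> to be
  an identity gives naturality in the other variable.\<close>

theorem theorem2p22:
  shows
    \<comment> \<open>Inv is a category\<close>
    "(\<forall>S::'a monoid. pseudogroup S \<longrightarrow> restrict id (carrier S) \<in> Inv_hom S S) \<and>
     (\<forall>(S::'a monoid) (T::'c monoid) (U::'e monoid). \<forall>\<theta> \<psi>.
        pseudogroup S \<and> pseudogroup T \<and> pseudogroup U \<and> \<theta> \<in> Inv_hom S T \<and> \<psi> \<in> Inv_hom T U \<longrightarrow>
        compose (carrier S) \<psi> \<theta> \<in> Inv_hom S U) \<and>
     \<comment> \<open>Etale is a category\<close>
     (\<forall>G::'b top_groupoid. etale_groupoid G \<longrightarrow> restrict id (carrier G) \<in> Etale_hom G G) \<and>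
     (\<forall>(G::'b top_groupoid) (H::'d top_groupoid) (K::'f top_groupoid). \<forall>\<alpha> \<beta>.
        etale_groupoid G \<and> etale_groupoid H \<and> etale_groupoid K \<and>
        \<alpha> \<in> Etale_hom G H \<and> \<beta> \<in> Etale_hom H K \<longrightarrow>
        compose (carrier G) \<beta> \<alpha> \<in> Etale_hom G K) \<and>
     \<comment> \<open>completely prime filters: a contravariant functor from Inv to Etale\<close>
     (\<forall>S::'a monoid. pseudogroup S \<longrightarrow> etale_groupoid (filter_groupoid S)) \<and>
     (\<forall>(S::'a monoid) (T::'c monoid). \<forall>\<theta>.
        pseudogroup S \<and> pseudogroup T \<and> \<theta> \<in> Inv_hom S T \<longrightarrow>
        filter_map S T \<theta> \<in> Etale_hom (filter_groupoid T) (filter_groupoid S)) \<and>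
     (\<forall>S::'a monoid. pseudogroup S \<longrightarrow>
        filter_map S S (restrict id (carrier S)) = restrict id (carrier (filter_groupoid S))) \<and>
     (\<forall>(S::'a monoid) (T::'c monoid) (U::'e monoid). \<forall>\<theta> \<psi>.
        pseudogroup S \<and> pseudogroup T \<and> pseudogroup U \<and> \<theta> \<in> Inv_hom S T \<and> \<psi> \<in> Inv_hom T U \<longrightarrow>
        filter_map S U (compose (carrier S) \<psi> \<theta>) =
          compose (carrier (filter_groupoid U)) (filter_map S T \<theta>) (filter_map T U \<psi>)) \<and>
     \<comment> \<open>open bisections: a contravariant functor from Etale to Inv\<close>
     (\<forall>G::'b top_groupoid. etale_groupoid G \<longrightarrow> pseudogroup (bisection_monoid G)) \<and>
     (\<forall>(G::'b top_groupoid) (H::'d top_groupoid). \<forall>\<alpha>.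
        etale_groupoid G \<and> etale_groupoid H \<and> \<alpha> \<in> Etale_hom G H \<longrightarrow>
        bisection_map G H \<alpha> \<in> Inv_hom (bisection_monoid H) (bisection_monoid G)) \<and>
     (\<forall>G::'b top_groupoid. etale_groupoid G \<longrightarrow>
        bisection_map G G (restrict id (carrier G)) =
          restrict id (carrier (bisection_monoid G))) \<and>
     (\<forall>(G::'b top_groupoid) (H::'d top_groupoid) (K::'f top_groupoid). \<forall>\<alpha> \<beta>.
        etale_groupoid G \<and> etale_groupoid H \<and> etale_groupoid K \<and>
        \<alpha> \<in> Etale_hom G H \<and> \<beta> \<in> Etale_hom H K \<longrightarrow>
        bisection_map G K (compose (carrier G) \<beta> \<alpha>) =
          compose (carrier (bisection_monoid K)) (bisection_map G H \<alpha>) (bisection_map H K \<beta>)) \<and>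
     \<comment> \<open>the adjunction: bijections of hom-sets, natural in both variables\<close>
     (\<forall>(S::'a monoid) (G::'b top_groupoid). pseudogroup S \<and> etale_groupoid G \<longrightarrow>
        bij_betw (transpose_arrow S G)
          (Inv_hom S (bisection_monoid G)) (Etale_hom G (filter_groupoid S))) \<and>
     (\<forall>(S'::'c monoid) (S::'a monoid) (G::'b top_groupoid) (G'::'d top_groupoid). \<forall>\<theta> \<phi> \<alpha>.
        pseudogroup S' \<and> pseudogroup S \<and> etale_groupoid G \<and> etale_groupoid G' \<and>
        \<theta> \<in> Inv_hom S' S \<and> \<phi> \<in> Inv_hom S (bisection_monoid G) \<and> \<alpha> \<in> Etale_hom G' G \<longrightarrow>
        transpose_arrow S' G'
            (compose (carrier S') (bisection_map G' G \<alpha>) (compose (carrier S') \<phi> \<theta>)) =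
          compose (carrier G') (filter_map S' S \<theta>)
            (compose (carrier G') (transpose_arrow S G \<phi>) \<alpha>))"
proof (intro conjI allI impI; (elim conjE)?)
  show "restrict id (carrier S) \<in> Inv_hom S S" if "pseudogroup S" for S :: "'a monoid"
    using that by (rule Inv_hom_id)
  show "compose (carrier S) \<psi> \<theta> \<in> Inv_hom S U"
    if "pseudogroup S" "pseudogroup T" "pseudogroup U" "\<theta> \<in> Inv_hom S T" "\<psi> \<in> Inv_hom T U"
    for S :: "'a monoid" and T :: "'c monoid" and U :: "'e monoid" and \<theta> \<psi>
    using that by (rule Inv_hom_compose)
  show "restrict id (carrier G) \<in> Etale_hom G G" if "etale_groupoid G" for G :: "'b top_groupoid"
    using that by (rule Etale_hom_id)
  show "compose (carrier G) \<beta> \<alpha> \<in> Etale_hom G K"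
    if "etale_groupoid G" "etale_groupoid H" "\<alpha> \<in> Etale_hom G H" "\<beta> \<in> Etale_hom H K"
    for G :: "'b top_groupoid" and H :: "'d top_groupoid" and K :: "'f top_groupoid" and \<alpha> \<beta>
    using that by (rule Etale_hom_compose)
  show "etale_groupoid (filter_groupoid S)" if "pseudogroup S" for S :: "'a monoid"
    using that by (rule pseudogroup.etale_groupoid_FG)
  show "filter_map S T \<theta> \<in> Etale_hom (filter_groupoid T) (filter_groupoid S)"
    if "pseudogroup S" "pseudogroup T" "\<theta> \<in> Inv_hom S T"
    for S :: "'a monoid" and T :: "'c monoid" and \<theta>
    using callitic_morphism.filter_map_Etale_hom[OF Inv_hom_callitic_morphism[OF that]] .
  show "filter_map S S (restrict id (carrier S)) = restrict id (carrier (filter_groupoid S))"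
    if "pseudogroup S" for S :: "'a monoid"
    using that by (rule filter_map_id)
  show "filter_map S U (compose (carrier S) \<psi> \<theta>) =
      compose (carrier (filter_groupoid U)) (filter_map S T \<theta>) (filter_map T U \<psi>)"
    if "pseudogroup T" "pseudogroup U" "\<theta> \<in> Inv_hom S T" "\<psi> \<in> Inv_hom T U"
    for S :: "'a monoid" and T :: "'c monoid" and U :: "'e monoid" and \<theta> \<psi>
    using that(1,2,4) Inv_hom_funcset[OF that(3)] by (rule filter_map_compose)
  show "pseudogroup (bisection_monoid G)" if "etale_groupoid G" for G :: "'b top_groupoid"
    using that by (rule etale_groupoid.pseudogroup_BG)
  show "bisection_map G H \<alpha> \<in> Inv_hom (bisection_monoid H) (bisection_monoid G)"
    if "etale_groupoid G" "etale_groupoid H" "\<alpha> \<in> Etale_hom G H"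
    for G :: "'b top_groupoid" and H :: "'d top_groupoid" and \<alpha>
    using etale_morphism.bisection_map_Inv_hom[OF Etale_hom_etale_morphism[OF that]] .
  show "bisection_map G G (restrict id (carrier G)) = restrict id (carrier (bisection_monoid G))"
    if "etale_groupoid G" for G :: "'b top_groupoid"
    using that by (rule bisection_map_id)
  show "bisection_map G K (compose (carrier G) \<beta> \<alpha>) =
      compose (carrier (bisection_monoid K)) (bisection_map G H \<alpha>) (bisection_map H K \<beta>)"
    if "etale_groupoid H" "etale_groupoid K" "\<alpha> \<in> Etale_hom G H" "\<beta> \<in> Etale_hom H K"
    for G :: "'b top_groupoid" and H :: "'d top_groupoid" and K :: "'f top_groupoid" and \<alpha> \<beta>
    using that(1,2,4) Etale_hom_funcset[OF that(3)] by (rule bisection_map_compose)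
  show "bij_betw (transpose_arrow S G) (Inv_hom S (bisection_monoid G)) (Etale_hom G (filter_groupoid S))"
    if "pseudogroup S" "etale_groupoid G" for S :: "'a monoid" and G :: "'b top_groupoid"
    using that by (rule bij_betw_transpose_arrow)
  show "transpose_arrow S' G'
        (compose (carrier S') (bisection_map G' G \<alpha>) (compose (carrier S') \<phi> \<theta>)) =
      compose (carrier G') (filter_map S' S \<theta>)
        (compose (carrier G') (transpose_arrow S G \<phi>) \<alpha>)"
    if "pseudogroup S" "etale_groupoid G" "etale_groupoid G'"
      "\<theta> \<in> Inv_hom S' S" "\<phi> \<in> Inv_hom S (bisection_monoid G)" "\<alpha> \<in> Etale_hom G' G"
    for S' :: "'c monoid" and S :: "'a monoid" and G :: "'b top_groupoid" and G' :: "'d top_groupoid"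
      and \<theta> \<phi> \<alpha>
    using that by (rule transpose_arrow_natural)
qed

end
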